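(* Let $t\geq 1$ and $r\geq 2$ be integers, let $a_{1}\geq a_{2}\geq\cdots\geq a_{t}\geq 3$ and $\ell_{1}\geq \ell_{2}\geq\cdots\geq \ell_{r}\geq 2$ be integers, and let $F=\left(\bigcup_{1\leq i\leq t}K_{1,a_{i}}\right)\cup \left(\bigcup_{1\leq j\leq r}P_{\ell_{j}}\right)$ (disjoint union). Set $b=\sum_{1\leq j\leq r}\left\lfloor\frac{\ell_{j}}{2}\right\rfloor$. Then for all sufficiently large $n$ (i.e. for all $n\geq n_0$ for some $n_0$ depending only on $F$), each graph in $\mathrm{EX}(n,F)$ is (up to isomorphism) either a graph in $\mathrm{EX}\left(n,\bigcup_{1\leq i\leq t}K_{1,a_{i}}\right)$, or one of the following graphs: (i) the graph obtained from $K_{t+b-1}\vee\overline{K_{n-t-b+1}}$ by adding a maximum matching in the part $\overline{K_{n-t-b+1}}$ (that is, $\lfloor (n-t-b+1)/2\rfloor$ pairwise disjoint edges), when $\ell_{j}=3$ for every $1\leq j\leq r$; (ii) $K_{t+b-1}\vee\left(K_{2}\cup \overline{K_{n-t-b-1}}\right)$, when all $\ell_{j}$ are odd and at least one of them is not $3$; (iii) $K_{t+b-1}\vee\overline{K_{n-t-b+1}}$, when at least one of the $\ell_{j}$ with $1\leq j\leq r$ is even.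
   Context: All graphs are finite, undirected and simple. $K_n$ and $P_n$ denote the complete graph and the path on $n$ vertices; $K_{1,d}$ is the star on $d+1$ vertices; $\overline{G}$ is the complement of $G$ (so $\overline{K_m}$ is the edgeless graph on $m$ vertices). $G_1\cup G_2$ denotes the disjoint union, and $G_1\vee G_2$ denotes the join, obtained from the disjoint union by connecting each vertex of $G_1$ to each vertex of $G_2$. A graph $G$ is $F$-free if it does not contain $F$ as a (not necessarily induced) subgraph. $\mathrm{EX}(n,F)$ denotes the set of $F$-free graphs of order $n$ with the maximum number of edges; its members are called the extremal graphs of order $n$ for $F$. *)

theory Defs
  imports "HOL-Library.Disjoint_Sets"
begin

record 'a graph =
  verts :: "'a set"
  edges :: "'a set set"

definition simple_graph :: "'a graph \<Rightarrow> bool" where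
  "simple_graph G \<longleftrightarrow>
     finite (verts G) \<and> (\<forall>e\<in>edges G. e \<subseteq> verts G \<and> card e = 2)"

definition graph_order :: "'a graph \<Rightarrow> nat" where
  "graph_order G = card (verts G)"

definition graph_iso :: "'a graph \<Rightarrow> 'b graph \<Rightarrow> bool" (infix "\<simeq>\<^sub>g" 50) where
  "G \<simeq>\<^sub>g H \<longleftrightarrow>
     (\<exists>f. bij_betw f (verts G) (verts H) \<and>
          (\<forall>u\<in>verts G. \<forall>v\<in>verts G. {u, v} \<in> edges G \<longleftrightarrow> {f u, f v} \<in> edges H))"

definition subgraph :: "'a graph \<Rightarrow> 'a graph \<Rightarrow> bool" where
  "subgraph H G \<longleftrightarrow> simple_graph H \<and> verts H \<subseteq> verts G \<and> edges H \<subseteq> edges G"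

definition graph_free :: "'b graph \<Rightarrow> 'a graph \<Rightarrow> bool" where
  "graph_free F G \<longleftrightarrow> \<not> (\<exists>H. subgraph H G \<and> H \<simeq>\<^sub>g F)"

(* Every finite graph has an isomorphic copy with vertices in nat, so it is enough to let
   extremal graphs (and their competitors) range over graphs whose vertex set is a finite
   set of natural numbers; extremal_graphs n F is closed under isomorphism of such graphs. *)
definition extremal_graphs :: "nat \<Rightarrow> 'b graph \<Rightarrow> nat graph set" where
  "extremal_graphs n F =
     {G. simple_graph G \<and> graph_order G = n \<and> graph_free F G \<and>
         (\<forall>H :: nat graph. simple_graph H \<and> graph_order H = n \<and> graph_free F H
            \<longrightarrow> card (edges H) \<le> card (edges G))}"

definition complete_graph :: "nat \<Rightarrow> nat graph" where
  "complete_graph n =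
     \<lparr>verts = {..<n}, edges = {{u, v} | u v. u < n \<and> v < n \<and> u \<noteq> v}\<rparr>"

definition path_graph :: "nat \<Rightarrow> nat graph" where
  "path_graph n = \<lparr>verts = {..<n}, edges = {{i, Suc i} | i. Suc i < n}\<rparr>"

(* The star with d leaves; its centre is 0. *)
definition star_graph :: "nat \<Rightarrow> nat graph" where
  "star_graph d = \<lparr>verts = {..d}, edges = {{0, i} | i. 1 \<le> i \<and> i \<le> d}\<rparr>"

definition graph_complement :: "'a graph \<Rightarrow> 'a graph" where
  "graph_complement G =
     \<lparr>verts = verts G,
      edges = {{u, v} | u v. u \<in> verts G \<and> v \<in> verts G \<and> u \<noteq> v \<and> {u, v} \<notin> edges G}\<rparr>"

definition graph_union :: "'a graph \<Rightarrow> 'b graph \<Rightarrow> ('a + 'b) graph" where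
  "graph_union G H =
     \<lparr>verts = verts G <+> verts H,
      edges = (\<lambda>e. Inl ` e) ` edges G \<union> (\<lambda>e. Inr ` e) ` edges H\<rparr>"

definition graph_Union :: "'i set \<Rightarrow> ('i \<Rightarrow> 'a graph) \<Rightarrow> ('i \<times> 'a) graph" where
  "graph_Union I G =
     \<lparr>verts = (SIGMA i:I. verts (G i)),
      edges = (\<Union>i\<in>I. (\<lambda>e. Pair i ` e) ` edges (G i))\<rparr>"

definition graph_join :: "'a graph \<Rightarrow> 'b graph \<Rightarrow> ('a + 'b) graph" where
  "graph_join G H =
     \<lparr>verts = verts (graph_union G H),
      edges = edges (graph_union G H) \<union> {{Inl u, Inr v} | u v. u \<in> verts G \<and> v \<in> verts H}\<rparr>"

definition add_edges :: "'a graph \<Rightarrow> 'a set set \<Rightarrow> 'a graph" where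
  "add_edges G M = \<lparr>verts = verts G, edges = edges G \<union> M\<rparr>"

definition matching_on :: "'a set \<Rightarrow> 'a set set \<Rightarrow> bool" where
  "matching_on W M \<longleftrightarrow> (\<forall>e\<in>M. e \<subseteq> W \<and> card e = 2) \<and> disjoint M"

definition maximum_matching_on :: "'a set \<Rightarrow> 'a set set \<Rightarrow> bool" where
  "maximum_matching_on W M \<longleftrightarrow>
     matching_on W M \<and> (\<forall>M'. matching_on W M' \<longrightarrow> card M' \<le> card M)"

lemma simple_graph_complete_graph: "simple_graph (complete_graph n)"
  by (auto simp: simple_graph_def complete_graph_def)

lemma simple_graph_path_graph: "simple_graph (path_graph n)"
  by (auto simp: simple_graph_def path_graph_def)

lemma simple_graph_star_graph: "simple_graph (star_graph d)"
  by (auto simp: simple_graph_def star_graph_def)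

lemma simple_graph_complement: "simple_graph G \<Longrightarrow> simple_graph (graph_complement G)"
  by (auto simp: simple_graph_def graph_complement_def)

lemma simple_graph_union:
  "simple_graph G \<Longrightarrow> simple_graph H \<Longrightarrow> simple_graph (graph_union G H)"
  by (fastforce simp: simple_graph_def graph_union_def card_image)

lemma simple_graph_Union:
  "finite I \<Longrightarrow> (\<And>i. i \<in> I \<Longrightarrow> simple_graph (G i)) \<Longrightarrow> simple_graph (graph_Union I G)"
  by (fastforce simp: simple_graph_def graph_Union_def card_image inj_on_def)

lemma simple_graph_join:
  "simple_graph G \<Longrightarrow> simple_graph H \<Longrightarrow> simple_graph (graph_join G H)"
  using simple_graph_union[of G H]
  by (auto simp: simple_graph_def graph_join_def) (auto simp: graph_union_def)

lemma matching_on_card: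
  assumes "finite W" "matching_on W M"
  shows "2 * card M \<le> card W"
proof -
  have fin: "finite M"
    using assms finite_subset[of M "Pow W"] by (auto simp: matching_on_def)
  have "card (\<Union>M) = (\<Sum>e\<in>M. card e)"
    using assms by (intro card_Union_disjoint)
      (auto simp: matching_on_def disjoint_def pairwise_def disjnt_def intro: finite_subset)
  also have "\<dots> = 2 * card M"
    using assms by (simp add: matching_on_def)
  finally have "card (\<Union>M) = 2 * card M" .
  moreover have "card (\<Union>M) \<le> card W"
    using assms by (intro card_mono) (auto simp: matching_on_def)
  ultimately show ?thesis by simp
qed

lemma ex_matching_on:
  assumes "finite W"
  shows "\<exists>M. matching_on W M \<and> card M = card W div 2"
proof -
  obtain f where f: "bij_betw f {0..<card W} W"
    using ex_bij_betw_nat_finite[OF assms] by blast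
  define g where "g i = {f (2 * i), f (2 * i + 1)}" for i
  have inj: "f i = f j \<longleftrightarrow> i = j" if "i < card W" "j < card W" for i j
    using f that by (auto simp: bij_betw_def inj_on_def)
  have W: "f i \<in> W" if "i < card W" for i
    using f that by (auto simp: bij_betw_def)
  have dis: "g i \<inter> g j = {}" if "i < card W div 2" "j < card W div 2" "i \<noteq> j" for i j
  proof -
    have "2 * i + 1 < card W" "2 * j + 1 < card W" using that by auto
    then show ?thesis using that unfolding g_def by (auto simp: inj; presburger)
  qed
  have "inj_on g {..<card W div 2}"
  proof (rule inj_onI, rule ccontr)
    fix i j assume "i \<in> {..<card W div 2}" "j \<in> {..<card W div 2}" "g i = g j" "i \<noteq> j"
    then show False using dis[of i j] by (simp add: g_def)
  qed
  then have "card (g ` {..<card W div 2}) = card W div 2"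
    by (simp add: card_image)
  moreover have "matching_on W (g ` {..<card W div 2})"
    unfolding matching_on_def
  proof (intro conjI ballI)
    fix e assume "e \<in> g ` {..<card W div 2}"
    then obtain i where "e = g i" "2 * i + 1 < card W" by auto
    then show "e \<subseteq> W" "card e = 2"
      using W by (auto simp: g_def inj card_insert_if)
  next
    show "disjoint (g ` {..<card W div 2})"
      using dis by (auto simp: disjoint_def)
  qed
  ultimately show ?thesis by blast
qed

lemma maximum_matching_on_iff:
  assumes "finite W"
  shows "maximum_matching_on W M \<longleftrightarrow> matching_on W M \<and> card M = card W div 2"
proof -
  have le: "card M' \<le> card W div 2" if "matching_on W M'" for M'
    using matching_on_card[OF assms that] by linarith
  show ?thesis
    using le ex_matching_on[OF assms] unfolding maximum_matching_on_def
    by (metis le_antisym)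
qed

end

theory Submission
  imports Defs
begin

text \<open>Let k = t + b - 1. The graphs in (i) to (iii) are F-free because a copy of F would need k + 1 of
  the k dominating vertices, so an extremal graph G for F has at least k n - O(1) edges. If G has no
  copy of S, then it is extremal for S. Otherwise edge counts based on the Erdos-Gallai bound produce
  t centres of large degree and then all but p - 1 vertices of a core, where the shortest path has 2p
  or 2p + 1 vertices. In a subgraph of minimum degree k outside this partial core K, deleting a bounded
  set leaves many components with the same attachments. If many of these are single vertices, then
  p - 1 attachment vertices complete the core; otherwise the components allow a copy of F that uses
  too few vertices of K. Once K has k vertices with many common neighbours, replacing vertices outside
  K by twins adjacent to K shows that every vertex set Y outside K meets at least k |Y| edges. The
  edges outside K are then so restricted that G is one of the listed graphs.\<close>

section \<open>Edge counts and paths\<close>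

text \<open>\<open>t + b\<close> is the vertex cover number of F: a star needs one covering vertex,
  a path on l vertices needs \<open>l div 2\<close>. Deleting part of a cover costs at most n edges
  per vertex, which is what the assumed edge count allows, so the additive constant never grows
  while the cover is peeled off. The bounds that give contradictions have, with edges counted twice,
  a factor 2c - 1 in place of 2c; this leaves a margin of order n, so crude versions suffice. The
  obstacle is the shortest path, on m vertices. Once only this path is excluded outside the partial
  core, disjoint cliques on m - 1 vertices are at least as dense as a join with p - 1 vertices, so
  counting alone cannot find the missing p - 1 core vertices. Such cliques are ruled out by a second
  path: the shortest path can pass through several components with a single core vertex, and the
  second shortest one saves a core vertex by starting and ending with edges inside components.
  Together they use only as many core vertices as a minimum cover of the second shortest path. This
  is where r >= 2 enters.\<close>

definition simple_edges :: "'a set set \<Rightarrow> bool" where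
  "simple_edges E \<longleftrightarrow> (\<forall>e\<in>E. card e = 2)"

text \<open>Edge set and vertex set are separate arguments here and below, so that an induced
  subgraph is obtained by shrinking \<open>X\<close> with \<open>E\<close> fixed, and degrees into
  \<open>X\<close> make sense also for vertices outside \<open>X\<close>.\<close>

definition nbrs :: "'a set set \<Rightarrow> 'a set \<Rightarrow> 'a \<Rightarrow> 'a set" where
  "nbrs E X v = {u \<in> X. {u, v} \<in> E}"

abbreviation degree :: "'a set set \<Rightarrow> 'a set \<Rightarrow> 'a \<Rightarrow> nat" where
  "degree E X v \<equiv> card (nbrs E X v)"

definition common_nbrs :: "'a set set \<Rightarrow> 'a set \<Rightarrow> 'a set \<Rightarrow> 'a set" where
  "common_nbrs E X A = {u \<in> X. \<forall>v\<in>A. {u, v} \<in> E}"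

definition esize :: "'a set set \<Rightarrow> 'a set \<Rightarrow> nat" where
  "esize E X = card {e \<in> E. e \<subseteq> X}"

abbreviation walk :: "'a set set \<Rightarrow> 'a list \<Rightarrow> bool" where
  "walk E \<equiv> successively (\<lambda>u v. {u, v} \<in> E)"

text \<open>A path is its vertex list, measured by the number of vertices as in
  \<open>path_graph\<close>. The empty list is allowed, which frees prefixes and concatenations from
  side conditions.\<close>

definition is_path :: "'a set set \<Rightarrow> 'a set \<Rightarrow> 'a list \<Rightarrow> bool" where
  "is_path E X xs \<longleftrightarrow> distinct xs \<and> set xs \<subseteq> X \<and> walk E xs"

lemma simple_edges_no_loop: "simple_edges E \<Longrightarrow> {v, v} \<notin> E"
  by (auto simp: simple_edges_def)

lemma simple_edges_no_loop': "simple_edges E \<Longrightarrow> {v} \<notin> E"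
  using simple_edges_no_loop by fastforce

lemma nbrs_subset: "nbrs E X v \<subseteq> X"
  by (auto simp: nbrs_def)

lemma finite_nbrs: "finite X \<Longrightarrow> finite (nbrs E X v)"
  using finite_subset nbrs_subset by metis

lemma not_in_nbrs: "simple_edges E \<Longrightarrow> v \<notin> nbrs E X v"
  by (auto simp: nbrs_def simple_edges_no_loop')

lemma nbrs_mono: "X \<subseteq> Y \<Longrightarrow> nbrs E X v \<subseteq> nbrs E Y v"
  by (auto simp: nbrs_def)

lemma finite_edges_within: "finite X \<Longrightarrow> finite {e \<in> E. e \<subseteq> X}"
  by (rule finite_subset[of _ "Pow X"]) auto

lemma esize_mono: "finite Y \<Longrightarrow> X \<subseteq> Y \<Longrightarrow> esize E X \<le> esize E Y"
  unfolding esize_def by (rule card_mono[OF finite_edges_within]) auto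

lemma esize_insert:
  assumes "simple_edges E" "finite X" "v \<notin> X"
  shows "esize E (insert v X) = esize E X + degree E X v"
proof -
  have split: "{e \<in> E. e \<subseteq> insert v X} = {e \<in> E. e \<subseteq> X} \<union> (\<lambda>u. {u, v}) ` nbrs E X v"
    (is "?L = ?R")
  proof
    show "?L \<subseteq> ?R"
    proof
      fix e assume e: "e \<in> ?L"
      show "e \<in> ?R"
      proof (cases "v \<in> e")
        case True
        have "card e = 2" using e assms(1) by (auto simp: simple_edges_def)
        then obtain x y where xy: "e = {x, y}" "x \<noteq> y" by (auto simp: card_2_iff)
        then obtain u where "e = {u, v}" "u \<noteq> v" using True by blast
        then show ?thesis using e by (auto simp: nbrs_def)
      qed (use e in auto)
    qed
  qed (use assms in \<open>auto simp: nbrs_def\<close>)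
  have "inj_on (\<lambda>u. {u, v}) (nbrs E X v)"
    by (auto simp: inj_on_def doubleton_eq_iff)
  then have "card ((\<lambda>u. {u, v}) ` nbrs E X v) = degree E X v"
    by (rule card_image)
  moreover have "{e \<in> E. e \<subseteq> X} \<inter> (\<lambda>u. {u, v}) ` nbrs E X v = {}"
    using assms(3) by auto
  ultimately show ?thesis
    unfolding esize_def split
    by (simp add: card_Un_disjoint finite_edges_within[OF assms(2)] finite_nbrs[OF assms(2)])
qed

lemma esize_remove:
  assumes "simple_edges E" "finite X" "v \<in> X"
  shows "esize E X = esize E (X - {v}) + degree E X v"
proof -
  have "nbrs E (X - {v}) v = nbrs E X v"
    using not_in_nbrs[OF assms(1), of v X] by (auto simp: nbrs_def)
  then show ?thesis
    using esize_insert[OF assms(1), of "X - {v}" v] assms by (simp add: insert_absorb)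
qed

lemma esize_empty: "simple_edges E \<Longrightarrow> esize E {} = 0"
  by (auto simp: esize_def simple_edges_def)

text \<open>The vertices of \<open>A\<close> are deleted one at a time, each losing at most its
  degree in \<open>X\<close>; edges inside \<open>A\<close> may be counted twice.\<close>

lemma esize_le_degree_sum:
  assumes "simple_edges E" "finite X" "A \<subseteq> X"
  shows "esize E X \<le> esize E (X - A) + (\<Sum>v\<in>A. degree E X v)"
proof -
  have "finite A" using assms(2,3) finite_subset by auto
  then show ?thesis using assms(3)
  proof (induction A rule: finite_induct)
    case (insert a A)
    have eq: "X - A - {a} = X - insert a A" by auto
    have "esize E (X - A) = esize E (X - insert a A) + degree E (X - A) a"
      using esize_remove[OF assms(1), of "X - A" a] insert assms(2) by (simp add: eq)
    moreover have "degree E (X - A) a \<le> degree E X a"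
      by (rule card_mono[OF finite_nbrs[OF assms(2)] nbrs_mono]) auto
    ultimately show ?case using insert by auto
  qed simp
qed

lemma esize_remove_le:
  assumes "simple_edges E" "finite X" "A \<subseteq> X"
  shows "esize E X \<le> esize E (X - A) + card A * card X"
proof -
  have "(\<Sum>v\<in>A. degree E X v) \<le> card A * card X"
    using sum_bounded_above[of A "\<lambda>v. degree E X v" "card X"] card_mono[OF assms(2) nbrs_subset]
    by simp
  then show ?thesis using esize_le_degree_sum[OF assms] by linarith
qed

lemma handshake:
  assumes "simple_edges E" "finite X"
  shows "2 * esize E X = (\<Sum>v\<in>X. degree E X v)"
  using assms(2)
proof (induction X rule: finite_induct)
  case empty
  then show ?case using assms(1) by (simp add: esize_empty)
next
  case (insert v X)
  have nb: "degree E (insert v X) u = degree E X u + (if u \<in> nbrs E X v then 1 else 0)"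
    if "u \<in> X" for u
  proof -
    have "nbrs E (insert v X) u = nbrs E X u \<union> (if u \<in> nbrs E X v then {v} else {})"
      using that by (auto simp: nbrs_def insert_commute)
    moreover have "v \<notin> nbrs E X u" using insert by (auto simp: nbrs_def)
    ultimately show ?thesis by (simp add: finite_nbrs insert)
  qed
  have nv: "nbrs E (insert v X) v = nbrs E X v"
    using simple_edges_no_loop'[OF assms(1)] by (auto simp: nbrs_def)
  have "(\<Sum>u\<in>X. degree E (insert v X) u)
      = (\<Sum>u\<in>X. degree E X u) + (\<Sum>u\<in>X. if u \<in> nbrs E X v then 1 else 0)"
    by (simp add: nb sum.distrib)
  also have "(\<Sum>u\<in>X. if u \<in> nbrs E X v then 1 else 0) = degree E X v"
    using insert nbrs_subset[of E X v] by (simp add: sum.If_cases Int_absorb1 Int_absorb2)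
  finally show ?case
    using insert esize_insert[OF assms(1) insert(1,2)] by (simp add: nv)
qed

lemma esize_le_complete:
  assumes "simple_edges E" "finite X"
  shows "2 * esize E X \<le> card X * (card X - 1)"
proof -
  have "degree E X v \<le> card X - 1" if "v \<in> X" for v
  proof -
    have "nbrs E X v \<subseteq> X - {v}"
      using not_in_nbrs[OF assms(1), of v X] nbrs_subset[of E X v] by auto
    then show ?thesis using card_mono[of "X - {v}"] that assms(2) by (metis card_Diff_singleton finite_Diff)
  qed
  then show ?thesis
    unfolding handshake[OF assms] using sum_bounded_above[of X "\<lambda>v. degree E X v" "card X - 1"] by simp
qed

lemma esize_separated:
  assumes "simple_edges E" "finite X" "Q \<subseteq> X"
    and "\<And>u v. u \<in> Q \<Longrightarrow> v \<in> X - Q \<Longrightarrow> {u, v} \<notin> E"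
  shows "esize E X = esize E (X - Q) + esize E Q"
proof -
  have "{e \<in> E. e \<subseteq> X} = {e \<in> E. e \<subseteq> X - Q} \<union> {e \<in> E. e \<subseteq> Q}" (is "?L = ?R")
  proof
    show "?L \<subseteq> ?R"
    proof
      fix e assume e: "e \<in> ?L"
      then have "card e = 2" using assms(1) by (auto simp: simple_edges_def)
      then obtain x y where xy: "e = {x, y}" by (auto simp: card_2_iff)
      show "e \<in> ?R"
        using e xy assms(4)[of x y] assms(4)[of y x] by (auto simp: insert_commute)
    qed
  qed (use assms in auto)
  moreover have "{e \<in> E. e \<subseteq> X - Q} \<inter> {e \<in> E. e \<subseteq> Q} = {}"
  proof -
    have "{} \<notin> E" using assms(1) by (auto simp: simple_edges_def)
    moreover have "e = {}" if "e \<subseteq> X - Q" "e \<subseteq> Q" for e using that by blast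
    ultimately show ?thesis by blast
  qed
  moreover have "finite {e \<in> E. e \<subseteq> Q}" "finite {e \<in> E. e \<subseteq> X - Q}"
    using finite_edges_within[OF finite_subset[OF assms(3,2)]] finite_edges_within[of "X - Q"] assms(2)
    by auto
  ultimately show ?thesis
    unfolding esize_def by (simp add: card_Un_disjoint)
qed

section \<open>Paths as vertex lists and the Erdos-Gallai bound\<close>

lemma is_path_mono: "is_path E X xs \<Longrightarrow> X \<subseteq> Y \<Longrightarrow> is_path E Y xs"
  by (auto simp: is_path_def)

lemma successively_edges_rev:
  "walk E (rev xs) = walk E xs"
  by (simp add: insert_commute)

lemma is_path_rev [simp]: "is_path E X (rev xs) = is_path E X xs"
  by (simp add: is_path_def successively_edges_rev del: successively_rev)

lemma is_path_append:
  "is_path E X (xs @ ys) \<longleftrightarrow> is_path E X xs \<and> is_path E X ys \<and> set xs \<inter> set ys = {} \<and>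
     (xs \<noteq> [] \<longrightarrow> ys \<noteq> [] \<longrightarrow> {last xs, hd ys} \<in> E)"
  by (auto simp: is_path_def successively_append_iff)

lemma is_path_Cons:
  "is_path E X (x # xs) \<longleftrightarrow> x \<in> X \<and> x \<notin> set xs \<and> is_path E X xs \<and> (xs \<noteq> [] \<longrightarrow> {x, hd xs} \<in> E)"
  by (auto simp: is_path_def successively_Cons)

lemma is_path_Nil [simp]: "is_path E X []"
  by (simp add: is_path_def)

lemma is_path_take: "is_path E X xs \<Longrightarrow> is_path E X (take n xs)"
  by (metis append_take_drop_id is_path_append)

text \<open>The last vertex is joined to the first, so the list can be rotated to start at
  \<open>x\<close>; then \<open>y\<close> goes in front.\<close>

lemma closed_path_spans:
  assumes "is_path E X xs" "{last xs, hd xs} \<in> E"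
    and "y \<in> X - set xs" "x \<in> set xs" "{x, y} \<in> E"
  shows "\<exists>zs. is_path E X zs \<and> length zs = Suc (length xs)"
proof -
  obtain as bs where ab: "xs = as @ x # bs" using assms(4) by (meson split_list)
  have "is_path E X ((x # bs) @ as)"
    using assms(1,2) unfolding ab is_path_append by (auto split: if_splits)
  then have "is_path E X (y # ((x # bs) @ as))"
    using assms(3,5) unfolding ab by (subst is_path_Cons) (auto simp: insert_commute)
  then show ?thesis unfolding ab
    by (intro exI[of _ "y # ((x # bs) @ as)"]) auto
qed

text \<open>Pigeonhole on the \<open>length xs - 1\<close> gaps of the list: members of
  \<open>A\<close> are recorded by the gap before them, members of \<open>B\<close> by the gap after
  them. For the neighbourhoods of the two ends this is the crossing argument known from Ore's
  theorem.\<close>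

lemma path_endpoint_crossing:
  assumes "distinct xs" "xs \<noteq> []" "A \<subseteq> set (tl xs)" "B \<subseteq> set (butlast xs)"
    and "card A + card B \<ge> length xs"
  shows "\<exists>i. Suc i < length xs \<and> xs ! Suc i \<in> A \<and> xs ! i \<in> B"
proof -
  let ?s = "length xs - 1"
  let ?I = "{i. i < ?s \<and> xs ! Suc i \<in> A}" and ?J = "{i. i < ?s \<and> xs ! i \<in> B}"
  have "A \<subseteq> (\<lambda>i. xs ! Suc i) ` ?I"
  proof
    fix a assume a: "a \<in> A"
    then obtain i where "i < length (tl xs)" "tl xs ! i = a"
      using assms(3) by (metis in_set_conv_nth subsetD)
    then show "a \<in> (\<lambda>i. xs ! Suc i) ` ?I"
      using a by (auto simp: nth_tl)
  qed
  then have A: "card A \<le> card ?I"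
    by (rule surj_card_le[rotated]) auto
  have "B \<subseteq> (\<lambda>i. xs ! i) ` ?J"
  proof
    fix a assume a: "a \<in> B"
    then obtain i where "i < length (butlast xs)" "butlast xs ! i = a"
      using assms(4) by (metis in_set_conv_nth subsetD)
    then show "a \<in> (\<lambda>i. xs ! i) ` ?J"
      using a by (auto simp: nth_butlast)
  qed
  then have B: "card B \<le> card ?J"
    by (rule surj_card_le[rotated]) auto
  have "?I \<inter> ?J \<noteq> {}"
  proof
    assume "?I \<inter> ?J = {}"
    then have "card ?I + card ?J = card (?I \<union> ?J)" by (simp add: card_Un_disjoint)
    also have "\<dots> \<le> card {..<?s}" by (rule card_mono) auto
    finally show False using A B assms(2,5) by (cases xs) auto
  qed
  then show ?thesis by auto
qed

text \<open>By induction, delete an endpoint of a longest path if its degree is small. Otherwise the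
  neighbourhoods of the two endpoints cross, and the vertices of the path span a cycle that no edge
  leaves, since such an edge would give a longer path.\<close>

theorem erdos_gallai_path:
  assumes "simple_edges E" "finite X" "l \<ge> 2" "\<And>xs. is_path E X xs \<Longrightarrow> length xs \<noteq> l"
  shows "2 * esize E X \<le> (l - 2) * card X"
  using assms(2,4)
proof (induction "card X" arbitrary: X rule: less_induct)
  case less
  show ?case
  proof (cases "X = {}")
    case True
    then show ?thesis using assms(1) by (simp add: esize_empty)
  next
    case False
    have sub: "2 * esize E Y \<le> (l - 2) * card Y" if "Y \<subset> X" for Y
      using less(1)[of Y] less(2) that is_path_mono[of E Y _ X] less(3)
      by (metis finite_subset psubset_card_mono psubset_imp_subset)
    have short: "length xs < l" if "is_path E X xs" for xs
    proof (rule ccontr)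
      assume "\<not> ?thesis"
      then have "length (take l xs) = l" by simp
      then show False using less(3) is_path_take[OF that] by blast
    qed
    obtain x0 where "x0 \<in> X" using False by blast
    then have "is_path E X [x0]" by (simp add: is_path_def)
    then obtain xs where xs: "is_path E X xs" and max: "\<And>ys. is_path E X ys \<Longrightarrow> length ys \<le> length xs"
      using ex_has_greatest_nat[of "is_path E X" "[x0]" length l] short by (metis order_less_imp_le)
    have ne: "xs \<noteq> []" using max[OF \<open>is_path E X [x0]\<close>] by auto
    let ?u = "hd xs" and ?v = "last xs"
    have in_X: "?u \<in> X" "?v \<in> X" using xs ne by (auto simp: is_path_def)
    have nu: "nbrs E X ?u \<subseteq> set xs"
    proof
      fix y assume y: "y \<in> nbrs E X ?u"
      show "y \<in> set xs"
      proof (rule ccontr)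
        assume "y \<notin> set xs"
        then have "is_path E X (y # xs)" using y xs ne by (auto simp: is_path_Cons nbrs_def)
        then show False using max by fastforce
      qed
    qed
    have nv: "nbrs E X ?v \<subseteq> set xs"
    proof
      fix y assume y: "y \<in> nbrs E X ?v"
      show "y \<in> set xs"
      proof (rule ccontr)
        assume "y \<notin> set xs"
        then have "is_path E X (xs @ [y])"
          using y xs ne by (auto simp: is_path_append is_path_Cons nbrs_def insert_commute)
        then show False using max by fastforce
      qed
    qed
    \<comment> \<open>The claim allows \<open>(l - 2) / 2\<close> edges per vertex, so a vertex of
      at most this degree can be removed.\<close>
    have delete: ?thesis if "v \<in> X" "2 * degree E X v \<le> l - 2" for v
    proof -
      have "2 * esize E (X - {v}) \<le> (l - 2) * card (X - {v})" using that sub[of "X - {v}"] by auto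
      moreover have "card X = Suc (card (X - {v}))"
        using that(1) less(2) by (metis card.remove)
      ultimately show ?thesis using esize_remove[OF assms(1) less(2) that(1)] that(2) by simp
    qed
    show ?thesis
    proof (cases "2 * degree E X ?u \<le> l - 2 \<or> 2 * degree E X ?v \<le> l - 2")
      case True
      then show ?thesis using delete in_X by blast
    next
      case False
      have tl: "nbrs E X ?u \<subseteq> set (tl xs)"
        using nu not_in_nbrs[OF assms(1), of ?u X] ne by (cases xs) auto
      have bl: "nbrs E X ?v \<subseteq> set (butlast xs)"
        using nv not_in_nbrs[OF assms(1), of ?v X] ne by (cases xs rule: rev_cases) auto
      \<comment> \<open>Both doubled degrees are at least \<open>l - 1\<close>, and a path has at
        most \<open>l - 1\<close> vertices.\<close>
      have "degree E X ?u + degree E X ?v \<ge> length xs"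
        using False short[OF xs] by linarith
      then obtain i where i: "Suc i < length xs" "xs ! Suc i \<in> nbrs E X ?u" "xs ! i \<in> nbrs E X ?v"
        using path_endpoint_crossing[OF _ ne tl bl] xs by (auto simp: is_path_def)
      define as bs where "as = take (Suc i) xs" and "bs = drop (Suc i) xs"
      have ab: "xs = as @ bs" "as \<noteq> []" "bs \<noteq> []" and la: "last as = xs ! i" and hb: "hd bs = xs ! Suc i"
        using i(1) ne by (auto simp: as_def bs_def hd_drop_conv_nth last_conv_nth)
      have hl: "hd as = ?u" "last bs = ?v" using ab by auto
      \<comment> \<open>Reversing the second piece replaces the edge between the pieces by the edge
        from \<open>xs ! i\<close> to the old end \<open>?v\<close>; the new ends \<open>?u\<close>
        and \<open>xs ! Suc i\<close> are adjacent.\<close>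
      have path: "is_path E X (as @ rev bs)"
        using xs i(3) ab(2,3) unfolding ab(1) is_path_append
        by (auto simp: hd_rev nbrs_def la[unfolded ab(1)] )
      have closed: "{last (as @ rev bs), hd (as @ rev bs)} \<in> E"
        using ab(2,3) i(2) hb hl(1) by (simp add: last_rev nbrs_def)
      have no_exit: "{x, y} \<notin> E" if xy: "x \<in> set xs" "y \<in> X - set xs" for x y
      proof
        assume "{x, y} \<in> E"
        moreover have "set (as @ rev bs) = set xs" "length (as @ rev bs) = length xs"
          unfolding ab(1) by auto
        ultimately obtain zs where "is_path E X zs" "length zs = Suc (length xs)"
          using closed_path_spans[OF path closed, of y x] xy by metis
        then show False using max by fastforce
      qed
      have xs_X: "set xs \<subseteq> X" using xs by (simp add: is_path_def)
      have cQ: "card (set xs) \<le> l - 1" using short[OF xs] xs by (simp add: is_path_def distinct_card)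
      \<comment> \<open>A set of at most \<open>l - 1\<close> vertices satisfies the bound even if
        it is complete.\<close>
      have "2 * esize E (set xs) \<le> card (set xs) * (card (set xs) - 1)"
        by (rule esize_le_complete[OF assms(1)]) simp
      also have "\<dots> \<le> card (set xs) * (l - 2)" using cQ by (intro mult_le_mono) auto
      finally have "2 * esize E (set xs) \<le> (l - 2) * card (set xs)" by (simp add: mult.commute)
      moreover have "2 * esize E (X - set xs) \<le> (l - 2) * card (X - set xs)"
        using ne xs_X hd_in_set[OF ne] by (intro sub) blast
      moreover have "card X = card (X - set xs) + card (set xs)"
        using xs_X less(2) by (simp add: card_Diff_subset card_mono)
      moreover have "esize E X = esize E (X - set xs) + esize E (set xs)"
        by (rule esize_separated[OF assms(1) less(2) xs_X no_exit])
      ultimately show ?thesis by (simp add: add_mult_distrib2)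
    qed
  qed
qed

section \<open>Packings of stars and paths\<close>

text \<open>A not necessarily induced embedding with image exactly \<open>X\<close>, so that further
  copies are kept disjoint by removing \<open>X\<close>.\<close>

definition copy_on :: "'a set set \<Rightarrow> 'b graph \<Rightarrow> 'a set \<Rightarrow> bool" where
  "copy_on E A X \<longleftrightarrow> (\<exists>g. bij_betw g (verts A) X \<and> (\<forall>e\<in>edges A. g ` e \<in> E))"

text \<open>Containment of a disjoint union, taken component by component; this permits induction
  over the components of the forest.\<close>

fun packs :: "'a set set \<Rightarrow> 'a set \<Rightarrow> 'b graph list \<Rightarrow> bool" where
  "packs E V [] \<longleftrightarrow> True"
| "packs E V (A # As) \<longleftrightarrow> (\<exists>X\<subseteq>V. copy_on E A X \<and> packs E (V - X) As)"

text \<open>\<open>l div 2\<close> is the vertex cover number of the path on \<open>l\<close>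
  vertices. As a star has cover number 1, \<open>length ds + cover_sum ls\<close> is the cover
  number of the whole forest.\<close>

abbreviation cover_sum :: "nat list \<Rightarrow> nat" where
  "cover_sum ls \<equiv> \<Sum>l\<leftarrow>ls. l div 2"

abbreviation forest :: "nat list \<Rightarrow> nat list \<Rightarrow> nat graph list" where
  "forest ds ls \<equiv> map star_graph ds @ map path_graph ls"

lemma packs_mono: "packs E V As \<Longrightarrow> V \<subseteq> V' \<Longrightarrow> packs E V' As"
proof (induction As arbitrary: V V')
  case (Cons A As)
  then obtain X where "X \<subseteq> V" "copy_on E A X" "packs E (V - X) As" by auto
  then show ?case using Cons.IH[of "V - X" "V' - X"] Cons.prems(2) by auto
qed simp

text \<open>Components may be split off in any order, not only from the head of the list.\<close>

lemma packs_insert: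
  "X \<subseteq> V \<Longrightarrow> copy_on E A X \<Longrightarrow> packs E (V - X) (As @ Bs) \<Longrightarrow> packs E V (As @ A # Bs)"
proof (induction As arbitrary: V)
  case (Cons C As)
  then obtain Y where Y: "Y \<subseteq> V - X" "copy_on E C Y" "packs E (V - X - Y) (As @ Bs)" by auto
  have "V - X - Y = V - Y - X" by auto
  then have "packs E (V - Y) (As @ A # Bs)" using Cons.IH[of "V - Y"] Y Cons.prems by auto
  then show ?case using Y by auto
qed auto

lemma copy_on_card: "copy_on E A X \<Longrightarrow> card X = card (verts A)"
  unfolding copy_on_def using bij_betw_same_card by metis

lemma copy_on_finite: "copy_on E A X \<Longrightarrow> finite (verts A) \<Longrightarrow> finite X"
  unfolding copy_on_def using bij_betw_finite by metis

text \<open>Turns a packing into a set of known size that later choices can avoid; the last clause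
  allows it to be continued by graphs placed outside this set.\<close>

lemma packs_support:
  assumes "packs E V As" "\<And>A. A \<in> set As \<Longrightarrow> finite (verts A)"
  obtains D where "D \<subseteq> V" "finite D" "card D = (\<Sum>A\<leftarrow>As. card (verts A))" "packs E D As"
    "\<forall>Bs. packs E (V - D) Bs \<longrightarrow> packs E V (As @ Bs)"
proof -
  have "\<exists>D\<subseteq>V. finite D \<and> card D = (\<Sum>A\<leftarrow>As. card (verts A)) \<and> packs E D As \<and>
      (\<forall>Bs. packs E (V - D) Bs \<longrightarrow> packs E V (As @ Bs))"
    using assms
  proof (induction As arbitrary: V)
    case Nil
    then show ?case by (intro exI[of _ "{}"]) auto
  next
    case (Cons A As)
    then obtain X where X: "X \<subseteq> V" "copy_on E A X" "packs E (V - X) As" by auto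
    with Cons.IH[OF X(3)] Cons.prems(2) obtain D where D: "D \<subseteq> V - X" "finite D"
      "card D = (\<Sum>A\<leftarrow>As. card (verts A))" "packs E D As"
      "\<And>Bs. packs E (V - X - D) Bs \<Longrightarrow> packs E (V - X) (As @ Bs)" by auto
    have fin: "finite X" "card X = card (verts A)"
      using copy_on_finite[OF X(2)] copy_on_card[OF X(2)] Cons.prems(2) by auto
    have "X \<union> D - X = D" "V - (X \<union> D) = V - X - D" "X \<inter> D = {}" using D(1) by auto
    then show ?case
      using X D fin by (intro exI[of _ "X \<union> D"]) (auto simp: card_Un_disjoint)
  qed
  then show ?thesis using that by blast
qed

lemma packs_paths_support:
  assumes "packs E V (map path_graph ls)"
  obtains D where "D \<subseteq> V" "finite D" "card D = sum_list ls" "packs E D (map path_graph ls)"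
proof -
  obtain D where D: "D \<subseteq> V" "finite D" "card D = (\<Sum>A\<leftarrow>map path_graph ls. card (verts A))"
    "packs E D (map path_graph ls)"
  proof (rule packs_support[OF assms])
    show "finite (verts A)" if "A \<in> set (map path_graph ls)" for A
      using that by (auto simp: path_graph_def)
  qed
  moreover from D(3) have "card D = sum_list ls" by (simp add: path_graph_def comp_def)
  ultimately show ?thesis using that by blast
qed

section \<open>Copies of paths, stars and disjoint unions\<close>

lemma copy_on_path_graph:
  "copy_on E (path_graph l) X \<longleftrightarrow>
    (\<exists>xs. length xs = l \<and> distinct xs \<and> set xs = X \<and> walk E xs)"
proof
  assume "copy_on E (path_graph l) X"
  then obtain g where g: "bij_betw g {..<l} X" and e: "\<forall>e\<in>edges (path_graph l). g ` e \<in> E"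
    by (auto simp: copy_on_def path_graph_def)
  have "{g i, g (Suc i)} \<in> E" if "Suc i < l" for i
    using e[rule_format, of "{i, Suc i}"] that by (auto simp: path_graph_def)
  show "\<exists>xs. length xs = l \<and> distinct xs \<and> set xs = X \<and> walk E xs"
    using g \<open>\<And>i. Suc i < l \<Longrightarrow> {g i, g (Suc i)} \<in> E\<close> by (intro exI[of _ "map g [0..<l]"])
      (auto simp: bij_betw_def distinct_map successively_conv_nth lessThan_atLeast0)
next
  assume "\<exists>xs. length xs = l \<and> distinct xs \<and> set xs = X \<and> walk E xs"
  then obtain xs where "length xs = l" "distinct xs" "set xs = X" "walk E xs"
    by blast
  then show "copy_on E (path_graph l) X"
    unfolding copy_on_def path_graph_def
    by (intro exI[of _ "\<lambda>i. xs ! i"]) (auto simp: bij_betw_nth successively_conv_nth)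
qed

lemma copy_on_path_if_is_path: "is_path E X xs \<Longrightarrow> copy_on E (path_graph (length xs)) (set xs)"
  unfolding copy_on_path_graph by (auto simp: is_path_def)

lemma copy_on_star_graph:
  "copy_on E (star_graph d) X \<longleftrightarrow>
    (\<exists>c L. X = insert c L \<and> c \<notin> L \<and> finite L \<and> card L = d \<and> (\<forall>x\<in>L. {c, x} \<in> E))"
proof
  assume "copy_on E (star_graph d) X"
  then obtain g where g: "bij_betw g {..d} X" and e: "\<forall>e\<in>edges (star_graph d). g ` e \<in> E"
    by (auto simp: copy_on_def star_graph_def)
  have ed: "{g 0, g i} \<in> E" if "1 \<le> i" "i \<le> d" for i
    using e[rule_format, of "{0, i}"] that by (auto simp: star_graph_def)
  have eq: "{..d} = insert 0 {1..d}" by auto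
  have inj: "inj_on g {..d}" and im: "X = g ` {..d}" using g by (auto simp: bij_betw_def)
  have "card (g ` {1..d}) = d"
    using inj by (subst card_image) (auto intro: inj_on_subset)
  moreover have "g 0 \<noteq> g i" if "i \<in> {1..d}" for i using inj_onD[OF inj, of 0 i] that by auto
  then have "g 0 \<notin> g ` {1..d}" by blast
  ultimately show "\<exists>c L. X = insert c L \<and> c \<notin> L \<and> finite L \<and> card L = d \<and> (\<forall>x\<in>L. {c, x} \<in> E)"
    using im ed unfolding eq by (intro exI[of _ "g 0"] exI[of _ "g ` {1..d}"]) auto
next
  assume "\<exists>c L. X = insert c L \<and> c \<notin> L \<and> finite L \<and> card L = d \<and> (\<forall>x\<in>L. {c, x} \<in> E)"
  then obtain c L where cL: "X = insert c L" "c \<notin> L" "finite L" "card L = d" "\<forall>x\<in>L. {c, x} \<in> E"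
    by blast
  have "\<exists>h. bij_betw h {1..d} L" using cL(3,4) by (intro finite_same_card_bij) auto
  then obtain h where h: "bij_betw h {1..d} L" by blast
  let ?g = "\<lambda>i. if i = 0 then c else h i"
  have eq: "{..d} = insert 0 {1..d}" by auto
  have "bij_betw ?g {1..d} L" using h by (subst bij_betw_cong[of _ _ h]) auto
  then have "bij_betw ?g {..d} X"
    using notIn_Un_bij_betw[of 0 "{1..d}" ?g L] cL(2) unfolding eq cL(1) by simp
  moreover have "\<forall>e\<in>edges (star_graph d). ?g ` e \<in> E"
    using cL(5) h by (auto simp: star_graph_def bij_betw_def insert_commute)
  ultimately show "copy_on E (star_graph d) X"
    unfolding copy_on_def by (intro exI[of _ ?g] conjI) (simp_all add: star_graph_def)
qed

lemma copy_on_graph_union: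
  "copy_on E (graph_union A B) Z \<longleftrightarrow>
    (\<exists>X Y. X \<inter> Y = {} \<and> Z = X \<union> Y \<and> copy_on E A X \<and> copy_on E B Y)"
proof
  assume "copy_on E (graph_union A B) Z"
  then obtain g where g: "bij_betw g (verts A <+> verts B) Z"
    "\<And>e. e \<in> edges A \<Longrightarrow> g ` Inl ` e \<in> E" "\<And>e. e \<in> edges B \<Longrightarrow> g ` Inr ` e \<in> E"
    by (auto simp: copy_on_def graph_union_def)
  let ?X = "(g \<circ> Inl) ` verts A" and ?Y = "(g \<circ> Inr) ` verts B"
  have inj: "inj_on g (verts A <+> verts B)" and im: "Z = g ` (verts A <+> verts B)"
    using g(1) by (auto simp: bij_betw_def)
  have "copy_on E A ?X" "copy_on E B ?Y"
    unfolding copy_on_def using inj g(2,3)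
    by (intro exI[of _ "g \<circ> Inl"] exI[of _ "g \<circ> Inr"]; force simp: bij_betw_def inj_on_def image_comp)+
  moreover have "?X \<inter> ?Y = {}" using inj by (fastforce simp: inj_on_def)
  moreover have "Z = ?X \<union> ?Y" unfolding im by (auto simp: Plus_def image_Un image_comp)
  ultimately show "\<exists>X Y. X \<inter> Y = {} \<and> Z = X \<union> Y \<and> copy_on E A X \<and> copy_on E B Y" by blast
next
  assume "\<exists>X Y. X \<inter> Y = {} \<and> Z = X \<union> Y \<and> copy_on E A X \<and> copy_on E B Y"
  then obtain X Y g h where XY: "X \<inter> Y = {}" "Z = X \<union> Y"
    and g: "bij_betw g (verts A) X" "\<forall>e\<in>edges A. g ` e \<in> E"
    and h: "bij_betw h (verts B) Y" "\<forall>e\<in>edges B. h ` e \<in> E"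
    by (auto simp: copy_on_def)
  have "bij_betw (case_sum g h) (verts A <+> verts B) Z"
    unfolding XY(2) Plus_def
  proof (rule bij_betw_combine[OF _ _ XY(1)])
    show "bij_betw (case_sum g h) (Inl ` verts A) X" "bij_betw (case_sum g h) (Inr ` verts B) Y"
      using g(1) h(1) by (auto simp: bij_betw_def inj_on_def image_comp)
  qed
  then show "copy_on E (graph_union A B) Z"
    unfolding copy_on_def using g(2) h(2)
    by (intro exI[of _ "case_sum g h"]) (auto simp: graph_union_def image_comp comp_def)
qed

lemma copy_on_graph_Union_insert:
  assumes "i \<notin> I"
  shows "copy_on E (graph_Union (insert i I) G) Z \<longleftrightarrow>
    (\<exists>X Y. X \<inter> Y = {} \<and> Z = X \<union> Y \<and> copy_on E (G i) X \<and> copy_on E (graph_Union I G) Y)"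
proof
  assume "copy_on E (graph_Union (insert i I) G) Z"
  then obtain g where bij: "bij_betw g (SIGMA j:insert i I. verts (G j)) Z"
    and "\<forall>e\<in>edges (graph_Union (insert i I) G). g ` e \<in> E"
    by (auto simp: copy_on_def graph_Union_def)
  then have ed: "g ` Pair j ` e \<in> E" if "j \<in> insert i I" "e \<in> edges (G j)" for j e
  proof -
    have "Pair j ` e \<in> edges (graph_Union (insert i I) G)"
      using that by (auto simp: graph_Union_def)
    then show ?thesis using \<open>\<forall>e\<in>edges (graph_Union (insert i I) G). g ` e \<in> E\<close> by blast
  qed
  let ?S = "SIGMA j:I. verts (G j)"
  let ?X = "(g \<circ> Pair i) ` verts (G i)" and ?Y = "g ` ?S"
  have inj: "inj_on g (SIGMA j:insert i I. verts (G j))"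
    and im: "Z = g ` (SIGMA j:insert i I. verts (G j))"
    using bij by (auto simp: bij_betw_def)
  have "copy_on E (G i) ?X"
    unfolding copy_on_def using inj ed[of i]
    by (intro exI[of _ "g \<circ> Pair i"]) (force simp: bij_betw_def inj_on_def image_comp)
  moreover have "copy_on E (graph_Union I G) ?Y"
    unfolding copy_on_def using inj ed
    by (intro exI[of _ g]) (auto simp: bij_betw_def graph_Union_def intro: inj_on_subset)
  moreover have "?X \<inter> ?Y = {}" using inj assms by (fastforce simp: inj_on_def)
  moreover have "Z = ?X \<union> ?Y" unfolding im by auto
  ultimately show "\<exists>X Y. X \<inter> Y = {} \<and> Z = X \<union> Y \<and> copy_on E (G i) X \<and> copy_on E (graph_Union I G) Y"
    by blast
next
  assume "\<exists>X Y. X \<inter> Y = {} \<and> Z = X \<union> Y \<and> copy_on E (G i) X \<and> copy_on E (graph_Union I G) Y"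
  then obtain X Y g h where XY: "X \<inter> Y = {}" "Z = X \<union> Y"
    and g: "bij_betw g (verts (G i)) X" "\<forall>e\<in>edges (G i). g ` e \<in> E"
    and h: "bij_betw h (SIGMA j:I. verts (G j)) Y" "\<forall>e\<in>edges (graph_Union I G). h ` e \<in> E"
    by (auto simp: copy_on_def graph_Union_def)
  let ?k = "\<lambda>p. if fst p = i then g (snd p) else h p"
  have k_i: "?k ` Pair i ` A = g ` A" for A
  proof -
    have "?k ` Pair i ` A = (\<lambda>x. ?k (i, x)) ` A" by (rule image_image)
    then show ?thesis by simp
  qed
  have "(SIGMA j:insert i I. verts (G j)) = Pair i ` verts (G i) \<union> (SIGMA j:I. verts (G j))" by auto
  moreover have "bij_betw ?k (Pair i ` verts (G i)) X"
    using g(1) by (auto simp only: bij_betw_def k_i) (auto simp: inj_on_def)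
  moreover have "bij_betw ?k (SIGMA j:I. verts (G j)) Y"
    using h(1) assms by (subst bij_betw_cong[of _ _ h]) auto
  ultimately have "bij_betw ?k (SIGMA j:insert i I. verts (G j)) Z"
    unfolding XY(2) using bij_betw_combine[OF _ _ XY(1)] by metis
  moreover have "?k ` e \<in> E" if "e \<in> edges (graph_Union (insert i I) G)" for e
  proof -
    from that obtain j e' where j: "j \<in> insert i I" "e' \<in> edges (G j)" "e = Pair j ` e'"
      by (auto simp: graph_Union_def)
    show ?thesis
    proof (cases "j = i")
      case True
      then show ?thesis using j g(2) by (simp only: k_i)
    next
      case False
      then have "?k ` e = h ` e" using j(3) by auto
      moreover have "e \<in> edges (graph_Union I G)" using j False by (auto simp: graph_Union_def)
      ultimately show ?thesis using h(2) by simp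
    qed
  qed
  ultimately show "copy_on E (graph_Union (insert i I) G) Z"
    unfolding copy_on_def by (intro exI[of _ ?k]) (auto simp: graph_Union_def)
qed

lemma copy_on_graph_Union_empty: "copy_on E (graph_Union {} G) X \<longleftrightarrow> X = {}"
  by (auto simp: copy_on_def graph_Union_def bij_betw_def)

text \<open>Connects the recursion over lists with the indexed unions of the theorem. The tail
  \<open>Bs\<close> is carried along so that the stars can be treated first and the paths after
  them.\<close>

lemma packs_graph_Union:
  assumes "distinct is"
  shows "packs E V (map G is @ Bs) \<longleftrightarrow>
    (\<exists>X\<subseteq>V. copy_on E (graph_Union (set is) G) X \<and> packs E (V - X) Bs)"
  using assms
proof (induction "is" arbitrary: V)
  case Nil
  then show ?case by (simp add: copy_on_graph_Union_empty)
next
  case (Cons i js)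
  have dif: "V - (X \<union> Y) = V - X - Y" for X Y by auto
  have "packs E V (map G (i # js) @ Bs) \<longleftrightarrow>
    (\<exists>X\<subseteq>V. copy_on E (G i) X \<and> (\<exists>Y\<subseteq>V - X. copy_on E (graph_Union (set js) G) Y \<and> packs E (V - X - Y) Bs))"
    using Cons by simp
  also have "\<dots> \<longleftrightarrow> (\<exists>X\<subseteq>V. copy_on E (graph_Union (set (i # js)) G) X \<and> packs E (V - X) Bs)"
    (is "?L \<longleftrightarrow> ?R")
  proof
    assume ?L
    then obtain X Y where XY: "X \<subseteq> V" "copy_on E (G i) X" "Y \<subseteq> V - X" "copy_on E (graph_Union (set js) G) Y"
      "packs E (V - X - Y) Bs" by blast
    then have "X \<inter> Y = {}" "X \<union> Y \<subseteq> V" by auto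
    then show ?R
      using XY Cons.prems by (intro exI[of _ "X \<union> Y"]) (auto simp: copy_on_graph_Union_insert dif)
  next
    assume ?R
    then obtain X Y where XY: "X \<inter> Y = {}" "X \<union> Y \<subseteq> V" "copy_on E (G i) X"
      "copy_on E (graph_Union (set js) G) Y" "packs E (V - X - Y) Bs"
      using Cons.prems by (auto simp: copy_on_graph_Union_insert dif)
    then have "X \<subseteq> V" "Y \<subseteq> V - X" by auto
    then show ?L using XY by blast
  qed
  finally show ?case .
qed

lemma copy_on_transfer:
  assumes "copy_on E A X" "simple_graph A" "inj_on h X"
    and "\<And>u v. u \<in> X \<Longrightarrow> v \<in> X \<Longrightarrow> {u, v} \<in> E \<Longrightarrow> {h u, h v} \<in> E'"
  shows "copy_on E' A (h ` X)"
proof -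
  obtain g where g: "bij_betw g (verts A) X" "\<forall>e\<in>edges A. g ` e \<in> E"
    using assms(1) by (auto simp: copy_on_def)
  have "bij_betw (h \<circ> g) (verts A) (h ` X)"
    using g(1) assms(3) by (intro bij_betw_trans[OF g(1)]) (simp add: bij_betw_def)
  moreover have "(h \<circ> g) ` e \<in> E'" if e: "e \<in> edges A" for e
  proof -
    have "card e = 2" "e \<subseteq> verts A" using assms(2) e by (auto simp: simple_graph_def)
    then obtain u v where uv: "e = {u, v}" "u \<in> verts A" "v \<in> verts A" by (auto simp: card_2_iff)
    have "{g u, g v} \<in> E" using g(2) e uv(1) by auto
    then have "{h (g u), h (g v)} \<in> E'"
      using g(1) uv by (intro assms(4)) (auto simp: bij_betw_def)
    then show ?thesis by (simp add: uv(1))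
  qed
  ultimately show ?thesis by (auto simp: copy_on_def)
qed

lemma graph_free_iff_no_copy:
  assumes "simple_graph G" "simple_graph F"
  shows "graph_free F G \<longleftrightarrow> \<not> (\<exists>X\<subseteq>verts G. copy_on (edges G) F X)"
proof -
  have "(\<exists>H. subgraph H G \<and> H \<simeq>\<^sub>g F) \<longleftrightarrow> (\<exists>X\<subseteq>verts G. copy_on (edges G) F X)"
  proof
    assume "\<exists>H. subgraph H G \<and> H \<simeq>\<^sub>g F"
    then obtain H f where H: "subgraph H G" and f: "bij_betw f (verts H) (verts F)"
      and ed: "\<And>u v. u \<in> verts H \<Longrightarrow> v \<in> verts H \<Longrightarrow> {u, v} \<in> edges H \<longleftrightarrow> {f u, f v} \<in> edges F"
      by (auto simp: graph_iso_def)
    let ?g = "inv_into (verts H) f"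
    have g: "bij_betw ?g (verts F) (verts H)" using f by (rule bij_betw_inv_into)
    have "?g ` e \<in> edges G" if e: "e \<in> edges F" for e
    proof -
      have "card e = 2" "e \<subseteq> verts F" using assms(2) e by (auto simp: simple_graph_def)
      then obtain u v where uv: "e = {u, v}" "u \<in> verts F" "v \<in> verts F" by (auto simp: card_2_iff)
      have "f (?g u) = u" "f (?g v) = v" "?g u \<in> verts H" "?g v \<in> verts H"
        using uv g bij_betw_inv_into_right[OF f] by (auto simp: bij_betw_def)
      then have "{?g u, ?g v} \<in> edges H" using ed[of "?g u" "?g v"] e uv(1) by simp
      then show ?thesis using H uv(1) by (auto simp: subgraph_def)
    qed
    then have "copy_on (edges G) F (verts H)" using g unfolding copy_on_def by blast
    then show "\<exists>X\<subseteq>verts G. copy_on (edges G) F X" using H by (auto simp: subgraph_def)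
  next
    assume "\<exists>X\<subseteq>verts G. copy_on (edges G) F X"
    then obtain X g where X: "X \<subseteq> verts G" and g: "bij_betw g (verts F) X" "\<forall>e\<in>edges F. g ` e \<in> edges G"
      by (auto simp: copy_on_def)
    \<comment> \<open>Only the image edges are kept, since \<open>graph_iso\<close> also requires
      that non-edges correspond.\<close>
    let ?H = "\<lparr>verts = X, edges = (`) g ` edges F\<rparr>"
    let ?f = "inv_into (verts F) g"
    have inj: "inj_on g (verts F)" using g(1) by (simp add: bij_betw_def)
    have "e \<subseteq> X" "card e = 2" if "e \<in> edges ?H" for e
    proof -
      obtain e' where e': "e' \<in> edges F" "e = g ` e'" using \<open>e \<in> edges ?H\<close> by auto
      then have "e' \<subseteq> verts F" "card e' = 2" using assms(2) by (auto simp: simple_graph_def)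
      then show "e \<subseteq> X" "card e = 2"
        using e'(2) g(1) inj_on_subset[OF inj] by (auto simp: bij_betw_def card_image)
    qed
    moreover have "finite X" using X assms(1) finite_subset by (auto simp: simple_graph_def)
    ultimately have sub: "subgraph ?H G"
      using X g(2) by (auto simp: subgraph_def simple_graph_def)
    have "{u, v} \<in> edges ?H \<longleftrightarrow> {?f u, ?f v} \<in> edges F" if uv: "u \<in> X" "v \<in> X" for u v
    proof
      have im: "g ` {?f u, ?f v} = {u, v}"
        using uv bij_betw_inv_into_right[OF g(1)] by simp
      show "{u, v} \<in> edges ?H" if "{?f u, ?f v} \<in> edges F"
        using imageI[OF that, of "(`) g"] by (simp only: im) simp
      assume "{u, v} \<in> edges ?H"
      then obtain e where e: "e \<in> edges F" "g ` e = {u, v}" by auto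
      have "e \<subseteq> verts F" using e assms(2) by (auto simp: simple_graph_def)
      moreover have "{?f u, ?f v} \<subseteq> verts F"
        using uv bij_betw_inv_into[OF g(1)] by (auto simp: bij_betw_def)
      ultimately have "e = {?f u, ?f v}"
        using e(2) im inj_on_image_eq_iff[OF inj] by metis
      then show "{?f u, ?f v} \<in> edges F" using e by simp
    qed
    then have "?H \<simeq>\<^sub>g F"
      unfolding graph_iso_def using bij_betw_inv_into[OF g(1)] by (intro exI[of _ ?f]) auto
    then show "\<exists>H. subgraph H G \<and> H \<simeq>\<^sub>g F" using sub by blast
  qed
  then show ?thesis by (simp add: graph_free_def)
qed

section \<open>Alternating paths in complete bipartite pairs\<close>

lemma set_splice: "set (splice xs ys) = set xs \<union> set ys"
  by (induction xs ys rule: splice.induct) auto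

lemma distinct_splice: "distinct (splice xs ys) \<longleftrightarrow> distinct (xs @ ys)"
  by (induction xs ys rule: splice.induct) (auto simp: set_splice)

lemma hd_splice: "xs \<noteq> [] \<Longrightarrow> hd (splice xs ys) = hd xs"
  by (cases xs) auto

lemma last_splice: "length xs = Suc (length ys) \<Longrightarrow> last (splice xs ys) = last xs"
proof (induction ys arbitrary: xs)
  case Nil
  then show ?case by simp
next
  case (Cons y ys)
  then obtain x xs' where "xs = x # xs'" "length xs' = Suc (length ys)" by (cases xs) auto
  moreover from this have "xs' \<noteq> []" by auto
  ultimately show ?case using Cons.IH[of xs'] by simp
qed

lemma successively_splice:
  assumes "length ys \<le> length xs" "length xs \<le> Suc (length ys)"
    and "\<And>x y. x \<in> set xs \<Longrightarrow> y \<in> set ys \<Longrightarrow> {x, y} \<in> E"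
  shows "walk E (splice xs ys)"
  using assms
proof (induction ys arbitrary: xs)
  case Nil
  then show ?case by (cases xs) auto
next
  case (Cons y ys)
  then obtain x xs' where xs: "xs = x # xs'" by (cases xs) auto
  have "walk E (splice xs' ys)" using Cons xs by auto
  moreover have "xs' = [] \<Longrightarrow> ys = []" using Cons.prems(1) xs by auto
  moreover have "{y, hd xs'} \<in> E" if "xs' \<noteq> []"
    using Cons.prems(3)[of "hd xs'" y] that xs by (simp add: insert_commute)
  ultimately show ?case
    using xs Cons.prems(3)[of x y] by (cases "xs' = []") (auto simp: successively_Cons hd_splice)
qed

text \<open>\<open>splice\<close> alternates between the lists and starts with \<open>xs\<close>; if
  \<open>xs\<close> is longer by one, both ends of the path lie in \<open>xs\<close>.\<close>

lemma is_path_splice: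
  assumes "length ys \<le> length xs" "length xs \<le> Suc (length ys)" "distinct (xs @ ys)"
    and "set xs \<subseteq> V" "set ys \<subseteq> V" "\<And>x y. x \<in> set xs \<Longrightarrow> y \<in> set ys \<Longrightarrow> {x, y} \<in> E"
  shows "is_path E V (splice xs ys)"
  unfolding is_path_def using assms successively_splice[of ys xs E]
  by (simp add: set_splice distinct_splice)

lemma obtain_distinct_list:
  assumes "finite A" "n \<le> card A"
  obtains xs where "distinct xs" "length xs = n" "set xs \<subseteq> A"
proof -
  obtain B where "B \<subseteq> A" "card B = n" "finite B"
    using obtain_subset_with_card_n[OF assms(2)] by metis
  then show ?thesis using finite_distinct_list[of B] distinct_card that by metis
qed

lemma packs_paths_bipartite:
  assumes "finite Z" "finite W" "Z \<inter> W = {}" "\<And>z w. z \<in> Z \<Longrightarrow> w \<in> W \<Longrightarrow> {z, w} \<in> E"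
    and "cover_sum ls \<le> card Z" "sum_list ls \<le> card W"
  shows "packs E (Z \<union> W) (map path_graph ls)"
  using assms
proof (induction ls arbitrary: Z W)
  case (Cons l ls)
  obtain zs where zs: "distinct zs" "length zs = l div 2" "set zs \<subseteq> Z"
    using obtain_distinct_list[OF Cons.prems(1), of "l div 2"] Cons.prems(5) by auto
  \<comment> \<open>The path starts on the \<open>W\<close> side, so that it needs only
    \<open>l div 2\<close> vertices of \<open>Z\<close>, a minimum cover.\<close>
  obtain ws where ws: "distinct ws" "length ws = l - l div 2" "set ws \<subseteq> W"
  proof (rule obtain_distinct_list[OF Cons.prems(2)])
    show "l - l div 2 \<le> card W" using Cons.prems(6) by simp
  qed
  let ?p = "splice ws zs"
  have path: "is_path E (Z \<union> W) ?p"
    using zs ws Cons.prems(3,4) by (intro is_path_splice) (force simp: insert_commute)+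
  have "length ?p = l" using zs ws by simp
  then have copy: "copy_on E (path_graph l) (set ?p)" using copy_on_path_if_is_path[OF path] by simp
  have cZ: "card (Z - set zs) = card Z - l div 2"
    using zs by (metis card_Diff_subset List.finite_set distinct_card)
  have cW: "card (W - set ws) = card W - (l - l div 2)"
    using ws by (metis card_Diff_subset List.finite_set distinct_card)
  have "packs E ((Z - set zs) \<union> (W - set ws)) (map path_graph ls)"
    using Cons.prems cZ cW by (intro Cons.IH) auto
  then have "packs E (Z \<union> W - set ?p) (map path_graph ls)"
    by (rule packs_mono) (use Cons.prems(3) zs ws in \<open>auto simp: set_splice\<close>)
  then show ?case using copy path by (auto simp: is_path_def intro!: exI[of _ "set ?p"])
qed simp

text \<open>A minimum cover of the forest goes to \<open>Z\<close> and all other vertices to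
  \<open>W\<close>. Later \<open>Z\<close> is part of a core and \<open>W\<close> lies in its common
  neighbourhood.\<close>

lemma packs_forest_bipartite:
  assumes "finite Z" "finite W" "Z \<inter> W = {}" "\<And>z w. z \<in> Z \<Longrightarrow> w \<in> W \<Longrightarrow> {z, w} \<in> E"
    and "length ds + cover_sum ls \<le> card Z" "sum_list ds + sum_list ls \<le> card W"
  shows "packs E (Z \<union> W) (forest ds ls)"
  using assms
proof (induction ds arbitrary: Z W)
  case Nil
  then show ?case using packs_paths_bipartite[OF Nil.prems(1-4)] by simp
next
  case (Cons d ds)
  have "Z \<noteq> {}" using Cons.prems(5) by auto
  then obtain c where c: "c \<in> Z" by blast
  obtain L where L: "L \<subseteq> W" "card L = d" "finite L"
    using obtain_subset_with_card_n[of d W] Cons.prems(6) by auto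
  have "copy_on E (star_graph d) (insert c L)"
    unfolding copy_on_star_graph using c L Cons.prems(3,4) by (intro exI[of _ c] exI[of _ L]) auto
  moreover have "packs E ((Z - {c}) \<union> (W - L)) (forest ds ls)"
    using Cons.prems c L by (intro Cons.IH) (auto simp: card_Diff_subset)
  then have "packs E (Z \<union> W - insert c L) (forest ds ls)"
    by (rule packs_mono) (use Cons.prems(3) c L in auto)
  ultimately show ?case using c L by (auto intro!: exI[of _ "insert c L"])
qed

text \<open>The leaves of the stars are chosen after the paths, away from them.\<close>

lemma packs_stars_at_large_degree:
  assumes "finite V" "T \<subseteq> V" "card T = length ds"
    and "\<And>c. c \<in> T \<Longrightarrow> degree E V c \<ge> sum_list ds + length ds + sum_list ls"
    and "simple_edges E" "packs E (V - T) (map path_graph ls)"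
  shows "packs E V (forest ds ls)"
proof -
  obtain D where D: "D \<subseteq> V - T" "finite D" "card D = sum_list ls" "packs E D (map path_graph ls)"
    by (rule packs_paths_support[OF assms(6)])
  \<comment> \<open>The set \<open>D\<close> of the paths stays fixed during the induction. Removing
    one star lowers the degree of every other centre by at most \<open>d + 1\<close>, which is what
    \<open>sum_list ds + length ds\<close> allows for.\<close>
  have "packs E V (forest ds ls)"
    if "finite V" "T \<subseteq> V" "card T = length ds" "D \<subseteq> V - T"
      "\<And>c. c \<in> T \<Longrightarrow> degree E V c \<ge> sum_list ds + length ds + card D" for V T
    using that
  proof (induction ds arbitrary: V T)
    case Nil
    then have "D \<subseteq> V" by blast
    then show ?case using packs_mono[OF D(4)] by simp
  next
    case (Cons d ds)
    have finT: "finite T" using Cons.prems(1,2) finite_subset by blast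
    obtain c where c: "c \<in> T" using Cons.prems(3) by (cases "T = {}") auto
    have "card (T \<union> D) \<le> Suc (length ds) + card D"
      using card_Un_le[of T D] Cons.prems(3) by simp
    then have "card (nbrs E V c - (T \<union> D)) \<ge> d"
      using Cons.prems(5)[OF c] diff_card_le_card_Diff[of "T \<union> D" "nbrs E V c"] finT D(2) by simp
    then obtain L where L: "L \<subseteq> nbrs E V c - (T \<union> D)" "card L = d" "finite L"
      using obtain_subset_with_card_n by metis
    have cL: "c \<notin> L" using L(1) c by auto
    have "copy_on E (star_graph d) (insert c L)"
      unfolding copy_on_star_graph using L cL
      by (intro exI[of _ c] exI[of _ L]) (auto simp: nbrs_def insert_commute)
    moreover have "packs E (V - insert c L) (forest ds ls)"
    proof (rule Cons.IH)
      show "T - {c} \<subseteq> V - insert c L" "D \<subseteq> V - insert c L - (T - {c})"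
        using Cons.prems(2,4) L c by auto
      show "card (T - {c}) = length ds" using Cons.prems(3) c finT by simp
      fix c' assume c': "c' \<in> T - {c}"
      have "nbrs E V c' - insert c L \<subseteq> nbrs E (V - insert c L) c'" by (auto simp: nbrs_def)
      then have "card (nbrs E V c' - insert c L) \<le> degree E (V - insert c L) c'"
        using Cons.prems(1) by (intro card_mono finite_nbrs) auto
      moreover have "degree E V c' - card (insert c L) \<le> card (nbrs E V c' - insert c L)"
        using L(3) by (intro diff_card_le_card_Diff) auto
      ultimately show "sum_list ds + length ds + card D \<le> degree E (V - insert c L) c'"
        using Cons.prems(5)[of c'] c' L cL by simp
    qed (use Cons.prems(1) in auto)
    ultimately show ?case
      using L c Cons.prems(2) by (auto intro!: exI[of _ "insert c L"] simp: nbrs_def)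
  qed
  then show ?thesis using assms(1-4) D(1,3) by simp
qed

section \<open>Edge bounds for linear forests\<close>

lemma common_nbrs_mono: "X \<subseteq> Y \<Longrightarrow> common_nbrs E X A \<subseteq> common_nbrs E Y A"
  by (auto simp: common_nbrs_def)

lemma finite_common_nbrs: "finite X \<Longrightarrow> finite (common_nbrs E X A)"
  by (auto simp: common_nbrs_def)

lemma sum_nbrs_swap:
  assumes "finite A" "finite B"
  shows "(\<Sum>v\<in>A. degree E B v) = (\<Sum>u\<in>B. degree E A u)"
proof -
  have "degree E Y v = (\<Sum>u\<in>Y. if {u, v} \<in> E then 1 else 0)" if "finite Y" for Y v
    using that by (simp add: nbrs_def sum.If_cases Int_def)
  then have "(\<Sum>v\<in>A. degree E B v) = (\<Sum>v\<in>A. \<Sum>u\<in>B. if {u, v} \<in> E then 1 else 0)"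
    "(\<Sum>u\<in>B. degree E A u) = (\<Sum>u\<in>B. \<Sum>v\<in>A. if {v, u} \<in> E then 1 else 0)"
    using assms by simp_all
  then show ?thesis by (subst (asm) sum.swap) (simp add: insert_commute)
qed

lemma sum_if_const:
  "finite S \<Longrightarrow> B \<subseteq> S \<Longrightarrow> (\<Sum>u\<in>S. if u \<in> B then c else 0) = card B * (c :: nat)"
  by (simp add: sum.If_cases Int_absorb1)

text \<open>Vertices outside \<open>Q\<close> with more than \<open>d\<close> neighbours in
  \<open>Q\<close> lie in one of at most \<open>2 ^ card Q\<close> common neighbourhoods. If all of
  these are smaller than \<open>M\<close>, such vertices are boundedly many, and every other vertex
  outside \<open>Q\<close> sends at most \<open>d\<close> edges to \<open>Q\<close>.\<close>

lemma many_common_nbrs_or_few_edges: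
  assumes "simple_edges E" "finite X" "Q \<subseteq> X"
  shows "(\<exists>A\<subseteq>Q. card A = Suc d \<and> M \<le> card (common_nbrs E (X - Q) A)) \<or>
    esize E X \<le> esize E (X - Q) + d * card X + card Q * (2 ^ card Q * M + card Q)"
proof (rule disjCI)
  assume "\<not> esize E X \<le> esize E (X - Q) + d * card X + card Q * (2 ^ card Q * M + card Q)"
  show "\<exists>A\<subseteq>Q. card A = Suc d \<and> M \<le> card (common_nbrs E (X - Q) A)"
  proof (rule ccontr)
    assume no: "\<not> ?thesis"
    have finQ: "finite Q" using assms(2,3) finite_subset by blast
    let ?B = "{u \<in> X - Q. Suc d \<le> degree E Q u}"
    have "?B \<subseteq> (\<Union>A\<in>{A. A \<subseteq> Q \<and> card A = Suc d}. common_nbrs E (X - Q) A)"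
    proof
      fix u assume u: "u \<in> ?B"
      then have "Suc d \<le> degree E Q u" by simp
      then obtain A where A: "A \<subseteq> nbrs E Q u" "card A = Suc d"
        by (rule obtain_subset_with_card_n)
      have "{u, a} \<in> E" if "a \<in> A" for a
      proof -
        have "{a, u} \<in> E" using A(1) that by (auto simp: nbrs_def)
        then show ?thesis by (simp add: insert_commute)
      qed
      then have "u \<in> common_nbrs E (X - Q) A" using u by (simp add: common_nbrs_def)
      then show "u \<in> (\<Union>A\<in>{A. A \<subseteq> Q \<and> card A = Suc d}. common_nbrs E (X - Q) A)"
        using A by (auto simp: nbrs_def)
    qed
    then have "card ?B \<le> card (\<Union>A\<in>{A. A \<subseteq> Q \<and> card A = Suc d}. common_nbrs E (X - Q) A)"
      using finQ assms(2) by (intro card_mono) (auto intro: finite_common_nbrs)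
    also have "\<dots> \<le> (\<Sum>A\<in>{A. A \<subseteq> Q \<and> card A = Suc d}. card (common_nbrs E (X - Q) A))"
      using finQ by (intro card_UN_le) auto
    also have "\<dots> \<le> (\<Sum>A\<in>{A. A \<subseteq> Q \<and> card A = Suc d}. M)"
      using no by (intro sum_mono) (auto simp: not_le intro: less_imp_le)
    also have "\<dots> \<le> 2 ^ card Q * M"
      using card_mono[of "Pow Q" "{A. A \<subseteq> Q \<and> card A = Suc d}"] finQ
      by (auto simp: card_Pow)
    finally have B: "card ?B \<le> 2 ^ card Q * M" .
    have "degree E X v \<le> card Q + degree E (X - Q) v" if "v \<in> Q" for v
    proof -
      have "nbrs E X v = nbrs E Q v \<union> nbrs E (X - Q) v" using assms(3) by (auto simp: nbrs_def)
      then have "degree E X v \<le> degree E Q v + degree E (X - Q) v"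
        by (simp add: card_Un_le)
      then show ?thesis using card_mono[OF finQ nbrs_subset, of E v] by simp
    qed
    then have "(\<Sum>v\<in>Q. degree E X v) \<le> (\<Sum>v\<in>Q. card Q + degree E (X - Q) v)"
      by (rule sum_mono)
    also have "\<dots> = card Q * card Q + (\<Sum>u\<in>X - Q. degree E Q u)"
      using finQ assms(2) by (simp add: sum.distrib sum_nbrs_swap)
    also have "(\<Sum>u\<in>X - Q. degree E Q u) \<le> (\<Sum>u\<in>X - Q. d + (if u \<in> ?B then card Q else 0))"
    proof (rule sum_mono)
      fix u assume "u \<in> X - Q"
      then show "degree E Q u \<le> d + (if u \<in> ?B then card Q else 0)"
        using card_mono[OF finQ nbrs_subset, of E u] by simp
    qed
    also have "\<dots> = card (X - Q) * d + card ?B * card Q"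
    proof -
      have "(\<Sum>u\<in>X - Q. if u \<in> ?B then card Q else 0) = card ?B * card Q"
        using assms(2) by (intro sum_if_const) auto
      then show ?thesis by (simp only: sum.distrib) simp
    qed
    also have "\<dots> \<le> card X * d + 2 ^ card Q * M * card Q"
      using B card_mono[of X "X - Q"] assms(2) by (intro add_mono mult_le_mono) auto
    finally have "(\<Sum>v\<in>Q. degree E X v) \<le> d * card X + card Q * (2 ^ card Q * M + card Q)"
      by (simp add: algebra_simps)
    then show False
      using \<open>\<not> esize E X \<le> _\<close> esize_le_degree_sum[OF assms] by simp
  qed
qed

text \<open>The other paths only have to avoid \<open>A\<close>, not all of \<open>Q\<close>: they
  occupy \<open>sum_list ls\<close> vertices, and enough common neighbours remain to alternate with
  \<open>A\<close>.\<close>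

lemma packs_path_at_common_nbrs:
  assumes "finite V" "Q \<subseteq> V" "A \<subseteq> Q" "card A = l div 2"
    and "l + sum_list ls \<le> card (common_nbrs E (V - Q) A)"
    and "packs E (V - A) (map path_graph ls)"
  shows "packs E V (map path_graph (l # ls))"
proof -
  obtain D where D: "D \<subseteq> V - A" "finite D" "card D = sum_list ls" "packs E D (map path_graph ls)"
    by (rule packs_paths_support[OF assms(6)])
  let ?W = "common_nbrs E (V - Q) A"
  have "l \<le> card (?W - D)" 
    using diff_card_le_card_Diff[OF D(2), of ?W] D(3) assms(5) by simp
  obtain ws where ws: "distinct ws" "length ws = l - l div 2" "set ws \<subseteq> ?W - D"
  proof (rule obtain_distinct_list)
    show "finite (?W - D)" using assms(1) by (simp add: finite_common_nbrs)
    show "l - l div 2 \<le> card (?W - D)" using \<open>l \<le> card (?W - D)\<close> by simp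
  qed
  have AV: "A \<subseteq> V" using assms(2,3) by blast
  then have "finite A" using assms(1) finite_subset by blast
  then obtain zs where zs: "distinct zs" "length zs = l div 2" "set zs = A"
    using finite_distinct_list[of A] distinct_card assms(4) by metis
  let ?p = "splice ws zs"
  have path: "is_path E V ?p"
  proof (rule is_path_splice)
    fix x y assume "x \<in> set ws" "y \<in> set zs"
    then show "{x, y} \<in> E" using ws(3) zs(3) by (auto simp: common_nbrs_def)
  qed (use ws zs assms(3) AV in \<open>auto simp: common_nbrs_def\<close>)
  have "length ?p = l" using ws zs by simp
  then have "copy_on E (path_graph l) (set ?p)" using copy_on_path_if_is_path[OF path] by simp
  moreover have "D \<subseteq> V - set ?p" using D(1) ws(3) zs(3) by (auto simp: set_splice)
  then have "packs E (V - set ?p) (map path_graph ls)" using packs_mono[OF D(4)] by blast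
  ultimately show ?thesis using path by (auto simp: is_path_def intro!: exI[of _ "set ?p"])
qed

lemma packs_Cons_path:
  assumes "is_path E X xs" "packs E (X - set xs) (map path_graph ls)"
  shows "packs E X (map path_graph (length xs # ls))"
  using assms copy_on_path_if_is_path[OF assms(1)] by (auto simp: is_path_def intro!: exI[of _ "set xs"])

lemma cover_sum_pos:
  "ls \<noteq> [] \<Longrightarrow> \<forall>l\<in>set ls. 2 \<le> l \<Longrightarrow> 1 \<le> cover_sum ls" for ls :: "nat list"
  by (cases ls) auto

text \<open>Induction on the paths: once a path on \<open>Q\<close> is found, either a part
  \<open>A\<close> of the size of its cover is deleted, or \<open>Q\<close> meets so few edges that
  all of it is deleted. The factor comes from a single path, where \<open>l - 2\<close> is at most
  \<open>2 * (l div 2) - 1\<close>; the contradictions below rely on its being less than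
  \<open>2 * cover_sum ls\<close>.\<close>

lemma linear_forest_edge_bound:
  assumes "ls \<noteq> []" "\<forall>l\<in>set ls. 2 \<le> l"
  shows "\<exists>C. \<forall>(E :: 'a set set) X. simple_edges E \<longrightarrow> finite X \<longrightarrow>
    \<not> packs E X (map path_graph ls) \<longrightarrow> 2 * esize E X \<le> (2 * cover_sum ls - 1) * card X + C"
  using assms
proof (induction ls)
  case (Cons l ls)
  have EG: "2 * esize E X \<le> (2 * (l div 2) - 1) * card X"
    if "simple_edges E" "finite X" "\<And>xs. is_path E X xs \<Longrightarrow> length xs \<noteq> l" for E :: "'a set set" and X
  proof -
    have "2 * esize E X \<le> (l - 2) * card X" using erdos_gallai_path that Cons.prems(2) by auto
    also have "\<dots> \<le> (2 * (l div 2) - 1) * card X" by (intro mult_le_mono) auto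
    finally show ?thesis .
  qed
  obtain d where d: "l div 2 = Suc d" using Cons.prems(2) by (cases "l div 2") auto
  show ?case
  proof (cases "ls = []")
    case True
    have "2 * esize E X \<le> (2 * cover_sum (l # ls) - 1) * card X + 0"
      if "simple_edges E" "finite X" "\<not> packs E X (map path_graph (l # ls))" for E :: "'a set set" and X
      using EG[of E X] that packs_Cons_path[of E X _ "[]"] True by force
    then show ?thesis by blast
  next
    case False
    with Cons obtain C where C: "\<And>(E :: 'a set set) X. simple_edges E \<Longrightarrow> finite X \<Longrightarrow>
        \<not> packs E X (map path_graph ls) \<Longrightarrow> 2 * esize E X \<le> (2 * cover_sum ls - 1) * card X + C"
      by auto
    obtain c where c: "cover_sum ls = Suc c"
      using cover_sum_pos[of ls] False Cons.prems(2) by (cases "cover_sum ls") auto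
    let ?M = "l + sum_list ls"
    let ?C = "C + 2 * (l * (2 ^ l * ?M + l))"
    have "2 * esize E X \<le> (2 * cover_sum (l # ls) - 1) * card X + ?C"
      if E: "simple_edges E" and X: "finite X" and free: "\<not> packs E X (map path_graph (l # ls))"
      for E :: "'a set set" and X
    proof (cases "\<exists>xs. is_path E X xs \<and> length xs = l")
      case False
      then have "2 * esize E X \<le> (2 * (l div 2) - 1) * card X" using EG[OF E X] by blast
      also have "\<dots> \<le> (2 * cover_sum (l # ls) - 1) * card X" by (intro mult_le_mono) auto
      finally show ?thesis by simp
    next
      case True
      then obtain xs where xs: "is_path E X xs" "length xs = l" by blast
      let ?Q = "set xs"
      have Q: "?Q \<subseteq> X" "card ?Q = l" using xs by (auto simp: is_path_def distinct_card)
      have "\<not> packs E (X - ?Q) (map path_graph ls)" using packs_Cons_path[OF xs(1)] xs(2) free by auto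
      then have outside: "2 * esize E (X - ?Q) \<le> (2 * c + 1) * card X + C"
        using C[OF E, of "X - ?Q"] X mult_le_mono2[OF card_mono[of X "X - ?Q"], of "2 * c + 1"] c
        by simp
      from many_common_nbrs_or_few_edges[OF E X Q(1), of d ?M] Q(2)
      consider A where "A \<subseteq> ?Q" "card A = Suc d" "?M \<le> card (common_nbrs E (X - ?Q) A)"
        | "esize E X \<le> esize E (X - ?Q) + d * card X + l * (2 ^ l * ?M + l)" by auto
      then show ?thesis
      proof cases
        case 1
        have A: "A \<subseteq> X" using 1 Q by auto
        have "\<not> packs E (X - A) (map path_graph ls)"
          using packs_path_at_common_nbrs[OF X Q(1) 1(1) _ 1(3)] 1(2) d free by auto
        then have "2 * esize E (X - A) \<le> (2 * c + 1) * card X + C"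
          using C[OF E, of "X - A"] X mult_le_mono2[OF card_mono[of X "X - A"], of "2 * c + 1"] c
          by simp
        moreover have "esize E X \<le> esize E (X - A) + Suc d * card X"
          using esize_remove_le[OF E X A] 1(2) by simp
        ultimately have "2 * esize E X \<le> (2 * c + 1) * card X + C + 2 * (Suc d * card X)" by linarith
        then show ?thesis by (simp add: c d algebra_simps)
      next
        case 2
        then show ?thesis using outside by (simp add: c d algebra_simps)
      qed
    qed
    then show ?thesis by blast
  qed
qed simp

text \<open>Each path but the last yields \<open>l div 2\<close> vertices with many common
  neighbours, which are deleted. The edge hypothesis survives with the same \<open>C\<close>, since
  the deletion loses at most \<open>l div 2\<close> times the order and \<open>cover_sum\<close>
  drops by as much. For the last path no other path is left to combine with, and only its absence is
  recorded.\<close>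

lemma linear_forest_extract:
  assumes "\<forall>l\<in>set (ls @ [m]). 2 \<le> l"
  shows "\<exists>n0. \<forall>(E :: 'a set set) X. simple_edges E \<longrightarrow> finite X \<longrightarrow> n0 \<le> card X \<longrightarrow>
    \<not> packs E X (map path_graph (ls @ [m])) \<longrightarrow>
    2 * (cover_sum (ls @ [m]) - 1) * card X \<le> 2 * esize E X + C \<longrightarrow>
    (\<exists>A\<subseteq>X. card A = cover_sum ls \<and> (\<forall>xs. is_path E (X - A) xs \<longrightarrow> length xs \<noteq> m))"
  using assms
proof (induction ls)
  case Nil
  have "\<not> (is_path E X xs \<and> length xs = m)" if "\<not> packs E X (map path_graph ([] @ [m]))"
    for E :: "'a set set" and X xs
    using packs_Cons_path[of E X xs "[]"] that by auto
  then show ?case by (intro exI[of _ 0] allI impI exI[of _ "{}"]) auto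
next
  case (Cons l ls)
  from Cons obtain n1 where n1: "\<And>(E :: 'a set set) X. simple_edges E \<Longrightarrow> finite X \<Longrightarrow> n1 \<le> card X \<Longrightarrow>
    \<not> packs E X (map path_graph (ls @ [m])) \<Longrightarrow>
    2 * (cover_sum (ls @ [m]) - 1) * card X \<le> 2 * esize E X + C \<Longrightarrow>
    \<exists>A\<subseteq>X. card A = cover_sum ls \<and> (\<forall>xs. is_path E (X - A) xs \<longrightarrow> length xs \<noteq> m)"
    by auto
  obtain C' where C': "\<And>(E :: 'a set set) X. simple_edges E \<Longrightarrow> finite X \<Longrightarrow>
    \<not> packs E X (map path_graph (ls @ [m])) \<Longrightarrow>
    2 * esize E X \<le> (2 * cover_sum (ls @ [m]) - 1) * card X + C'"
    using linear_forest_edge_bound[of "ls @ [m]"] Cons.prems by auto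
  obtain d where d: "l div 2 = Suc d" using Cons.prems by (cases "l div 2") auto
  obtain c where c: "cover_sum (ls @ [m]) = Suc c"
    using cover_sum_pos[of "ls @ [m]"] Cons.prems by (cases "cover_sum (ls @ [m])") auto
  have c': "cover_sum ((l # ls) @ [m]) = Suc d + Suc c" using c d by simp
  let ?M = "l + sum_list (ls @ [m])"
  let ?C = "2 * (l * (2 ^ l * ?M + l))"
  \<comment> \<open>The summand \<open>l\<close> pays for the \<open>Suc d\<close> deleted vertices,
    so that \<open>n1\<close> vertices remain; \<open>C\<close>, \<open>C'\<close> and
    \<open>?C\<close> outweigh the constants in the two contradictions.\<close>
  let ?n0 = "C + C' + ?C + n1 + l + 1"
  have "\<exists>A\<subseteq>X. card A = cover_sum (l # ls) \<and> (\<forall>xs. is_path E (X - A) xs \<longrightarrow> length xs \<noteq> m)"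
    if E: "simple_edges E" and X: "finite X" and n: "?n0 \<le> card X"
      and free: "\<not> packs E X (map path_graph ((l # ls) @ [m]))"
      and many: "2 * (cover_sum ((l # ls) @ [m]) - 1) * card X \<le> 2 * esize E X + C"
    for E :: "'a set set" and X
  proof -
    have many': "2 * (d + Suc c) * card X \<le> 2 * esize E X + C" using many unfolding c' by simp
    have "\<exists>xs. is_path E X xs \<and> length xs = l"
    proof (rule ccontr)
      assume "\<not> ?thesis"
      then have "2 * esize E X \<le> (l - 2) * card X"
        using erdos_gallai_path[OF E X, of l] Cons.prems by auto
      also have "\<dots> \<le> (2 * d + 1) * card X" using d by (intro mult_le_mono) auto
      finally show False using many' n by (simp add: algebra_simps)
    qed
    then obtain xs where xs: "is_path E X xs" "length xs = l" by blast
    let ?Q = "set xs"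
    have Q: "?Q \<subseteq> X" "card ?Q = l" using xs by (auto simp: is_path_def distinct_card)
    have "\<not> packs E (X - ?Q) (map path_graph (ls @ [m]))"
      using packs_Cons_path[OF xs(1), of "ls @ [m]"] xs(2) free by auto
    then have "2 * esize E (X - ?Q) \<le> (2 * Suc c - 1) * card (X - ?Q) + C'"
      using C'[OF E, of "X - ?Q"] X unfolding c by blast
    also have "\<dots> \<le> (2 * c + 1) * card X + C'"
      using card_mono[of X "X - ?Q"] X by (intro add_mono mult_le_mono) auto
    \<comment> \<open>Otherwise the doubled edge count would have factor
      \<open>2 * c + 1 + 2 * d\<close>, one less than the assumed
      \<open>2 * (d + Suc c)\<close>.\<close>
    finally have "\<not> esize E X \<le> esize E (X - ?Q) + d * card X + l * (2 ^ l * ?M + l)"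
      using many' n by (simp add: algebra_simps)
    then obtain A where A: "A \<subseteq> ?Q" "card A = Suc d" "?M \<le> card (common_nbrs E (X - ?Q) A)"
      using many_common_nbrs_or_few_edges[OF E X Q(1), of d ?M] Q(2) by auto
    have AX: "A \<subseteq> X" using A Q by auto
    have free': "\<not> packs E (X - A) (map path_graph (ls @ [m]))"
      using packs_path_at_common_nbrs[OF X Q(1) A(1) _ A(3)] A(2) d free by auto
    have "esize E X \<le> esize E (X - A) + Suc d * card X"
      using esize_remove_le[OF E X AX] A(2) by simp
    then have "2 * c * card X \<le> 2 * esize E (X - A) + C" using many' by (simp add: algebra_simps)
    moreover have "2 * c * card (X - A) \<le> 2 * c * card X"
      using card_mono[of X "X - A"] X by (intro mult_le_mono) auto
    ultimately have many'': "2 * (cover_sum (ls @ [m]) - 1) * card (X - A) \<le> 2 * esize E (X - A) + C"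
      unfolding c diff_Suc_1 by (rule order_trans[rotated])
    have finA: "finite A" using AX X finite_subset by blast
    have cA: "card (X - A) = card X - Suc d" using A(2) AX finA by (simp add: card_Diff_subset)
    have "n1 \<le> card (X - A)" unfolding cA using n d by linarith
    then obtain B where B: "B \<subseteq> X - A" "card B = cover_sum ls"
      "\<forall>xs. is_path E (X - A - B) xs \<longrightarrow> length xs \<noteq> m"
      using n1[OF E, of "X - A"] X free' many'' by auto
    have "card (A \<union> B) = cover_sum (l # ls)"
      using B A(2) d finA finite_subset[OF B(1)] X by (subst card_Un_disjoint) auto
    moreover have "X - (A \<union> B) = X - A - B" by auto
    ultimately show ?thesis using B AX by (intro exI[of _ "A \<union> B"]) auto
  qed
  then show ?case by blast
qed

text \<open>Take a copy \<open>D\<close> of the star forest. Outside \<open>D\<close> the paths do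
  not fit, so there are few edges, and fewer than \<open>length ds\<close> vertices of large degree
  in \<open>D\<close> could not make up the difference. Large degree is all that a centre needs, as
  its leaves are chosen last.\<close>

lemma star_centres_extract:
  assumes "ls \<noteq> []" "\<forall>l\<in>set ls. 2 \<le> l" "ds \<noteq> []"
  obtains n0 where "\<And>(E :: 'a set set) V. simple_edges E \<Longrightarrow> finite V \<Longrightarrow> n0 \<le> card V \<Longrightarrow>
    packs E V (map star_graph ds) \<Longrightarrow> \<not> packs E V (forest ds ls) \<Longrightarrow>
    2 * (length ds + cover_sum ls - 1) * card V \<le> 2 * esize E V + C \<Longrightarrow>
    \<exists>T\<subseteq>V. card T = length ds \<and> \<not> packs E (V - T) (map path_graph ls)"
proof -
  obtain C' where C': "\<And>(E :: 'a set set) X. simple_edges E \<Longrightarrow> finite X \<Longrightarrow>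
    \<not> packs E X (map path_graph ls) \<Longrightarrow> 2 * esize E X \<le> (2 * cover_sum ls - 1) * card X + C'"
    using linear_forest_edge_bound[OF assms(1,2)] by blast
  obtain c where c: "cover_sum ls = Suc c"
    using cover_sum_pos[of ls] assms by (cases "cover_sum ls") auto
  obtain t where t: "length ds = Suc t" using assms(3) by (cases ds) auto
  let ?s = "sum_list ds + length ds" and ?\<Delta> = "sum_list ds + length ds + sum_list ls"
  show ?thesis
  proof (rule that[of "C + C' + 2 * (?s * ?\<Delta>) + 1"])
    fix E :: "'a set set" and V
    assume E: "simple_edges E" and V: "finite V" and n: "C + C' + 2 * (?s * ?\<Delta>) + 1 \<le> card V"
      and stars: "packs E V (map star_graph ds)" and free: "\<not> packs E V (forest ds ls)"
      and many: "2 * (length ds + cover_sum ls - 1) * card V \<le> 2 * esize E V + C"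
    obtain D where D: "D \<subseteq> V" "finite D" "card D = (\<Sum>A\<leftarrow>map star_graph ds. card (verts A))"
      "packs E D (map star_graph ds)"
      "\<forall>Bs. packs E (V - D) Bs \<longrightarrow> packs E V (map star_graph ds @ Bs)"
    proof (rule packs_support[OF stars])
      show "finite (verts A)" if "A \<in> set (map star_graph ds)" for A
        using that by (auto simp: star_graph_def)
    qed
    have cD: "card D = ?s"
      using D(3) by (simp add: star_graph_def comp_def sum_list_Suc)
    have "\<not> packs E (V - D) (map path_graph ls)" using D(5) free by blast
    then have "2 * esize E (V - D) \<le> (2 * Suc c - 1) * card (V - D) + C'"
      using C'[OF E, of "V - D"] V unfolding c by blast
    also have "\<dots> \<le> (2 * c + 1) * card V + C'"
      using card_mono[of V "V - D"] V by (intro add_mono mult_le_mono) auto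
    finally have outside: "2 * esize E (V - D) \<le> (2 * c + 1) * card V + C'" .
    let ?B = "{v \<in> D. ?\<Delta> \<le> degree E V v}"
    have large: "length ds \<le> card ?B"
    proof (rule ccontr)
      assume "\<not> ?thesis"
      then have B: "card ?B \<le> t" using t by simp
      have "(\<Sum>v\<in>D. degree E V v) \<le> (\<Sum>v\<in>D. ?\<Delta> + (if v \<in> ?B then card V else 0))"
        using card_mono[OF V nbrs_subset, of E] by (intro sum_mono) (auto intro: trans_le_add2)
      also have "\<dots> = card D * ?\<Delta> + card ?B * card V"
      proof -
        have "(\<Sum>v\<in>D. if v \<in> ?B then card V else 0) = card ?B * card V"
          using D(2) by (intro sum_if_const) auto
        then show ?thesis by (simp only: sum.distrib) (simp add: algebra_simps)
      qed
      also have "\<dots> \<le> ?s * ?\<Delta> + t * card V" using B cD by (intro add_mono mult_le_mono) auto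
      finally have "esize E V \<le> esize E (V - D) + ?s * ?\<Delta> + t * card V"
        using esize_le_degree_sum[OF E V D(1)] by linarith
      then show False using outside many n unfolding c t by (simp add: algebra_simps)
    qed
    obtain T where T: "T \<subseteq> ?B" "card T = length ds"
      by (rule obtain_subset_with_card_n[OF large])
    have TV: "T \<subseteq> V" using T(1) D(1) by auto
    have "\<not> packs E (V - T) (map path_graph ls)"
      using packs_stars_at_large_degree[OF V TV T(2) _ E, of ls] T(1) free by blast
    then show "\<exists>T\<subseteq>V. card T = length ds \<and> \<not> packs E (V - T) (map path_graph ls)"
      using TV T(2) by blast
  qed
qed

section \<open>Completing the core\<close>

text \<open>The component of \<open>u\<close> in the graph induced on \<open>Z\<close>. The closure
  is reflexive, so a vertex outside \<open>Z\<close> forms a class of its own.\<close>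

definition conn_class :: "'a set set \<Rightarrow> 'a set \<Rightarrow> 'a \<Rightarrow> 'a set" where
  "conn_class E Z u = {v. (u, v) \<in> {(x, y). x \<in> Z \<and> y \<in> Z \<and> {x, y} \<in> E}\<^sup>*}"

lemma conn_class_self [simp]: "u \<in> conn_class E Z u"
  by (simp add: conn_class_def)

lemma conn_class_subset: "u \<in> Z \<Longrightarrow> conn_class E Z u \<subseteq> Z"
  by (auto simp: conn_class_def elim: rtranclE)

lemma conn_class_eq:
  assumes "v \<in> conn_class E Z u"
  shows "conn_class E Z v = conn_class E Z u"
proof -
  let ?r = "{(x, y). x \<in> Z \<and> y \<in> Z \<and> {x, y} \<in> E}"
  have "sym ?r" by (auto simp: sym_def insert_commute)
  then have "sym (?r\<^sup>*)" by (rule sym_rtrancl)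
  then have "(u, v) \<in> ?r\<^sup>*" "(v, u) \<in> ?r\<^sup>*" using assms by (auto simp: conn_class_def sym_def)
  then show ?thesis unfolding conn_class_def by (auto intro: rtrancl_trans)
qed

lemma conn_class_disjoint:
  "conn_class E Z u \<noteq> conn_class E Z v \<Longrightarrow> conn_class E Z u \<inter> conn_class E Z v = {}"
  using conn_class_eq by (metis disjoint_iff)

lemma conn_class_step:
  "v \<in> conn_class E Z u \<Longrightarrow> v \<in> Z \<Longrightarrow> x \<in> Z \<Longrightarrow> {v, x} \<in> E \<Longrightarrow> x \<in> conn_class E Z u"
  unfolding conn_class_def by (auto intro: rtrancl_into_rtrancl)

lemma conn_class_if_path:
  "is_path E Z xs \<Longrightarrow> xs \<noteq> [] \<Longrightarrow> last xs \<in> conn_class E Z (hd xs)"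
proof (induction xs)
  case (Cons x xs)
  show ?case
  proof (cases "xs = []")
    case False
    have p: "is_path E Z xs" "{x, hd xs} \<in> E" "x \<in> Z"
      using Cons.prems(1) False by (auto simp: is_path_Cons)
    then have "last xs \<in> conn_class E Z (hd xs)" "hd xs \<in> Z"
      using Cons.IH False hd_in_set[OF False] by (auto simp: is_path_def)
    moreover have "hd xs \<in> conn_class E Z x"
      using conn_class_step[of x E Z x "hd xs"] p calculation by simp
    ultimately show ?thesis using conn_class_eq[of "hd xs" E Z x] False by simp
  qed simp
qed simp

lemma path_in_conn_class:
  assumes "u \<in> Z" "v \<in> conn_class E Z u"
  shows "\<exists>xs. is_path E (conn_class E Z u) xs \<and> xs \<noteq> [] \<and> hd xs = u \<and> last xs = v"
  using assms(2)[unfolded conn_class_def mem_Collect_eq]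
proof (induction rule: rtrancl_induct)
  case base
  then show ?case by (intro exI[of _ "[u]"]) (auto simp: is_path_def)
next
  case (step v w)
  then obtain xs where xs: "is_path E (conn_class E Z u) xs" "xs \<noteq> []" "hd xs = u" "last xs = v" by blast
  have w: "w \<in> conn_class E Z u"
    using conn_class_step[of v E Z u w] step by (auto simp: conn_class_def)
  show ?case
  proof (cases "w \<in> set xs")
    case True
    \<comment> \<open>The new vertex already lies on the path, which is therefore cut at
      \<open>w\<close> instead of extended.\<close>
    then obtain as bs where ab: "xs = (as @ [w]) @ bs" by (metis split_list append.assoc append_Cons append_Nil)
    then have "is_path E (conn_class E Z u) (as @ [w])" using xs(1) is_path_append by metis
    moreover have "hd (as @ [w]) = u" using xs(3) ab by (cases as) auto
    ultimately show ?thesis by (intro exI[of _ "as @ [w]"]) auto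
  next
    case False
    then have "is_path E (conn_class E Z u) (xs @ [w])"
      using xs step w by (auto simp: is_path_append is_path_Cons)
    then show ?thesis using xs by (intro exI[of _ "xs @ [w]"]) auto
  qed
qed

lemma path_between_conn_class:
  assumes "u \<in> Z" "v \<in> conn_class E Z u" "w \<in> conn_class E Z u"
  shows "\<exists>xs. is_path E (conn_class E Z u) xs \<and> xs \<noteq> [] \<and> hd xs = v \<and> last xs = w"
proof -
  have "v \<in> Z" using conn_class_subset[OF assms(1)] assms(2) by blast
  then show ?thesis
    using path_in_conn_class[of v Z w E] assms(3) unfolding conn_class_eq[OF assms(2)] by blast
qed

section \<open>Separating many vertices by few deletions\<close>

lemma fiber_pigeonhole:
  assumes "finite A" "card (f ` A) * k < card A"
  obtains y where "y \<in> f ` A" "k < card {x \<in> A. f x = y}"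
proof (rule ccontr)
  assume no: "\<not> thesis"
  have "card A = card (\<Union>y\<in>f ` A. {x \<in> A. f x = y})" by (rule arg_cong[of _ _ card]) auto
  also have "\<dots> \<le> (\<Sum>y\<in>f ` A. card {x \<in> A. f x = y})" using assms(1) by (intro card_UN_le) auto
  also have "\<dots> \<le> (\<Sum>y\<in>f ` A. k)" using no that by (intro sum_mono) (meson not_le)
  finally show False using assms(2) by simp
qed

text \<open>Only paths from one root are bounded, not all paths of the class. This form is
  inherited: when the root is deleted, its neighbour on a path to \<open>w\<close> is a root for the
  new class of \<open>w\<close>, with a bound smaller by one.\<close>

definition short_rooted :: "'a set set \<Rightarrow> 'a set \<Rightarrow> nat \<Rightarrow> 'a \<Rightarrow> bool" where
  "short_rooted E Z s w \<longleftrightarrow>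
    (\<exists>u\<in>conn_class E Z w. \<forall>xs. is_path E Z xs \<and> xs \<noteq> [] \<and> hd xs = u \<longrightarrow> length xs \<le> s)"

definition spread_classes :: "'a set set \<Rightarrow> 'a set \<Rightarrow> 'a set \<Rightarrow> nat \<Rightarrow> nat \<Rightarrow> bool" where
  "spread_classes E Z W0 s N \<longleftrightarrow> (\<exists>R\<subseteq>Z. card R \<le> s \<and> (\<exists>I\<subseteq>W0 - R. card I = N \<and> finite I \<and>
    (\<forall>w\<in>I. \<forall>w'\<in>I. w \<noteq> w' \<longrightarrow> conn_class E (Z - R) w \<inter> conn_class E (Z - R) w' = {})))"

text \<open>Either \<open>W0\<close> already meets \<open>N\<close> classes, or one class has more
  than \<open>b\<close> vertices of \<open>W0\<close>; then its root is deleted and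
  \<open>step\<close> applies.\<close>

lemma spread_classes_step:
  assumes Z: "finite Z" and W0: "W0 \<subseteq> Z" "N * b + N \<le> card W0" and N: "0 < N"
    and short: "\<And>w. w \<in> W0 \<Longrightarrow> short_rooted E Z (Suc s) w"
    and step: "\<And>u W1. W1 \<subseteq> Z - {u} \<Longrightarrow> b \<le> card W1 \<Longrightarrow>
      (\<And>w. w \<in> W1 \<Longrightarrow> short_rooted E (Z - {u}) s w) \<Longrightarrow> spread_classes E (Z - {u}) W1 s N"
  shows "spread_classes E Z W0 (Suc s) N"
proof (cases "N \<le> card (conn_class E Z ` W0)")
  case True
  obtain D where D: "D \<subseteq> conn_class E Z ` W0" "card D = N"
    by (rule obtain_subset_with_card_n[OF True])
  then obtain I where I: "I \<subseteq> W0" "inj_on (conn_class E Z) I" "D = conn_class E Z ` I"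
    unfolding subset_image_inj by blast
  have "card I = N" using I D(2) card_image by fastforce
  moreover have "finite I" using I(1) W0(1) Z by (meson finite_subset)
  moreover have "conn_class E Z w \<inter> conn_class E Z w' = {}" if "w \<in> I" "w' \<in> I" "w \<noteq> w'" for w w'
    using that I(2) by (intro conn_class_disjoint) (auto simp: inj_on_def)
  ultimately show ?thesis
    unfolding spread_classes_def using I(1) by (intro exI[of _ "{}"] conjI exI[of _ I]) auto
next
  case False
  have finW: "finite W0" using W0(1) Z by (meson finite_subset)
  have "card (conn_class E Z ` W0) * b \<le> N * b" using False by (intro mult_le_mono) auto
  then have few: "card (conn_class E Z ` W0) * b < card W0" using W0(2) N by linarith
  obtain D where D: "D \<in> conn_class E Z ` W0" "b < card {w \<in> W0. conn_class E Z w = D}"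
    by (rule fiber_pigeonhole[OF finW few])
  then obtain w0 where w0: "w0 \<in> W0" "D = conn_class E Z w0" by blast
  then obtain u where u: "u \<in> D"
    "\<And>xs. is_path E Z xs \<Longrightarrow> xs \<noteq> [] \<Longrightarrow> hd xs = u \<Longrightarrow> length xs \<le> Suc s"
    using short[OF w0(1)] unfolding short_rooted_def by blast
  have uZ: "u \<in> Z" using u(1) w0 W0(1) conn_class_subset by (metis subsetD)
  have Du: "conn_class E Z u = D" using conn_class_eq u(1) w0(2) by metis
  \<comment> \<open>The root may itself belong to \<open>W0\<close>; the strict inequality from the
    pigeonhole pays for its removal.\<close>
  let ?W = "{w \<in> W0. conn_class E Z w = D} - {u}"
  have "b \<le> card ?W"
    using D(2) finW by (cases "u \<in> {w \<in> W0. conn_class E Z w = D}") (auto simp: card_Diff_singleton_if)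
  moreover have "short_rooted E (Z - {u}) s w" if w: "w \<in> ?W" for w
  proof -
    have "conn_class E Z w = conn_class E Z u" using w Du by blast
    then have "w \<in> conn_class E Z u" using conn_class_self by metis
    then obtain xs where xs: "is_path E (conn_class E Z u) xs" "xs \<noteq> []" "hd xs = u" "last xs = w"
      using path_in_conn_class[OF uZ] by blast
    then obtain ys where ys: "xs = u # ys" by (cases xs) auto
    have ne: "ys \<noteq> []" using ys xs(4) w by auto
    have pZ: "is_path E Z (u # ys)" using is_path_mono[OF xs(1) conn_class_subset[OF uZ]] ys by simp
    then have "is_path E Z ys" "u \<notin> set ys" by (auto simp: is_path_Cons)
    then have py: "is_path E (Z - {u}) ys" by (auto simp: is_path_def)
    have "last ys \<in> conn_class E (Z - {u}) (hd ys)" by (rule conn_class_if_path[OF py ne])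
    then have "hd ys \<in> conn_class E (Z - {u}) w"
      using conn_class_eq[of w E "Z - {u}" "hd ys"] ys xs(4) ne by simp
    \<comment> \<open>With \<open>u\<close> in front this becomes a path from the old root, so it
      has at most \<open>Suc s\<close> vertices.\<close>
    moreover have "length zs \<le> s" if zs: "is_path E (Z - {u}) zs" "zs \<noteq> []" "hd zs = hd ys" for zs
    proof -
      have "is_path E Z zs" using zs(1) by (rule is_path_mono) auto
      moreover have "u \<notin> set zs" using zs(1) by (auto simp: is_path_def)
      ultimately have "is_path E Z (u # zs)" using zs pZ ne uZ by (simp add: is_path_Cons)
      then show ?thesis using u(2)[of "u # zs"] by simp
    qed
    ultimately show ?thesis unfolding short_rooted_def by blast
  qed
  ultimately have "spread_classes E (Z - {u}) ?W s N" using W0(1) by (intro step) auto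
  then obtain R I where R: "R \<subseteq> Z - {u}" "card R \<le> s" "I \<subseteq> ?W - R" "card I = N" "finite I"
    "\<forall>w\<in>I. \<forall>w'\<in>I. w \<noteq> w' \<longrightarrow> conn_class E (Z - {u} - R) w \<inter> conn_class E (Z - {u} - R) w' = {}"
    unfolding spread_classes_def by blast
  have eq: "Z - insert u R = Z - {u} - R" by auto
  have "finite R" using R(1) Z by (meson finite_Diff finite_subset)
  then have "card (insert u R) \<le> Suc s" using R(2) by (simp add: card_insert_if)
  then show ?thesis
    unfolding spread_classes_def using R uZ
    by (intro exI[of _ "insert u R"] conjI exI[of _ I]) (auto simp: eq)
qed

text \<open>Deleting the common start of all short paths shortens them, so after at most s deletions the
  vertices of W0 are spread over many components.\<close>

lemma spread_over_components:
  assumes "0 < N"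
  obtains b where "\<And>(E :: 'a set set) Z W0. finite Z \<Longrightarrow> W0 \<subseteq> Z \<Longrightarrow> b \<le> card W0 \<Longrightarrow>
    \<forall>w\<in>W0. short_rooted E Z s w \<Longrightarrow> spread_classes E Z W0 s N"
proof -
  have "\<exists>b. \<forall>(E :: 'a set set) Z W0. finite Z \<longrightarrow> W0 \<subseteq> Z \<longrightarrow> b \<le> card W0 \<longrightarrow>
    (\<forall>w\<in>W0. short_rooted E Z s w) \<longrightarrow> spread_classes E Z W0 s N"
  proof (induction s)
    case 0
    \<comment> \<open>The one-vertex path at the root violates the bound 0, so \<open>b = 1\<close>
      makes the base case vacuous.\<close>
    have "\<not> short_rooted E Z 0 w" if "w \<in> Z" for E :: "'a set set" and Z w
    proof
      assume "short_rooted E Z 0 w"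
      then obtain u where u: "u \<in> conn_class E Z w"
        "\<And>xs. is_path E Z xs \<Longrightarrow> xs \<noteq> [] \<Longrightarrow> hd xs = u \<Longrightarrow> length xs \<le> 0"
        unfolding short_rooted_def by blast
      have "u \<in> Z" using u(1) that conn_class_subset by (metis subsetD)
      then show False using u(2)[of "[u]"] by (simp add: is_path_def)
    qed
    moreover have "\<exists>w. w \<in> W0" if "1 \<le> card W0" for W0 :: "'a set"
      using that by (cases "W0 = {}") auto
    ultimately show ?case by (intro exI[of _ 1]) blast
  next
    case (Suc s)
    then obtain b where b: "\<forall>(E :: 'a set set) Z W0. finite Z \<longrightarrow> W0 \<subseteq> Z \<longrightarrow> b \<le> card W0 \<longrightarrow>
      (\<forall>w\<in>W0. short_rooted E Z s w) \<longrightarrow> spread_classes E Z W0 s N" by blast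
    have "spread_classes E Z W0 (Suc s) N"
      if "finite Z" "W0 \<subseteq> Z" "N * b + N \<le> card W0" "\<forall>w\<in>W0. short_rooted E Z (Suc s) w"
      for E :: "'a set set" and Z W0
      using that b assms by (intro spread_classes_step[of Z W0 N b]) auto
    then show ?case by blast
  qed
  then obtain b where "\<forall>(E :: 'a set set) Z W0. finite Z \<longrightarrow> W0 \<subseteq> Z \<longrightarrow> b \<le> card W0 \<longrightarrow>
    (\<forall>w\<in>W0. short_rooted E Z s w) \<longrightarrow> spread_classes E Z W0 s N" by blast
  then show ?thesis by (intro that[of b]) simp
qed

text \<open>A path with at most \<open>d\<close> vertices can be extended: its last vertex has
  \<open>d\<close> neighbours, and at most \<open>d - 1\<close> of them precede it.\<close>

lemma greedy_path:
  assumes "finite Y" "simple_edges E" "\<And>y. y \<in> Y \<Longrightarrow> d \<le> degree E Y y" "y0 \<in> Y"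
  shows "\<exists>xs. is_path E Y xs \<and> xs \<noteq> [] \<and> hd xs = y0 \<and> length xs = Suc d"
proof -
  have "\<exists>xs. is_path E Y xs \<and> xs \<noteq> [] \<and> hd xs = y0 \<and> length xs = Suc j" if "j \<le> d" for j
    using that
  proof (induction j)
    case 0
    then show ?case using assms(4) by (intro exI[of _ "[y0]"]) (auto simp: is_path_def)
  next
    case (Suc j)
    then obtain xs where xs: "is_path E Y xs" "xs \<noteq> []" "hd xs = y0" "length xs = Suc j" by auto
    let ?v = "last xs"
    have v: "?v \<in> Y" using xs by (auto simp: is_path_def)
    have "\<not> nbrs E Y ?v \<subseteq> set xs"
    proof
      assume "nbrs E Y ?v \<subseteq> set xs"
      then have "nbrs E Y ?v \<subseteq> set (butlast xs)"
        using not_in_nbrs[OF assms(2), of ?v Y] xs(2) by (cases xs rule: rev_cases) auto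
      then have "degree E Y ?v \<le> length (butlast xs)"
        by (meson card_length card_mono List.finite_set order_trans)
      then show False using assms(3)[OF v] xs(4) Suc.prems by simp
    qed
    then obtain y where "y \<in> nbrs E Y ?v" "y \<notin> set xs" by blast
    then have "is_path E Y (xs @ [y])"
      using xs by (auto simp: is_path_append is_path_Cons nbrs_def insert_commute)
    then show ?case using xs by (intro exI[of _ "xs @ [y]"]) auto
  qed
  then show ?thesis by blast
qed

text \<open>The path moves from class to class by way of the hubs \<open>rs\<close>, each of which
  has a neighbour in every class. Every class but the last contributes at least one vertex and every
  hub exactly one, hence \<open>2 * length rs\<close>; the degrees inside the last class give the
  remaining \<open>Suc d\<close>.\<close>

lemma path_through_hubs:
  assumes "simple_edges E"
    and "length ws = Suc (length rs)" "distinct ws" "distinct rs"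
    and "\<And>w. w \<in> set ws \<Longrightarrow> finite (Y w)"
    and "\<And>w y. w \<in> set ws \<Longrightarrow> y \<in> Y w \<Longrightarrow> d \<le> degree E (Y w) y"
    and "\<And>w y z. w \<in> set ws \<Longrightarrow> y \<in> Y w \<Longrightarrow> z \<in> Y w \<Longrightarrow>
      \<exists>xs. is_path E (Y w) xs \<and> xs \<noteq> [] \<and> hd xs = y \<and> last xs = z"
    and "\<And>w r. w \<in> set ws \<Longrightarrow> r \<in> set rs \<Longrightarrow> \<exists>z\<in>Y w. {r, z} \<in> E"
    and "\<And>w w'. w \<in> set ws \<Longrightarrow> w' \<in> set ws \<Longrightarrow> w \<noteq> w' \<Longrightarrow> Y w \<inter> Y w' = {}"
    and "\<And>w. w \<in> set ws \<Longrightarrow> Y w \<inter> set rs = {}"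
    and "y \<in> Y (hd ws)"
  shows "\<exists>xs. is_path E ((\<Union>w\<in>set ws. Y w) \<union> set rs) xs \<and> xs \<noteq> [] \<and> hd xs = y \<and>
    2 * length rs + Suc d \<le> length xs"
  using assms(2-)
proof (induction rs arbitrary: ws y)
  case Nil
  then obtain w where ws: "ws = [w]" by (cases ws) auto
  have "\<exists>xs. is_path E (Y w) xs \<and> xs \<noteq> [] \<and> hd xs = y \<and> length xs = Suc d"
    using Nil ws by (intro greedy_path assms(1)) auto
  then show ?case using ws by auto
next
  case (Cons r rs)
  then obtain w ws' where ws: "ws = w # ws'" "length ws' = Suc (length rs)" by (cases ws) auto
  then obtain w' where w': "w' = hd ws'" "w' \<in> set ws'" by (cases ws') auto
  obtain z where z: "z \<in> Y w" "{r, z} \<in> E" using Cons.prems(7)[of w r] ws by auto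
  obtain y' where y': "y' \<in> Y w'" "{r, y'} \<in> E" using Cons.prems(7)[of w' r] ws w' by auto
  obtain ps where ps: "is_path E (Y w) ps" "ps \<noteq> []" "hd ps = y" "last ps = z"
    using Cons.prems(6)[of w y z] Cons.prems(10) z(1) ws by auto
  let ?U = "(\<Union>w\<in>set ws'. Y w) \<union> set rs"
  have "\<exists>xs. is_path E ?U xs \<and> xs \<noteq> [] \<and> hd xs = y' \<and> 2 * length rs + Suc d \<le> length xs"
  proof (rule Cons.IH)
    show "y' \<in> Y (hd ws')" using y' w' by simp
    show "\<And>w. w \<in> set ws' \<Longrightarrow> Y w \<inter> set rs = {}" using Cons.prems(9) ws by fastforce
  qed (use Cons.prems ws in auto)
  then obtain xs where xs: "is_path E ?U xs" "xs \<noteq> []" "hd xs = y'" "2 * length rs + Suc d \<le> length xs" by blast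
  let ?U' = "(\<Union>w\<in>set ws. Y w) \<union> set (r # rs)"
  have "set ps \<subseteq> Y w" "set xs \<subseteq> ?U" using ps(1) xs(1) by (auto simp: is_path_def)
  moreover have "Y w \<inter> ?U = {}"
  proof -
    have "Y w \<inter> Y v = {}" if "v \<in> set ws'" for v
      using Cons.prems(8)[of w v] Cons.prems(2) that ws by auto
    moreover have "Y w \<inter> set rs = {}" using Cons.prems(9)[of w] ws by auto
    ultimately show ?thesis by blast
  qed
  moreover have "r \<notin> Y w" "r \<notin> ?U"
    using Cons.prems(3,9) ws by fastforce+
  ultimately have disj: "set ps \<inter> set xs = {}" "r \<notin> set ps" "r \<notin> set xs" by blast+
  have "is_path E ?U' ps" using ps(1) by (rule is_path_mono) (auto simp: ws)
  moreover have "is_path E ?U' xs" using xs(1) by (rule is_path_mono) (auto simp: ws)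
  ultimately have "is_path E ?U' (ps @ r # xs)"
    using disj ps xs y'(2) z(2)
    by (auto simp: is_path_append is_path_Cons insert_commute)
  moreover have "1 \<le> length ps" using ps(2) by (cases ps) auto
  then have "2 * length (r # rs) + Suc d \<le> length (ps @ r # xs)" using xs(4) by simp
  moreover have "hd (ps @ r # xs) = y" using ps by simp
  ultimately show ?case by (intro exI[of _ "ps @ r # xs"]) simp
qed

text \<open>The factor 2k - 1 instead of 2k leaves a surplus of order card V in the edge count of V0, which
  keeps the common neighbourhood of K inside V0 large.\<close>

lemma min_degree_subset:
  assumes "finite V" "K \<subseteq> V" "simple_edges E" "1 \<le> k"
  obtains V0 where "K \<subseteq> V0" "V0 \<subseteq> V" "\<And>v. v \<in> V0 - K \<Longrightarrow> k \<le> degree E V0 v"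
    "2 * esize E V + (2 * k - 1) * card V0 \<le> 2 * esize E V0 + (2 * k - 1) * card V"
proof -
  have "\<exists>V0. K \<subseteq> V0 \<and> V0 \<subseteq> V \<and> (\<forall>v\<in>V0 - K. k \<le> degree E V0 v) \<and>
    2 * esize E V + (2 * k - 1) * card V0 \<le> 2 * esize E V0 + (2 * k - 1) * card V"
    using assms(1,2)
  proof (induction "card V" arbitrary: V rule: less_induct)
    case less
    show ?case
    proof (cases "\<forall>v\<in>V - K. k \<le> degree E V v")
      case True
      then show ?thesis using less by (intro exI[of _ V]) auto
    next
      case False
      then obtain v where v: "v \<in> V" "v \<notin> K" "degree E V v < k" by auto
      have cV: "card V = Suc (card (V - {v}))" using v(1) less(2) by (metis card.remove)
      have "\<exists>V0. K \<subseteq> V0 \<and> V0 \<subseteq> V - {v} \<and> (\<forall>v\<in>V0 - K. k \<le> degree E V0 v) \<and>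
        2 * esize E (V - {v}) + (2 * k - 1) * card V0 \<le> 2 * esize E V0 + (2 * k - 1) * card (V - {v})"
        by (rule less(1)) (use cV less(2,3) v in auto)
      then obtain V0 where V0: "K \<subseteq> V0" "V0 \<subseteq> V - {v}" "\<forall>v\<in>V0 - K. k \<le> degree E V0 v"
        "2 * esize E (V - {v}) + (2 * k - 1) * card V0 \<le> 2 * esize E V0 + (2 * k - 1) * card (V - {v})"
        by blast
      have "esize E V \<le> esize E (V - {v}) + (k - 1)"
        using esize_remove[OF assms(3) less(2) v(1)] v(3) by simp
      then have "2 * esize E V + (2 * k - 1) * card V0 \<le> 2 * esize E V0 + (2 * k - 1) * card V"
      proof -
        have "(2 * k - 1) * card V = (2 * k - 1) * card (V - {v}) + (2 * k - 1)"
          unfolding cV by (simp only: mult_Suc_right add.commute)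
        then show ?thesis using V0(4) assms(4) \<open>esize E V \<le> _\<close> by linarith
      qed
      then show ?thesis using V0(1-3) by blast
    qed
  qed
  then show ?thesis using that by blast
qed

section \<open>Common neighbours of the partial core and its completion\<close>

lemma degree_sum_le_common_nbrs:
  assumes "finite V" "K \<subseteq> V" "card K = Suc \<kappa>"
  shows "(\<Sum>c\<in>K. degree E V c) \<le> Suc \<kappa> * Suc \<kappa> + \<kappa> * card (V - K) + card (common_nbrs E (V - K) K)"
proof -
  have finK: "finite K" using assms(1,2) finite_subset by blast
  let ?W = "common_nbrs E (V - K) K"
  have "degree E V c \<le> card K + degree E (V - K) c" if "c \<in> K" for c
  proof -
    have "nbrs E V c = nbrs E K c \<union> nbrs E (V - K) c" using assms(2) by (auto simp: nbrs_def)
    then have "degree E V c \<le> degree E K c + degree E (V - K) c"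
      by (simp add: card_Un_le)
    then show ?thesis using card_mono[OF finK nbrs_subset, of E c] by simp
  qed
  then have "(\<Sum>c\<in>K. degree E V c) \<le> (\<Sum>c\<in>K. card K + degree E (V - K) c)"
    by (rule sum_mono)
  also have "\<dots> = card K * card K + (\<Sum>u\<in>V - K. degree E K u)"
    using finK assms(1) by (simp add: sum.distrib sum_nbrs_swap)
  \<comment> \<open>A vertex outside \<open>K\<close> that misses no vertex of \<open>K\<close> is a
    common neighbour; all others contribute at most \<kappa>.\<close>
  also have "(\<Sum>u\<in>V - K. degree E K u) \<le> (\<Sum>u\<in>V - K. \<kappa> + (if u \<in> ?W then 1 else 0))"
  proof (rule sum_mono)
    fix u assume u: "u \<in> V - K"
    show "degree E K u \<le> \<kappa> + (if u \<in> ?W then 1 else 0)"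
    proof (cases "u \<in> ?W")
      case True
      then show ?thesis using card_mono[OF finK nbrs_subset, of E u] assms(3) by simp
    next
      case False
      then obtain c where "c \<in> K" "{u, c} \<notin> E" using u unfolding common_nbrs_def by blast
      moreover have "{c, u} = {u, c}" by blast
      ultimately have "c \<in> K" "c \<notin> nbrs E K u" by (simp_all add: nbrs_def)
      then have "nbrs E K u \<subset> K" using nbrs_subset[of E K u] by blast
      then have "degree E K u < card K" by (rule psubset_card_mono[OF finK])
      then show ?thesis using assms(3) by simp
    qed
  qed
  also have "\<dots> = \<kappa> * card (V - K) + card ?W"
  proof -
    have "?W \<subseteq> V - K" by (auto simp: common_nbrs_def)
    then have "(\<Sum>u\<in>V - K. if u \<in> ?W then 1 else 0) = card ?W * 1"
      using assms(1) by (intro sum_if_const) auto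
    then show ?thesis by (simp only: sum.distrib) simp
  qed
  finally show ?thesis by (simp add: assms(3))
qed

text \<open>\<open>n\<close> stands for the surplus that the reduction to large minimum degree
  leaves, namely the order of the original graph. Edges outside \<open>K\<close> and edges from
  \<open>K\<close> to vertices missing part of it use up the term with factor
  \<open>2 * (\<kappa> + q) + 1\<close>, so common neighbours have to account for the
  surplus.\<close>

lemma core_common_nbrs_large:
  assumes "simple_edges E" "finite V" "K \<subseteq> V" "card K = Suc \<kappa>" "2 \<le> m" "m \<le> 2 * q + 3"
    and "\<And>xs. is_path E (V - K) xs \<Longrightarrow> length xs \<noteq> m"
    and "n + (2 * (\<kappa> + q) + 1) * card V \<le> 2 * esize E V + C"
  shows "n \<le> C + Suc \<kappa> + 2 * card (common_nbrs E (V - K) K)"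
proof -
  let ?h = "card (V - K)" and ?w = "card (common_nbrs E (V - K) K)"
  have "2 * esize E (V - K) \<le> (m - 2) * ?h"
    using assms(2,7) by (intro erdos_gallai_path[OF assms(1) _ assms(5)]) auto
  also have "\<dots> \<le> (2 * q + 1) * ?h" using assms(6) by (intro mult_le_mono) auto
  finally have outside: "2 * esize E (V - K) \<le> (2 * q + 1) * ?h" .
  have "finite K" using assms(2,3) finite_subset by blast
  then have cV: "card V = Suc \<kappa> + ?h"
    using card_Diff_subset[OF _ assms(3)] card_mono[OF assms(2,3)] assms(4) by simp
  have "esize E V \<le> esize E (V - K) + (Suc \<kappa> * Suc \<kappa> + \<kappa> * ?h + ?w)"
    using esize_le_degree_sum[OF assms(1-3)] degree_sum_le_common_nbrs[OF assms(2-4), of E] by linarith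
  then have "2 * esize E V \<le> (2 * q + 1) * ?h + 2 * (Suc \<kappa> * Suc \<kappa>) + 2 * \<kappa> * ?h + 2 * ?w"
    using outside by (simp add: algebra_simps)
  moreover have "(2 * (\<kappa> + q) + 1) * card V =
      (2 * q + 1) * ?h + 2 * \<kappa> * ?h + (2 * \<kappa> + 1) * Suc \<kappa> + 2 * q * Suc \<kappa>"
    unfolding cV by (simp add: algebra_simps)
  moreover have "2 * (Suc \<kappa> * Suc \<kappa>) = (2 * \<kappa> + 1) * Suc \<kappa> + Suc \<kappa>" by (simp add: algebra_simps)
  ultimately show ?thesis using assms(8) by linarith
qed

text \<open>A vertex that is alone in its class has all its neighbours in \<open>K\<close> and
  \<open>R'\<close>. Its degree forces \<open>q\<close> vertices into \<open>R'\<close>, and adding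
  these to \<open>K\<close> keeps all of \<open>J\<close> among the common neighbours.\<close>

lemma core_from_singleton_classes:
  assumes "simple_edges E" "finite V" "K \<subseteq> V" "card K = Suc \<kappa>" "R \<subseteq> V - K"
    and "J \<subseteq> common_nbrs E (V - K) K - R" "J \<noteq> {}"
    and "\<And>w. w \<in> J \<Longrightarrow> Suc (\<kappa> + q) \<le> degree E V w"
    and "\<And>w. w \<in> J \<Longrightarrow> conn_class E (V - K - R) w = {w}"
    and "\<And>w. w \<in> J \<Longrightarrow> {r \<in> R. {r, w} \<in> E} = R'"
  shows "\<exists>K'\<subseteq>V. card K' = Suc (\<kappa> + q) \<and> J \<subseteq> common_nbrs E (V - K') K'"
proof -
  have finK: "finite K" using assms(2,3) finite_subset by blast
  obtain w0 where w0: "w0 \<in> J" using assms(7) by blast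
  have R': "R' \<subseteq> R" using assms(10)[OF w0] by blast
  have finR': "finite R'" using R' assms(2,5) by (meson finite_Diff finite_subset)
  have w0V: "w0 \<in> V - K - R" using w0 assms(6) by (auto simp: common_nbrs_def)
  have "nbrs E V w0 \<subseteq> K \<union> R'"
  proof
    fix v assume v: "v \<in> nbrs E V w0"
    show "v \<in> K \<union> R'"
    proof (rule ccontr)
      assume "v \<notin> K \<union> R'"
      then have "v \<in> V - K - R" using v assms(10)[OF w0] by (auto simp: nbrs_def)
      moreover have "{w0, v} \<in> E" using v by (simp add: nbrs_def insert_commute)
      ultimately have "v \<in> conn_class E (V - K - R) w0"
        using conn_class_step[OF conn_class_self w0V] by blast
      then have "v = w0" using assms(9)[OF w0] by simp
      then show False using not_in_nbrs[OF assms(1)] v by metis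
    qed
  qed
  then have "degree E V w0 \<le> card K + card R'"
    using card_mono[of "K \<union> R'"] card_Un_le[of K R'] finK finR' by (meson finite_UnI order_trans)
  then have "q \<le> card R'" using assms(4) assms(8)[OF w0] by linarith
  then obtain B where B: "B \<subseteq> R'" "card B = q" "finite B" by (rule obtain_subset_with_card_n)
  have disj: "K \<inter> B = {}" using B(1) R' assms(5) by auto
  have "card (K \<union> B) = Suc (\<kappa> + q)" using B disj finK assms(4) by (simp add: card_Un_disjoint)
  moreover have "K \<union> B \<subseteq> V" using assms(3,5) B(1) R' by auto
  moreover have "J \<subseteq> common_nbrs E (V - (K \<union> B)) (K \<union> B)"
  proof
    fix w assume w: "w \<in> J"
    then have "w \<in> common_nbrs E (V - K) K" "w \<notin> R" using assms(6) by auto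
    moreover have "{w, r} \<in> E" if "r \<in> B" for r
      using that B(1) assms(10)[OF w] by (auto simp: insert_commute)
    ultimately show "w \<in> common_nbrs E (V - (K \<union> B)) (K \<union> B)"
      using B(1) R' by (auto simp: common_nbrs_def)
  qed
  ultimately show ?thesis by blast
qed

lemma conn_class_has_nbr:
  assumes "w \<in> Z" "conn_class E Z w \<noteq> {w}"
  obtains x where "x \<in> conn_class E Z w" "x \<noteq> w" "{w, x} \<in> E"
proof -
  obtain y where y: "y \<in> conn_class E Z w" "y \<noteq> w" using assms(2) conn_class_self[of w E Z] by blast
  then obtain xs where xs: "is_path E (conn_class E Z w) xs" "xs \<noteq> []" "hd xs = w" "last xs = y"
    using path_in_conn_class[OF assms(1) y(1)] by blast
  then obtain x zs where zs: "xs = w # x # zs"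
    using y(2) by (metis last.simps list.exhaust_sel)
  then have "x \<in> conn_class E Z w" "x \<noteq> w" "{w, x} \<in> E"
    using xs(1) by (auto simp: is_path_Cons is_path_def)
  then show ?thesis using that by blast
qed

text \<open>The two given paths share a budget of core vertices; the rest of the forest alternates
  between what is left of \<open>K\<close> and of \<open>W\<close>.\<close>

lemma packs_two_saved_paths:
  assumes "finite V" "K \<subseteq> V" "W \<subseteq> common_nbrs E (V - K) K"
    and "is_path E V P1" "length P1 = m" "is_path E V P2" "length P2 = l'" "set P1 \<inter> set P2 = {}"
    and "card (set P1 \<inter> K) + card (set P2 \<inter> K) + length ds + cover_sum ls \<le> card K"
    and "sum_list ds + sum_list ls + m + l' \<le> card W"
  shows "packs E V (forest ds (ls @ [l', m]))"
proof -
  have finK: "finite K" and finW: "finite W"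
    using assms(1-3) finite_common_nbrs[of "V - K"] by (auto intro: finite_subset)
  let ?Z = "K - set P1 - set P2" and ?W = "W - set P1 - set P2"
  have "?Z = K - (set P1 \<inter> K) - (set P2 \<inter> K)" by auto
  then have "card K - card (set P1 \<inter> K) - card (set P2 \<inter> K) \<le> card ?Z"
    by (metis (no_types, lifting) diff_card_le_card_Diff diff_le_mono finite_Int List.finite_set order_trans)
  then have cZ: "length ds + cover_sum ls \<le> card ?Z" using assms(9) by linarith
  have "card W - card (set P1) - card (set P2) \<le> card ?W"
    by (metis diff_card_le_card_Diff diff_le_mono List.finite_set order_trans)
  moreover have "card (set P1) \<le> m" "card (set P2) \<le> l'" using assms(5,7) card_length by auto
  ultimately have cW: "sum_list ds + sum_list ls \<le> card ?W" using assms(10) by linarith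
  have "packs E (?Z \<union> ?W) (forest ds ls)"
  proof (rule packs_forest_bipartite)
    show "?Z \<inter> ?W = {}" using assms(3) by (auto simp: common_nbrs_def)
    show "{z, w} \<in> E" if "z \<in> ?Z" "w \<in> ?W" for z w
    proof -
      have "{w, z} \<in> E" using that assms(3) by (auto simp: common_nbrs_def)
      then show ?thesis by (simp add: insert_commute)
    qed
  qed (use finK finW cZ cW in auto)
  then have rest: "packs E (V - set P2 - set P1) (forest ds ls)"
    by (rule packs_mono) (use assms(2,3) in \<open>auto simp: common_nbrs_def\<close>)
  have P1: "set P1 \<subseteq> V - set P2" "copy_on E (path_graph m) (set P1)"
    using assms(4,5,8) copy_on_path_if_is_path[OF assms(4)] by (auto simp: is_path_def)
  have P2: "set P2 \<subseteq> V" "copy_on E (path_graph l') (set P2)"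
    using assms(6,7) copy_on_path_if_is_path[OF assms(6)] by (auto simp: is_path_def)
  have "packs E (V - set P2) ((forest ds ls) @ path_graph m # [])"
    using P1 rest by (intro packs_insert[OF P1]) simp
  then have "packs E V ((forest ds ls) @ path_graph l' # [path_graph m])"
    by (intro packs_insert[OF P2]) simp
  then show ?thesis by simp
qed

text \<open>A path on m vertices uses a single vertex of K: it joins at this vertex a path in one class to
  a path running through several classes and the hubs in R'. A path on l' vertices saves one more
  vertex of K by starting and ending with an edge inside a class.\<close>

lemma packs_from_large_classes:
  assumes E: "simple_edges E" and V: "finite V" and K: "K \<subseteq> V"
    and cK: "card K = length ds + cover_sum ls + l' div 2" "ds \<noteq> []"
    and R: "R \<subseteq> V - K" and J: "J \<subseteq> common_nbrs E (V - K) K - R" "q + 4 \<le> card J"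
    and deg: "\<And>v. v \<in> V - K \<Longrightarrow> card K + q \<le> degree E V v"
    and big: "\<And>w. w \<in> J \<Longrightarrow> conn_class E (V - K - R) w \<noteq> {w}"
    and att: "\<And>w. w \<in> J \<Longrightarrow> {r \<in> R. \<exists>y\<in>conn_class E (V - K - R) w. {r, y} \<in> E} = R'"
    and disj: "\<And>w w'. w \<in> J \<Longrightarrow> w' \<in> J \<Longrightarrow> w \<noteq> w' \<Longrightarrow>
      conn_class E (V - K - R) w \<inter> conn_class E (V - K - R) w' = {}"
    and m: "m \<le> 2 * q + 3" "4 \<le> l'"
    and W: "sum_list ds + sum_list ls + m + l' + 4 \<le> card (common_nbrs E (V - K) K)"
  shows "packs E V (forest ds (ls @ [l', m]))"
proof -
  define Y where "Y w = conn_class E (V - K - R) w" for w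
  let ?W = "common_nbrs E (V - K) K"
  have finK: "finite K" and finR: "finite R" using K R V by (auto intro: finite_subset)
  have J_in: "w \<in> V - K - R" "w \<in> ?W" if "w \<in> J" for w using that J(1) by (auto simp: common_nbrs_def)
  have W_adj: "{w, c} \<in> E" "{c, w} \<in> E" if "w \<in> ?W" "c \<in> K" for w c
    using that by (auto simp: common_nbrs_def insert_commute)
  have Ysub: "Y w \<subseteq> V - K - R" if "w \<in> J" for w
    unfolding Y_def using J_in(1)[OF that] by (rule conn_class_subset)
  have Yfin: "finite (Y w)" if "w \<in> J" for w
    using Ysub[OF that] V by (meson finite_Diff finite_subset)
  have Yself: "w \<in> Y w" for w by (simp add: Y_def)
  have Ydisj: "Y w \<inter> Y w' = {}" if "w \<in> J" "w' \<in> J" "w \<noteq> w'" for w w'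
    using disj that by (simp add: Y_def)
  obtain w0 where "w0 \<in> J" using J(2) by fastforce
  then have R': "R' \<subseteq> R" using att by blast
  then have finR': "finite R'" using finR finite_subset by blast
  \<comment> \<open>Up to \<open>q\<close> hubs are used. If the classes attach to fewer than
    \<open>q\<close> hubs, the missing \<open>d\<close> is supplied by degrees inside the classes,
    as \<open>K\<close> and \<open>R'\<close> contain at most \<open>card K + card R'\<close> of the
    neighbours.\<close>
  define \<rho> d where "\<rho> = min (card R') q" and "d = q - \<rho>"
  have Ydeg: "d \<le> degree E (Y w) y" if w: "w \<in> J" and y: "y \<in> Y w" for w y
  proof -
    have yV: "y \<in> V - K - R" using Ysub[OF w] y by blast
    have "nbrs E V y \<subseteq> K \<union> R' \<union> nbrs E (Y w) y"
    proof
      fix v assume v: "v \<in> nbrs E V y"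
      then have ed: "{v, y} \<in> E" "{y, v} \<in> E" "v \<in> V" by (auto simp: nbrs_def insert_commute)
      consider "v \<in> K" | "v \<in> R" | "v \<in> V - K - R" using ed(3) by blast
      then show "v \<in> K \<union> R' \<union> nbrs E (Y w) y"
      proof cases
        case 2
        then have "v \<in> R'" using att[OF w] ed(1) y unfolding Y_def by blast
        then show ?thesis by blast
      next
        case 3
        then have "v \<in> Y w" using conn_class_step[OF _ yV 3 ed(2)] y unfolding Y_def by blast
        then show ?thesis using ed(1) by (simp add: nbrs_def)
      qed simp
    qed
    then have "degree E V y \<le> card (K \<union> R' \<union> nbrs E (Y w) y)"
      using finK finR' finite_nbrs[OF Yfin[OF w]] by (intro card_mono) auto
    also have "\<dots> \<le> card K + card R' + degree E (Y w) y"
      using card_Un_le[of "K \<union> R'" "nbrs E (Y w) y"] card_Un_le[of K R'] by linarith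
    finally show ?thesis using deg[of y] yV by (auto simp: d_def \<rho>_def)
  qed
  \<comment> \<open>There are \<open>\<rho> + 1\<close> classes for the path through the hubs, one
    for its continuation beyond \<open>c\<close>, and two for the ends of the path on
    \<open>l'\<close> vertices.\<close>
  obtain zs where zs: "distinct zs" "length zs = \<rho> + 4" "set zs \<subseteq> J"
  proof (rule obtain_distinct_list)
    show "finite J" using J(2) by (cases "finite J") auto
    show "\<rho> + 4 \<le> card J" using J(2) by (simp add: \<rho>_def)
  qed
  then obtain u v1 v2 ws where zs': "zs = u # v1 # v2 # ws" "length ws = Suc \<rho>"
    by (auto simp: length_Suc_conv numeral_eq_Suc add.commute)
  have inJ: "u \<in> J" "v1 \<in> J" "v2 \<in> J" "set ws \<subseteq> J" and dist: "distinct ws" "u \<noteq> v1" "u \<noteq> v2" "v1 \<noteq> v2"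
    "u \<notin> set ws" "v1 \<notin> set ws" "v2 \<notin> set ws"
    using zs(1,3) unfolding zs'(1) by auto
  obtain rs where rs: "distinct rs" "length rs = \<rho>" "set rs \<subseteq> R'"
    by (rule obtain_distinct_list[OF finR', of \<rho>]) (auto simp: \<rho>_def)
  let ?U = "(\<Union>w\<in>set ws. Y w) \<union> set rs"
  have ws_ne: "ws \<noteq> []" using zs'(2) by auto
  have hd_ws: "hd ws \<in> J" using ws_ne inJ(4) by auto
  have "\<exists>xs. is_path E ?U xs \<and> xs \<noteq> [] \<and> hd xs = hd ws \<and> 2 * length rs + Suc d \<le> length xs"
  proof (rule path_through_hubs[OF E])
    show "\<exists>xs. is_path E (Y w) xs \<and> xs \<noteq> [] \<and> hd xs = y \<and> last xs = z"
      if "w \<in> set ws" "y \<in> Y w" "z \<in> Y w" for w y z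
      using that path_between_conn_class[of w "V - K - R" y E z] J_in(1) inJ(4) unfolding Y_def by blast
    show "\<exists>z\<in>Y w. {r, z} \<in> E" if "w \<in> set ws" "r \<in> set rs" for w r
      using that att[of w] inJ(4) rs(3) unfolding Y_def by blast
    show "Y w \<inter> set rs = {}" if "w \<in> set ws" for w
      using that Ysub[of w] inJ(4) rs(3) R' by blast
    show "Y w \<inter> Y w' = {}" if "w \<in> set ws" "w' \<in> set ws" "w \<noteq> w'" for w w'
      using that Ydisj inJ(4) by blast
    show "hd ws \<in> Y (hd ws)" by (rule Yself)
  qed (use zs'(2) rs dist(1) Yfin Ydeg inJ(4) in auto)
  then obtain xs1 where xs1: "is_path E ?U xs1" "xs1 \<noteq> []" "hd xs1 = hd ws" "2 * \<rho> + Suc d \<le> length xs1"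
    using rs(2) by auto
  obtain xs2 where xs2: "is_path E (Y u) xs2" "xs2 \<noteq> []" "hd xs2 = u" "length xs2 = Suc d"
    using greedy_path[OF Yfin[OF inJ(1)] E Ydeg[OF inJ(1)] Yself] by blast
  have "K \<noteq> {}" using cK by auto
  then obtain c where c: "c \<in> K" by blast
  have Y_U: "Y v \<inter> ?U = {}" if v: "v \<in> J" "v \<notin> set ws" for v
  proof -
    have "Y v \<inter> Y w = {}" if "w \<in> set ws" for w
      using Ydisj[OF v(1)] that v(2) inJ(4) by blast
    moreover have "Y v \<inter> set rs = {}" using Ysub[OF v(1)] rs(3) R' by blast
    ultimately show ?thesis by blast
  qed
  have "Y w \<subseteq> V - K" if "w \<in> J" for w using Ysub[OF that] by blast
  moreover have "set rs \<subseteq> V - K" using rs(3) R' R by blast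
  ultimately have UV: "?U \<subseteq> V - K" "Y u \<subseteq> V - K" "?U \<inter> Y u = {}"
    using inJ Y_U[OF inJ(1) dist(5)] by blast+
  \<comment> \<open>The pieces have at least \<open>2 * \<rho> + Suc d\<close>, 1 and
    \<open>Suc d\<close> vertices, together \<open>2 * q + 3\<close>, hence at least
    \<open>m\<close>; only \<open>c\<close> lies in \<open>K\<close>.\<close>
  let ?P = "rev xs1 @ c # xs2"
  have "is_path E V ?P"
  proof -
    have "is_path E V xs1" "is_path E V xs2"
      using is_path_mono[OF xs1(1)] is_path_mono[OF xs2(1)] UV(1,2) by blast+
    moreover have "set xs1 \<subseteq> ?U" "set xs2 \<subseteq> Y u" using xs1(1) xs2(1) by (auto simp: is_path_def)
    then have "set xs1 \<inter> set xs2 = {}" "c \<notin> set xs1" "c \<notin> set xs2" using UV c by blast+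
    moreover have "{hd ws, c} \<in> E" "{c, u} \<in> E" using W_adj J_in(2) hd_ws inJ(1) c by auto
    ultimately show ?thesis
      using c K xs1(2,3) xs2(2,3) by (auto simp: is_path_append is_path_Cons last_rev)
  qed
  then have P1: "is_path E V (take m ?P)" by (rule is_path_take)
  have "\<rho> + d = q" by (simp add: d_def \<rho>_def)
  then have "m \<le> length ?P" using xs1(4) xs2(4) m(1) by simp
  then have lP1: "length (take m ?P) = m" by simp
  let ?P1 = "take m ?P"
  have sP1: "set ?P1 \<subseteq> ?U \<union> Y u \<union> {c}"
  proof -
    have "set ?P \<subseteq> ?U \<union> Y u \<union> {c}" using xs1(1) xs2(1) by (auto simp: is_path_def)
    then show ?thesis using set_take_subset[of m ?P] by blast
  qed
  obtain x1 where x1: "x1 \<in> Y v1" "x1 \<noteq> v1" "{v1, x1} \<in> E"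
    using conn_class_has_nbr[OF J_in(1) big, of v1] inJ(2) unfolding Y_def by metis
  obtain x2 where x2: "x2 \<in> Y v2" "x2 \<noteq> v2" "{v2, x2} \<in> E"
    using conn_class_has_nbr[OF J_in(1) big, of v2] inJ(3) unfolding Y_def by metis
  have Y12: "Y v1 \<inter> Y v2 = {}" "Y v1 \<inter> ?U = {}" "Y v2 \<inter> ?U = {}" "Y v1 \<inter> Y u = {}" "Y v2 \<inter> Y u = {}"
    using Ydisj[OF inJ(2,3) dist(4)] Y_U[OF inJ(2) dist(6)] Y_U[OF inJ(3) dist(7)]
      Ydisj[OF inJ(2,1)] Ydisj[OF inJ(3,1)] dist(2,3) by blast+
  have YK: "Y v1 \<subseteq> V - K" "Y v2 \<subseteq> V - K" using Ysub inJ by blast+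
  \<comment> \<open>The path on \<open>l'\<close> vertices will use \<open>Suc e\<close> core
    vertices, one below its cover number; with \<open>c\<close> this makes the
    \<open>l' div 2\<close> vertices that \<open>card K\<close> sets aside.\<close>
  obtain e where e: "l' div 2 = Suc (Suc e)"
  proof -
    have "2 \<le> l' div 2" using m(2) by simp
    then show ?thesis using that[of "l' div 2 - 2"] by simp
  qed
  have "card (K - {c}) = card K - 1" using c finK by simp
  then have "Suc e \<le> card (K - {c})" using cK e by simp
  then obtain cs where cs: "distinct cs" "length cs = Suc e" "set cs \<subseteq> K - {c}"
    using obtain_distinct_list[of "K - {c}" "Suc e"] finK by auto
  \<comment> \<open>Common neighbours of \<open>K\<close> may lie in classes already used, so those
    of the second path are chosen off the first path and off the four end vertices.\<close>
  let ?D = "set ?P1 \<union> {v1, x1, v2, x2}"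
  have "card ?D \<le> m + 4"
  proof -
    have "card ?D \<le> card (set ?P1) + card {v1, x1, v2, x2}" by (rule card_Un_le)
    moreover have "card (set ?P1) \<le> m" using card_length[of ?P1] lP1 by simp
    moreover have "card {v1, x1, v2, x2} \<le> 4" by (simp add: card_insert_if)
    ultimately show ?thesis by linarith
  qed
  then have "e \<le> card (?W - ?D)"
    using diff_card_le_card_Diff[of ?D ?W] W e by simp
  then obtain ss where ss: "distinct ss" "length ss = e" "set ss \<subseteq> ?W - ?D"
    using obtain_distinct_list[of "?W - ?D" e] finite_common_nbrs[of "V - K" E K] V by auto
  have WK: "?W \<subseteq> V - K" by (auto simp: common_nbrs_def)
  have mid: "is_path E V (splice cs ss)"
  proof (rule is_path_splice)
    show "{x, y} \<in> E" if "x \<in> set cs" "y \<in> set ss" for x y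
      using W_adj(2)[of y x] that cs(3) ss(3) by blast
    show "distinct (cs @ ss)" using cs ss WK by auto
  qed (use cs ss K WK in auto)
  have cs_ne: "cs \<noteq> []" using cs(2) by auto
  \<comment> \<open>Four vertices at the ends and \<open>2 * e + 1\<close> between them make
    \<open>2 * (l' div 2) + 1\<close>; a prefix of length \<open>l'\<close> then serves both
    parities.\<close>
  let ?Q = "x1 # v1 # splice cs ss @ [v2, x2]"
  have sQ: "set ?Q \<subseteq> Y v1 \<union> Y v2 \<union> (K - {c}) \<union> (?W - ?D)"
    using x1(1) x2(1) Yself[of v1] Yself[of v2] cs(3) ss(3) by (auto simp: set_splice)
  have "is_path E V ?Q"
  proof -
    have tl: "is_path E V [v2, x2]" using x2 YK Yself[of v2] by (auto simp: is_path_Cons)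
    have "last (splice cs ss) = last cs" using last_splice cs(2) ss(2) by metis
    then have l: "{last (splice cs ss), v2} \<in> E"
      using W_adj(2)[of v2 "last cs"] J_in(2)[OF inJ(3)] cs(3) last_in_set[OF cs_ne] by auto
    have h: "{v1, hd (splice cs ss)} \<in> E"
      using W_adj(1)[of v1 "hd cs"] J_in(2)[OF inJ(2)] cs(3) hd_in_set[OF cs_ne] hd_splice[OF cs_ne] by auto
    have set_mid: "set (splice cs ss) \<subseteq> K \<union> (?W - ?D)" using cs(3) ss(3) by (auto simp: set_splice)
    have out: "x1 \<notin> set (splice cs ss)" "v1 \<notin> set (splice cs ss)" "v2 \<notin> set (splice cs ss)" "x2 \<notin> set (splice cs ss)"
      using set_mid x1(1) x2(1) Yself[of v1] Yself[of v2] YK by blast+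
    have diff: "x1 \<noteq> v2" "x1 \<noteq> x2" "v1 \<noteq> v2" "v1 \<noteq> x2"
      using x1(1) x2(1) Yself[of v1] Yself[of v2] Y12(1) by blast+
    have "is_path E V (splice cs ss @ [v2, x2])"
      using mid tl l out by (auto simp: is_path_append)
    moreover have "hd (splice cs ss @ [v2, x2]) = hd (splice cs ss)" using cs_ne by simp
    ultimately show ?thesis
      using x1 h out diff YK Yself[of v1] by (auto simp: is_path_Cons insert_commute)
  qed
  then have P2: "is_path E V (take l' ?Q)" by (rule is_path_take)
  let ?P2 = "take l' ?Q"
  have lP2: "length ?P2 = l'" using cs(2) ss(2) e by simp
  have sP2: "set ?P2 \<subseteq> Y v1 \<union> Y v2 \<union> (K - {c}) \<union> (?W - ?D)"
    using sQ set_take_subset[of l' ?Q] by blast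
  obtain U where U: "U = ?U" by blast
  have "Y v1 \<inter> set ?P1 = {}" "Y v2 \<inter> set ?P1 = {}"
    using sP1 Y12 YK c unfolding U[symmetric] by blast+
  moreover have P1_K: "set ?P1 \<inter> K \<subseteq> {c}" using sP1 UV unfolding U[symmetric] by blast
  ultimately have disjP: "set ?P1 \<inter> set ?P2 = {}" using sP2 by blast
  have k1: "card (set ?P1 \<inter> K) \<le> 1" using card_mono[OF _ P1_K] by simp
  have "x1 \<notin> K" "v1 \<notin> K" "v2 \<notin> K" "x2 \<notin> K" "set ss \<inter> K = {}"
    using x1(1) x2(1) Yself[of v1] Yself[of v2] YK ss(3) WK by blast+
  then have "set ?Q \<inter> K \<subseteq> set cs" by (auto simp: set_splice)
  then have "set ?P2 \<inter> K \<subseteq> set cs" using set_take_subset[of l' ?Q] by blast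
  then have "card (set ?P2 \<inter> K) \<le> card (set cs)" by (intro card_mono) auto
  then have k2: "card (set ?P2 \<inter> K) \<le> Suc e" using cs(2) card_length[of cs] by linarith
  show ?thesis
    by (rule packs_two_saved_paths[OF V K subset_refl P1 lP1 P2 lP2 disjP]) (use k1 k2 cK e W in auto)
qed

lemma extend_to_full_core:
  assumes "2 \<le> m" "m \<le> l'" "ds \<noteq> []"
  obtains n0 where "\<And>(E :: 'a set set) V K. simple_edges E \<Longrightarrow> finite V \<Longrightarrow> n0 \<le> card V \<Longrightarrow>
    \<not> packs E V (forest ds (ls @ [l', m])) \<Longrightarrow>
    2 * (length ds + cover_sum (ls @ [l', m]) - 1) * card V \<le> 2 * esize E V + C \<Longrightarrow>
    K \<subseteq> V \<Longrightarrow> card K = length ds + cover_sum (ls @ [l']) \<Longrightarrow>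
    \<forall>xs. is_path E (V - K) xs \<longrightarrow> length xs \<noteq> m \<Longrightarrow>
    \<exists>K'\<subseteq>V. card K' = length ds + cover_sum (ls @ [l', m]) - 1 \<and>
      M \<le> card (common_nbrs E (V - K') K')"
proof -
  \<comment> \<open>\<open>q\<close> is the number of vertices that \<open>K\<close> still
    lacks.\<close>
  obtain q where q: "m div 2 = Suc q" using assms(1) by (cases "m div 2") auto
  obtain \<kappa> where \<kappa>: "length ds + cover_sum ls + l' div 2 = Suc \<kappa>"
    using assms(3) by (cases ds) auto
  have k: "length ds + cover_sum (ls @ [l', m]) - 1 = Suc (\<kappa> + q)" using q \<kappa> by simp
  \<comment> \<open>Enough for both outcomes: \<open>M\<close> common neighbours if the classes are
    single vertices, \<open>q + 4\<close> classes for the two paths otherwise. \<open>?N\<close>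
    exceeds \<open>?L\<close> times the number of signatures, which are a subset of at most
    \<open>m\<close> deleted vertices and a truth value.\<close>
  let ?L = "M + q + 4"
  let ?N = "2 ^ m * 2 * ?L + 1"
  obtain b where b: "\<And>(E :: 'a set set) Z W0. finite Z \<Longrightarrow> W0 \<subseteq> Z \<Longrightarrow> b \<le> card W0 \<Longrightarrow>
    \<forall>w\<in>W0. short_rooted E Z m w \<Longrightarrow> spread_classes E Z W0 m ?N"
    by (rule spread_over_components[of ?N m]) auto
  let ?w = "M + b + (sum_list ds + sum_list ls + m + l' + 4)"
  show ?thesis
  proof (rule that[of "C + Suc \<kappa> + 2 * ?w"], unfold k)
    fix E :: "'a set set" and V K
    assume E: "simple_edges E" and V: "finite V" and n: "C + Suc \<kappa> + 2 * ?w \<le> card V"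
      and free: "\<not> packs E V (forest ds (ls @ [l', m]))"
      and many: "2 * Suc (\<kappa> + q) * card V \<le> 2 * esize E V + C"
      and K: "K \<subseteq> V" and cK: "card K = length ds + cover_sum (ls @ [l'])"
      and no_path: "\<forall>xs. is_path E (V - K) xs \<longrightarrow> length xs \<noteq> m"
    have cK': "card K = Suc \<kappa>" using cK \<kappa> by simp
    obtain V0 where V0: "K \<subseteq> V0" "V0 \<subseteq> V" "\<And>v. v \<in> V0 - K \<Longrightarrow> Suc (\<kappa> + q) \<le> degree E V0 v"
      "2 * esize E V + (2 * Suc (\<kappa> + q) - 1) * card V0 \<le> 2 * esize E V0 + (2 * Suc (\<kappa> + q) - 1) * card V"
      by (rule min_degree_subset[OF V K E, of "Suc (\<kappa> + q)"]) auto
    have finV0: "finite V0" using V0(2) V finite_subset by blast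
    let ?H = "V0 - K"
    let ?W = "common_nbrs E ?H K"
    have no_path0: "length xs \<noteq> m" if "is_path E ?H xs" for xs
      using no_path is_path_mono[OF that, of "V - K"] V0(2) by blast
    have "card V + (2 * (\<kappa> + q) + 1) * card V0 \<le> 2 * esize E V0 + C"
    proof -
      have eq: "2 * Suc (\<kappa> + q) - 1 = 2 * (\<kappa> + q) + 1" by simp
      have "2 * Suc (\<kappa> + q) * card V = (2 * (\<kappa> + q) + 1) * card V + card V" by (simp add: algebra_simps)
      then show ?thesis using V0(4) many unfolding eq by linarith
    qed
    then have "card V \<le> C + Suc \<kappa> + 2 * card ?W"
      using q by (intro core_common_nbrs_large[OF E finV0 V0(1) cK' assms(1) _ no_path0]) auto
    then have "C + Suc \<kappa> + 2 * ?w \<le> C + Suc \<kappa> + 2 * card ?W" using n by (rule order_trans[rotated])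
    then have W: "?w \<le> card ?W" by simp
    show "\<exists>K'\<subseteq>V. card K' = Suc (\<kappa> + q) \<and> M \<le> card (common_nbrs E (V - K') K')"
    \<comment> \<open>For \<open>m\<close> equal to 2 or 3 the core is already complete; otherwise
      \<open>m\<close>, and with it \<open>l'\<close>, is at least 4.\<close>
    proof (cases "q = 0")
      case True
      have "?W \<subseteq> common_nbrs E (V - K) K" using V0(2) by (intro common_nbrs_mono) auto
      then have "card ?W \<le> card (common_nbrs E (V - K) K)"
        using V by (intro card_mono finite_common_nbrs) auto
      then show ?thesis using W K cK' True by (intro exI[of _ K]) auto
    next
      case False
      have "short_rooted E ?H m w" for w
      proof -
        have "length xs \<le> m" if "is_path E ?H xs" for xs
        proof (rule ccontr)
          assume "\<not> length xs \<le> m"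
          then have "length (take m xs) = m" by simp
          then show False using no_path0[OF is_path_take[OF that]] by blast
        qed
        then show ?thesis unfolding short_rooted_def by (intro bexI[of _ w]) auto
      qed
      then have "spread_classes E ?H ?W m ?N"
        using W finV0 by (intro b) (auto simp: common_nbrs_def)
      then obtain R I where R: "R \<subseteq> ?H" "card R \<le> m" and I: "I \<subseteq> ?W - R" "card I = ?N" "finite I"
        and disj: "\<And>w w'. w \<in> I \<Longrightarrow> w' \<in> I \<Longrightarrow> w \<noteq> w' \<Longrightarrow>
          conn_class E (?H - R) w \<inter> conn_class E (?H - R) w' = {}"
        unfolding spread_classes_def by blast
      \<comment> \<open>The signature of a class: the deleted vertices to which it is attached, and
        whether it is a single vertex.\<close>
      let ?f = "\<lambda>w. ({r \<in> R. \<exists>y\<in>conn_class E (?H - R) w. {r, y} \<in> E}, conn_class E (?H - R) w = {w})"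
      have finR: "finite R" using R(1) finV0 by (meson finite_Diff finite_subset)
      have "?f ` I \<subseteq> Pow R \<times> UNIV" by auto
      then have "card (?f ` I) \<le> card (Pow R \<times> (UNIV :: bool set))"
        using finR by (intro card_mono) auto
      also have "\<dots> \<le> 2 ^ m * 2"
        using R(2) finR by (simp add: card_cartesian_product card_Pow)
      finally have "card (?f ` I) * ?L \<le> 2 ^ m * 2 * ?L" by (rule mult_le_mono1)
      then have few: "card (?f ` I) * ?L < card I" using I(2) by linarith
      obtain y where y: "?L < card {w \<in> I. ?f w = y}"
        by (rule fiber_pigeonhole[OF I(3) few])
      obtain R' s where "y = (R', s)" by (cases y)
      then obtain J where J: "J = {w \<in> I. ?f w = (R', s)}" "?L < card J" using y by blast
      have JI: "J \<subseteq> I" using J(1) by blast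
      have J_W: "J \<subseteq> ?W - R" using JI I(1) by blast
      have J_f: "{r \<in> R. \<exists>y\<in>conn_class E (?H - R) w. {r, y} \<in> E} = R'"
        "conn_class E (?H - R) w = {w} \<longleftrightarrow> s" if "w \<in> J" for w
        using that unfolding J(1) by simp_all
      show ?thesis
      proof (cases s)
        case True
        have "J \<noteq> {}" using J(2) by auto
        moreover have "{r \<in> R. {r, w} \<in> E} = R'" if "w \<in> J" for w
          using J_f[OF that] True by simp
        moreover have "Suc (\<kappa> + q) \<le> degree E V0 w" if "w \<in> J" for w
          using that J_W by (intro V0(3)) (auto simp: common_nbrs_def)
        ultimately obtain K' where K': "K' \<subseteq> V0" "card K' = Suc (\<kappa> + q)" "J \<subseteq> common_nbrs E (V0 - K') K'"
          using core_from_singleton_classes[OF E finV0 V0(1) cK' R(1) J_W, of q R'] J_f(2) True by auto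
        have "J \<subseteq> common_nbrs E (V - K') K'"
          using K'(3) common_nbrs_mono[of "V0 - K'" "V - K'" E K'] V0(2) by blast
        then have "card J \<le> card (common_nbrs E (V - K') K')"
          using V by (intro card_mono finite_common_nbrs) auto
        then show ?thesis using J(2) K' V0(2) by (intro exI[of _ K']) auto
      next
        case False
        have "packs E V0 (forest ds (ls @ [l', m]))"
        proof (rule packs_from_large_classes[OF E finV0 V0(1) _ assms(3) R(1) J_W])
          show "q + 4 \<le> card J" using J(2) by simp
          show "card K + q \<le> degree E V0 v" if "v \<in> V0 - K" for v
            using V0(3)[OF that] cK' by simp
          show "m \<le> 2 * q + 3" "4 \<le> l'" using q \<open>q \<noteq> 0\<close> assms(2) by auto
          show "conn_class E (?H - R) w \<inter> conn_class E (?H - R) w' = {}"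
            if "w \<in> J" "w' \<in> J" "w \<noteq> w'" for w w'
            using disj that JI by blast
        qed (use cK' \<kappa> J_f False W in auto)
        then show ?thesis using free packs_mono V0(2) by blast
      qed
    qed
  qed
qed

section \<open>Graphs with a dominating core\<close>

text \<open>The edge set of a complete graph on \<open>K\<close> joined to an edgeless graph on
  \<open>V - K\<close>, written on an arbitrary vertex set.\<close>

definition core_edges :: "'a set \<Rightarrow> 'a set \<Rightarrow> 'a set set" where
  "core_edges V K = {{c, v} | c v. c \<in> K \<and> v \<in> V \<and> c \<noteq> v}"

lemma core_edges_iff: "K \<subseteq> V \<Longrightarrow> {u, v} \<in> core_edges V K \<longleftrightarrow> u \<in> V \<and> v \<in> V \<and> u \<noteq> v \<and> (u \<in> K \<or> v \<in> K)"
  by (auto simp: core_edges_def doubleton_eq_iff)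

lemma simple_core_edges: "simple_edges (core_edges V K)"
  by (auto simp: simple_edges_def core_edges_def)

lemma core_edges_subset: "K \<subseteq> V \<Longrightarrow> e \<in> core_edges V K \<Longrightarrow> e \<subseteq> V"
  by (auto simp: core_edges_def)

lemma core_edges_meet: "e \<in> core_edges V K \<Longrightarrow> e \<inter> K \<noteq> {}"
  by (auto simp: core_edges_def)

text \<open>Edges inside \<open>K\<close> are ignored, which is a bounded loss.\<close>

lemma core_edges_card_ge:
  assumes "finite V" "K \<subseteq> V"
  shows "card K * (card V - card K) \<le> card (core_edges V K)"
proof -
  have finK: "finite K" using assms finite_subset by blast
  have "inj_on (\<lambda>(c, v). {c, v}) (K \<times> (V - K))"
    by (auto simp: inj_on_def doubleton_eq_iff)
  then have "card ((\<lambda>(c, v). {c, v}) ` (K \<times> (V - K))) = card K * (card V - card K)"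
    using finK assms(2) by (simp add: card_image card_cartesian_product card_Diff_subset)
  moreover have "(\<lambda>(c, v). {c, v}) ` (K \<times> (V - K)) \<subseteq> core_edges V K"
    by (auto simp: core_edges_def)
  moreover have "core_edges V K \<subseteq> Pow V" using core_edges_subset[OF assms(2)] by blast
  then have "finite (core_edges V K)" using assms(1) by (meson finite_Pow_iff finite_subset)
  ultimately show ?thesis using card_mono[of "core_edges V K"] by metis
qed

text \<open>If every edge of the path meets \<open>K\<close>, then no two consecutive vertices avoid
  \<open>K\<close>, whence \<open>2 * card (set xs \<inter> K) + 1\<close>; each edge outside
  \<open>K\<close> lengthens the path by at most one.\<close>

lemma path_length_le_cover:
  assumes "simple_edges E" "distinct xs" "walk E xs"
  shows "length xs \<le> 2 * card (set xs \<inter> K) + 1 + esize E (set xs - K)"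
  using assms(2,3)
proof (induction xs rule: induct_list012)
  case (3 x y zs)
  have IH: "length (y # zs) \<le> 2 * card (set (y # zs) \<inter> K) + 1 + esize E (set (y # zs) - K)"
    "length zs \<le> 2 * card (set zs \<inter> K) + 1 + esize E (set zs - K)"
    using 3 by (auto simp: successively_Cons)
  show ?case
  proof (cases "x \<in> K")
    case True
    then have "set (x # y # zs) \<inter> K = insert x (set (y # zs) \<inter> K)" "set (x # y # zs) - K = set (y # zs) - K"
      by auto
    moreover have "x \<notin> set (y # zs) \<inter> K" using 3 by auto
    ultimately have "card (set (x # y # zs) \<inter> K) = Suc (card (set (y # zs) \<inter> K))"
      by (metis List.finite_set card_insert_disjoint finite_Int)
    then show ?thesis using IH(1) \<open>set (x # y # zs) - K = _\<close> by simp
  next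
    case x: False
    show ?thesis
    proof (cases "y \<in> K")
      case True
      have "set (x # y # zs) \<inter> K = insert y (set zs \<inter> K)" using True x by auto
      moreover have "y \<notin> set zs \<inter> K" using 3 by auto
      ultimately have "card (set (x # y # zs) \<inter> K) = Suc (card (set zs \<inter> K))"
        by (metis List.finite_set card_insert_disjoint finite_Int)
      moreover have "esize E (set zs - K) \<le> esize E (set (x # y # zs) - K)"
        by (rule esize_mono) auto
      ultimately show ?thesis using IH(2) by simp
    next
      case False
      have "set (x # y # zs) \<inter> K = set (y # zs) \<inter> K" using x by auto
      moreover have "set (x # y # zs) - K = insert x (set (y # zs) - K)" using x by auto
      moreover have "x \<notin> set (y # zs) - K" using 3 by auto
      moreover have "y \<in> nbrs E (set (y # zs) - K) x"
        using 3 False by (auto simp: nbrs_def insert_commute)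
      then have "1 \<le> degree E (set (y # zs) - K) x"
        using finite_nbrs[of "set (y # zs) - K" E x] by (simp add: Suc_le_eq card_gt_0_iff) blast
      ultimately show ?thesis
        using IH(1) esize_insert[OF assms(1), of "set (y # zs) - K" x] by simp
    qed
  qed
qed simp_all

lemma packs_paths_cover:
  assumes "packs E V (map path_graph ls)"
    and "\<And>l X. l \<in> set ls \<Longrightarrow> X \<subseteq> V \<Longrightarrow> copy_on E (path_graph l) X \<Longrightarrow> l div 2 \<le> card (X \<inter> K)"
    and "finite K"
  shows "cover_sum ls \<le> card (V \<inter> K)"
  using assms(1,2)
proof (induction ls arbitrary: V)
  case (Cons l ls)
  then obtain X where X: "X \<subseteq> V" "copy_on E (path_graph l) X" "packs E (V - X) (map path_graph ls)" by auto
  have "cover_sum ls \<le> card ((V - X) \<inter> K)"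
  proof (rule Cons.IH[OF X(3)])
    show "l' div 2 \<le> card (X' \<inter> K)" if "l' \<in> set ls" "X' \<subseteq> V - X" "copy_on E (path_graph l') X'" for l' X'
      using Cons.prems(2)[of l' X'] that by auto
  qed
  moreover have "l div 2 \<le> card (X \<inter> K)" using Cons.prems(2) X by auto
  moreover have "card (V \<inter> K) = card (X \<inter> K) + card ((V - X) \<inter> K)"
    using X(1) assms(3) by (subst card_Un_disjoint[symmetric]) (auto intro: arg_cong[of _ _ card])
  ultimately show ?case by simp
qed simp

text \<open>Disjoint copies meet \<open>K\<close> in disjoint sets, so their individual demands add
  up. A set \<open>K\<close> below the cover number therefore admits no packing.\<close>

lemma packs_forest_cover:
  assumes "packs E V (forest ds ls)"
    and "\<And>d X. d \<in> set ds \<Longrightarrow> X \<subseteq> V \<Longrightarrow> copy_on E (star_graph d) X \<Longrightarrow> 1 \<le> card (X \<inter> K)"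
    and "\<And>l X. l \<in> set ls \<Longrightarrow> X \<subseteq> V \<Longrightarrow> copy_on E (path_graph l) X \<Longrightarrow> l div 2 \<le> card (X \<inter> K)"
    and "finite K"
  shows "length ds + cover_sum ls \<le> card (V \<inter> K)"
  using assms(1-3)
proof (induction ds arbitrary: V)
  case Nil
  then show ?case using packs_paths_cover[OF _ _ assms(4)] by simp
next
  case (Cons d ds)
  then obtain X where X: "X \<subseteq> V" "copy_on E (star_graph d) X"
    "packs E (V - X) (forest ds ls)" by auto
  have "length ds + cover_sum ls \<le> card ((V - X) \<inter> K)"
  proof (rule Cons.IH[OF X(3)])
    show "1 \<le> card (X' \<inter> K)" if "d' \<in> set ds" "X' \<subseteq> V - X" "copy_on E (star_graph d') X'" for d' X'
      using Cons.prems(2)[of d' X'] that by auto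
    show "l div 2 \<le> card (X' \<inter> K)" if "l \<in> set ls" "X' \<subseteq> V - X" "copy_on E (path_graph l) X'" for l X'
      using Cons.prems(3)[of l X'] that by auto
  qed
  moreover have "1 \<le> card (X \<inter> K)" using Cons.prems(2) X by auto
  moreover have "card (V \<inter> K) = card (X \<inter> K) + card ((V - X) \<inter> K)"
    using X(1) assms(4) by (subst card_Un_disjoint[symmetric]) (auto intro: arg_cong[of _ _ card])
  ultimately show ?case by simp
qed

text \<open>These are the graphs listed in the theorem. A matching has no vertex of degree 2, so
  every star and every path on three vertices meets \<open>K\<close>; and a single outer edge
  lengthens a path by at most one, which does not help an odd path.\<close>

lemma core_matching_free:
  assumes V: "finite V" and K: "K \<subseteq> V" and cK: "card K < length ds + cover_sum ls"
    and ds: "\<forall>d\<in>set ds. 3 \<le> d"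
    and M: "matching_on (V - K) M"
    and ls: "M = {} \<or> (card M \<le> 1 \<and> (\<forall>l\<in>set ls. odd l)) \<or> (\<forall>l\<in>set ls. l = 3)"
  shows "\<not> packs (core_edges V K \<union> M) V (forest ds ls)"
proof
  let ?E = "core_edges V K \<union> M"
  assume "packs ?E V (forest ds ls)"
  have finK: "finite K" using V K finite_subset by blast
  have finM: "finite M" using M V by (intro finite_subset[of M "Pow V"]) (auto simp: matching_on_def)
  have E: "simple_edges ?E"
    using M simple_core_edges[of V K] by (auto simp: simple_edges_def matching_on_def)
  have out: "e \<in> M" if "e \<in> ?E" "e \<inter> K = {}" for e
    using that core_edges_meet[of e V K] by auto
  have no_P3: "y = z" if "{x, y} \<in> ?E" "{x, z} \<in> ?E" "x \<notin> K" "y \<notin> K" "z \<notin> K" for x y z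
  proof -
    have "{x, y} \<in> M" "{x, z} \<in> M" using that out[of "{x, y}"] out[of "{x, z}"] by auto
    moreover have "disjoint M" using M by (simp add: matching_on_def)
    ultimately have "{x, y} \<noteq> {x, z} \<Longrightarrow> {x, y} \<inter> {x, z} = {}" using disjointD by metis
    then have "{x, y} = {x, z}" by blast
    then show ?thesis by (auto simp: doubleton_eq_iff)
  qed
  have "length ds + cover_sum ls \<le> card (V \<inter> K)"
  proof (rule packs_forest_cover[OF \<open>packs ?E V _\<close> _ _ finK])
    fix d X assume d: "d \<in> set ds" and "copy_on ?E (star_graph d) X"
    then obtain c L where cL: "X = insert c L" "c \<notin> L" "finite L" "card L = d" "\<forall>x\<in>L. {c, x} \<in> ?E"
      unfolding copy_on_star_graph by blast
    have "X \<inter> K \<noteq> {}"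
    proof
      assume XK: "X \<inter> K = {}"
      have "L \<subseteq> {x}" if "x \<in> L" for x
        using no_P3[of c x] that cL(1,5) XK by blast
      then have "L = {} \<or> (\<exists>x. L = {x})" by blast
      then have "card L \<le> 1" by auto
      then show False using d ds cL(4) by fastforce
    qed
    then show "1 \<le> card (X \<inter> K)" using finK by (simp add: Suc_le_eq card_gt_0_iff)
  next
    fix l X assume l: "l \<in> set ls" and "copy_on ?E (path_graph l) X"
    then obtain xs where xs: "length xs = l" "distinct xs" "set xs = X" "successively (\<lambda>u v. {u, v} \<in> ?E) xs"
      unfolding copy_on_path_graph by blast
    have bound: "l \<le> 2 * card (X \<inter> K) + 1 + esize ?E (X - K)"
      using path_length_le_cover[OF E xs(2,4), of K] xs(1,3) by simp
    have "{e \<in> ?E. e \<subseteq> X - K} \<subseteq> M" using out by blast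
    then have es: "esize ?E (X - K) \<le> card M" unfolding esize_def using finM by (rule card_mono[rotated])
    from ls consider "M = {}" | "card M \<le> 1" "odd l" | "l = 3" using l by blast
    then show "l div 2 \<le> card (X \<inter> K)"
    proof cases
      case 1
      then show ?thesis using bound es by simp
    next
      case 2
      \<comment> \<open>With \<open>l = 2 * p + 1\<close> and x vertices in \<open>K\<close> the
        bound reads \<open>2 * p + 1 \<le> 2 * x + 2\<close>, and parity gives
        \<open>p \<le> x\<close>.\<close>
      then show ?thesis using bound es by (auto elim!: oddE)
    next
      case 3
      then obtain x y z where xyz: "xs = [x, y, z]" using xs(1) by (auto simp: length_Suc_conv numeral_eq_Suc)
      have "X \<inter> K \<noteq> {}"
      proof
        assume "X \<inter> K = {}"
        moreover have "{y, x} \<in> ?E" "{y, z} \<in> ?E" "x \<noteq> z" "X = {x, y, z}"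
          using xs(2-4) unfolding xyz by (auto simp: insert_commute)
        ultimately show False using no_P3[of y x z] by blast
      qed
      then have "1 \<le> card (X \<inter> K)" using finK by (simp add: Suc_le_eq card_gt_0_iff)
      then show ?thesis using 3 by simp
    qed
  qed
  moreover have "V \<inter> K = K" using K by blast
  ultimately show False using cK by simp
qed

lemma packs_transfer:
  assumes "packs E D As" "\<forall>A\<in>set As. simple_graph A" "inj_on h D"
    and "\<And>u v. u \<in> D \<Longrightarrow> v \<in> D \<Longrightarrow> {u, v} \<in> E \<Longrightarrow> {h u, h v} \<in> E'"
  shows "packs E' (h ` D) As"
  using assms
proof (induction As arbitrary: D)
  case (Cons A As)
  then obtain X where X: "X \<subseteq> D" "copy_on E A X" "packs E (D - X) As" by auto
  have "copy_on E' A (h ` X)"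
  proof (rule copy_on_transfer[OF X(2)])
    show "inj_on h X" using Cons.prems(3) X(1) by (rule inj_on_subset)
    show "{h u, h v} \<in> E'" if "u \<in> X" "v \<in> X" "{u, v} \<in> E" for u v
      using Cons.prems(4)[of u v] that X(1) by blast
  qed (use Cons.prems(2) in simp)
  moreover have "packs E' (h ` (D - X)) As"
  proof (rule Cons.IH[OF X(3)])
    show "inj_on h (D - X)" using Cons.prems(3) by (rule inj_on_subset) blast
    show "{h u, h v} \<in> E'" if "u \<in> D - X" "v \<in> D - X" "{u, v} \<in> E" for u v
      using Cons.prems(4)[of u v] that by blast
  qed (use Cons.prems(2) in simp)
  moreover have "h ` (D - X) = h ` D - h ` X" using Cons.prems(3) X(1) by (intro inj_on_image_set_diff) auto
  ultimately show ?case using X(1) by (auto intro!: exI[of _ "h ` X"])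
qed simp

text \<open>The vertices of Y are rewired to be adjacent to K only; a copy using them is moved to unused
  common neighbours of K.\<close>

lemma packs_untwin:
  assumes "packs E' V As" "\<forall>A\<in>set As. simple_graph A"
    and "finite V" "K \<subseteq> V" "Y \<subseteq> V - K"
    and E': "E' = {e \<in> E. e \<inter> Y = {}} \<union> {{y, c} | y c. y \<in> Y \<and> c \<in> K}"
    and "(\<Sum>A\<leftarrow>As. card (verts A)) \<le> card (common_nbrs E (V - K) K - Y)"
  shows "packs E V As"
proof -
  let ?W = "common_nbrs E (V - K) K - Y"
  have "\<And>A. A \<in> set As \<Longrightarrow> finite (verts A)" using assms(2) by (auto simp: simple_graph_def)
  then obtain D where D: "D \<subseteq> V" "finite D" "card D = (\<Sum>A\<leftarrow>As. card (verts A))" "packs E' D As"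
    using packs_support[OF assms(1)] by metis
  have finW: "finite ?W" using assms(3) by (simp add: finite_common_nbrs)
  have "card D = card (D \<inter> Y) + card (D - Y)"
    using D(2) by (metis card_Int_Diff)
  moreover have "card ?W - card (D - Y) \<le> card (?W - (D - Y))"
    using D(2) by (intro diff_card_le_card_Diff) auto
  ultimately have "card (D \<inter> Y) \<le> card (?W - (D - Y))" using assms(7) D(3) by linarith
  then obtain g where g: "inj_on g (D \<inter> Y)" "g ` (D \<inter> Y) \<subseteq> ?W - (D - Y)"
    using card_le_inj[of "D \<inter> Y" "?W - (D - Y)"] D(2) finW by auto
  define h where "h v = (if v \<in> Y then g v else v)" for v
  have inj: "inj_on h D"
  proof (rule inj_onI)
    fix u v assume uv: "u \<in> D" "v \<in> D" "h u = h v"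
    show "u = v"
    proof (cases "u \<in> Y")
      case True
      then have "h u \<in> ?W - (D - Y)" using uv(1) g(2) by (auto simp: h_def)
      then show ?thesis using uv True g(1) by (cases "v \<in> Y") (auto simp: h_def inj_on_def)
    next
      case False
      moreover have "v \<notin> Y"
      proof
        assume "v \<in> Y"
        then have "h v \<in> ?W - (D - Y)" using uv(2) g(2) by (auto simp: h_def)
        then show False using uv(1,3) False by (auto simp: h_def)
      qed
      ultimately show ?thesis using uv(3) by (simp add: h_def)
    qed
  qed
  have twin: "{h y, h c} \<in> E" "{h c, h y} \<in> E" if "y \<in> D" "y \<in> Y" "c \<in> K" for y c
  proof -
    have "g y \<in> ?W" using g(2) that(1,2) by blast
    then have "{g y, c} \<in> E" using that(3) by (auto simp: common_nbrs_def)
    moreover have "c \<notin> Y" using that(3) assms(5) by blast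
    ultimately show "{h y, h c} \<in> E" "{h c, h y} \<in> E" using that(2) by (simp_all add: h_def insert_commute)
  qed
  have "packs E (h ` D) As"
  proof (rule packs_transfer[OF D(4) assms(2) inj])
    fix u v assume uv: "u \<in> D" "v \<in> D" "{u, v} \<in> E'"
    then consider "{u, v} \<in> E" "u \<notin> Y" "v \<notin> Y" | "u \<in> Y" "v \<in> K" | "v \<in> Y" "u \<in> K"
      unfolding E' by (auto simp: doubleton_eq_iff)
    then show "{h u, h v} \<in> E"
      using twin uv by cases (auto simp: h_def)
  qed
  moreover have "h ` D \<subseteq> V"
    using D(1) g(2) by (auto simp: h_def common_nbrs_def)
  ultimately show ?thesis using packs_mono by blast
qed

text \<open>All vertices of \<open>K\<close> are alike, so any bijection onto the complete part
  works; only \<open>g\<close>, on the outer vertices, has to carry \<open>M\<close> along.\<close>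

lemma graph_iso_core:
  assumes "finite (verts G)" "K \<subseteq> verts G" "card K = k" "edges G = core_edges (verts G) K \<union> M"
    and "\<forall>e\<in>M. e \<subseteq> verts G - K" "bij_betw g (verts G - K) B"
    and "verts H = {..<k} <+> B"
    and "edges H = core_edges (verts H) (Inl ` {..<k}) \<union> (\<lambda>e. (Inr \<circ> g) ` e) ` M"
  shows "G \<simeq>\<^sub>g H"
proof -
  let ?V = "verts G"
  have "finite K" using assms(1,2) finite_subset by blast
  then obtain f where f: "bij_betw f K {..<k}"
    using ex_bij_betw_finite_nat assms(3) by (metis atLeast0LessThan)
  define \<phi> where "\<phi> v = (if v \<in> K then Inl (f v) else Inr (g v))" for v
  have K': "bij_betw \<phi> K (Inl ` {..<k})"
    using f by (auto simp: bij_betw_def inj_on_def \<phi>_def)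
  have B': "bij_betw \<phi> (?V - K) (Inr ` B)"
    using assms(6) by (auto simp: bij_betw_def inj_on_def \<phi>_def)
  have "?V = K \<union> (?V - K)" using assms(2) by auto
  then have bij: "bij_betw \<phi> ?V (verts H)"
    using bij_betw_combine[OF K' B'] unfolding assms(7) Plus_def by auto
  have inK: "\<phi> v \<in> Inl ` {..<k} \<longleftrightarrow> v \<in> K" if "v \<in> ?V" for v
    using that f by (auto simp: \<phi>_def bij_betw_def)
  have "Inl ` {..<k} \<subseteq> verts H" by (auto simp: assms(7))
  note core_H = core_edges_iff[OF this]
  have inV: "\<phi> v \<in> verts H" if "v \<in> ?V" for v using bij that by (auto simp: bij_betw_def)
  have inj: "inj_on \<phi> ?V" using bij by (simp add: bij_betw_def)
  have img: "(\<lambda>e. (Inr \<circ> g) ` e) ` M = (\<lambda>e. \<phi> ` e) ` M"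
  proof (rule image_cong[OF refl])
    fix e assume "e \<in> M"
    then show "(Inr \<circ> g) ` e = \<phi> ` e" using assms(5) by (intro image_cong) (auto simp: \<phi>_def)
  qed
  have "{u, v} \<in> edges G \<longleftrightarrow> {\<phi> u, \<phi> v} \<in> edges H" if uv: "u \<in> ?V" "v \<in> ?V" for u v
  proof -
    have "{\<phi> u, \<phi> v} \<in> core_edges (verts H) (Inl ` {..<k}) \<longleftrightarrow> {u, v} \<in> core_edges ?V K"
      unfolding core_H core_edges_iff[OF assms(2)] using uv inV inK inj by (auto simp: inj_on_def)
    moreover have "{\<phi> u, \<phi> v} \<in> (\<lambda>e. \<phi> ` e) ` M \<longleftrightarrow> {u, v} \<in> M"
    proof
      assume "{\<phi> u, \<phi> v} \<in> (\<lambda>e. \<phi> ` e) ` M"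
      then obtain e where e: "e \<in> M" "\<phi> ` {u, v} = \<phi> ` e" by auto
      have "{u, v} = e" using inj_on_image_eq_iff[OF inj, of "{u, v}" e] e uv assms(5) by auto
      then show "{u, v} \<in> M" using e by simp
    next
      assume "{u, v} \<in> M"
      then have "\<phi> ` {u, v} \<in> (\<lambda>e. \<phi> ` e) ` M" by blast
      then show "{\<phi> u, \<phi> v} \<in> (\<lambda>e. \<phi> ` e) ` M" by simp
    qed
    ultimately show ?thesis unfolding assms(4,8) img by blast
  qed
  then show ?thesis unfolding graph_iso_def using bij by blast
qed

text \<open>Brings the joins of the theorem into the form that \<open>graph_iso_core\<close>
  expects, core edges plus outer edges.\<close>

lemma edges_join_complete:
  "edges (graph_join (complete_graph k) B) =
    core_edges (verts (graph_join (complete_graph k) B)) (Inl ` {..<k}) \<union> (\<lambda>e. Inr ` e) ` edges B"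
  (is "?L = ?R")
proof
  show "?L \<subseteq> ?R"
  proof
    fix e assume "e \<in> ?L"
    then consider u v where "e = {Inl u, Inl v}" "u < k" "v < k" "u \<noteq> v"
      | "e \<in> (\<lambda>e. Inr ` e) ` edges B" | u v where "e = {Inl u, Inr v}" "u < k" "v \<in> verts B"
      by (auto simp: graph_join_def graph_union_def complete_graph_def)
    then show "e \<in> ?R"
      by cases (auto simp: core_edges_def graph_join_def graph_union_def complete_graph_def)
  qed
  show "?R \<subseteq> ?L"
  proof
    fix e assume "e \<in> ?R"
    then consider u v where "e = {Inl u, Inl v}" "u < k" "v < k" "u \<noteq> v"
      | "e \<in> (\<lambda>e. Inr ` e) ` edges B" | u v where "e = {Inl u, Inr v}" "u < k" "v \<in> verts B"
      by (auto simp: core_edges_def graph_join_def graph_union_def complete_graph_def)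
    then show "e \<in> ?L"
    proof cases
      case 1
      then have "e = Inl ` {u, v}" "{u, v} \<in> edges (complete_graph k)" by (auto simp: complete_graph_def)
      then have "e \<in> (\<lambda>e. Inl ` e) ` edges (complete_graph k)" by blast
      then show ?thesis by (simp add: graph_join_def graph_union_def)
    next
      case 2
      then show ?thesis by (auto simp: graph_join_def graph_union_def)
    next
      case 3
      then show ?thesis by (auto simp: graph_join_def complete_graph_def)
    qed
  qed
qed

lemma verts_join_complete: "verts (graph_join (complete_graph k) B) = {..<k} <+> verts B"
  by (simp add: graph_join_def graph_union_def complete_graph_def)

lemma complement_complete_graph:
  "verts (graph_complement (complete_graph m)) = {..<m}" "edges (graph_complement (complete_graph m)) = {}"
  by (auto simp: graph_complement_def complete_graph_def)

lemma edges_complete_2: "edges (complete_graph 2) = {{0, 1}}"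
proof -
  have "x = 0 \<or> x = 1" if "x < 2" for x :: nat using that by auto
  then show ?thesis by (force simp: complete_graph_def insert_commute)
qed

section \<open>Extremal graphs containing a core\<close>

text \<open>The situation once the core is full: \<open>card K\<close> is one below the cover number
  of the forest. Competitors on the same vertex set suffice for extremality. The bound
  \<open>many\<close> is twice the order of the forest plus 4, which leaves room for a copy that
  avoids a given path and for choices that avoid four given vertices.\<close>

locale extremal_forest_core =
  fixes E :: "'a set set" and V K :: "'a set" and ds ls :: "nat list"
  assumes simple: "simple_edges E" and finV: "finite V" and edges_in: "e \<in> E \<Longrightarrow> e \<subseteq> V"
    and free: "\<not> packs E V (forest ds ls)"
    and extremal: "simple_edges E' \<Longrightarrow> \<forall>e\<in>E'. e \<subseteq> V \<Longrightarrow>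
      \<not> packs E' V (forest ds ls) \<Longrightarrow> card E' \<le> card E"
    and K: "K \<subseteq> V" and card_K: "Suc (card K) = length ds + cover_sum ls"
    and ds: "ds \<noteq> []" "\<forall>d\<in>set ds. 3 \<le> d"
    and ls: "2 \<le> length ls" "\<forall>l\<in>set ls. 2 \<le> l"
    and many: "2 * (sum_list ds + length ds + sum_list ls) + 4 \<le> card (common_nbrs E (V - K) K)"
begin

abbreviation "W \<equiv> common_nbrs E (V - K) K"

lemma finK: "finite K"
  using K finV finite_subset by blast

lemma finE: "finite E"
  using edges_in finV by (intro finite_subset[of E "Pow V"]) auto

lemma card_E: "card E = esize E V"
  using edges_in unfolding esize_def by (intro arg_cong[of _ _ card]) auto

lemma many': "2 * sum_list ds + 2 * length ds + 2 * sum_list ls + 4 \<le> card W"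
  using many by (simp add: algebra_simps)

lemma W_sub: "W \<subseteq> V - K"
  by (auto simp: common_nbrs_def)

lemma finW: "finite W"
  using finV by (simp add: finite_common_nbrs)

lemma W_adj: "w \<in> W \<Longrightarrow> c \<in> K \<Longrightarrow> {c, w} \<in> E"
  by (auto simp: common_nbrs_def insert_commute)

section \<open>Paths that save a core vertex\<close>

lemma path_order_le: "l \<in> set ls \<Longrightarrow> l \<le> sum_list ls"
  by (rule member_le_sum_list) simp_all

text \<open>Besides this path there are another path and a star, each of cover number at least 1,
  and \<open>card K\<close> is one less than the total.\<close>

lemma path_cover_lt:
  assumes "l \<in> set ls"
  shows "l div 2 + 1 \<le> card K"
proof -
  obtain ls1 ls2 where ls12: "ls = ls1 @ l # ls2" using assms by (meson split_list)
  have "1 \<le> cover_sum (ls1 @ ls2)" using ls unfolding ls12 by (intro cover_sum_pos) auto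
  moreover have "1 \<le> length ds" using ds(1) by (cases ds) auto
  ultimately show ?thesis using card_K unfolding ls12 by simp
qed

lemma K_ge_2: "2 \<le> card K"
proof -
  obtain l where "l \<in> set ls" using ls(1) by (cases ls) auto
  then show ?thesis using path_cover_lt[of l] ls(2) by fastforce
qed

text \<open>\<open>K\<close> is a single vertex short of a copy of the forest. A path that saves one
  vertex of \<open>K\<close> closes this gap, as the other components can alternate between the rest
  of \<open>K\<close> and \<open>W\<close>.\<close>

lemma no_cheap_path:
  assumes "is_path E V xs" "length xs \<in> set ls" "card (set xs \<inter> K) < length xs div 2"
  shows False
proof -
  let ?l = "length xs"
  obtain ls1 ls2 where ls12: "ls = ls1 @ ?l # ls2" using assms(2) by (meson split_list)
  let ?Z = "K - set xs" and ?W = "W - set xs"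
  have "card ?Z = card K - card (set xs \<inter> K)"
    by (simp add: card_Diff_subset_Int Int_commute)
  then have cZ: "length ds + cover_sum (ls1 @ ls2) \<le> card ?Z"
    using card_K assms(3) unfolding ls12 by simp
  have "card W - card (set xs) \<le> card ?W" by (intro diff_card_le_card_Diff) auto
  moreover have "card (set xs) \<le> sum_list ls"
    using card_length[of xs] path_order_le[OF assms(2)] by linarith
  ultimately have "sum_list ds + sum_list ls \<le> card ?W" using many' by linarith
  then have cW: "sum_list ds + sum_list (ls1 @ ls2) \<le> card ?W" unfolding ls12 by simp
  have "packs E (?Z \<union> ?W) (forest ds (ls1 @ ls2))"
  proof (rule packs_forest_bipartite[OF _ _ _ _ cZ cW])
    show "?Z \<inter> ?W = {}" using W_sub by blast
    show "{z, w} \<in> E" if "z \<in> ?Z" "w \<in> ?W" for z w using that W_adj by blast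
  qed (use finK finW in auto)
  then have "packs E (V - set xs) (forest ds (ls1 @ ls2))"
    by (rule packs_mono) (use K W_sub in blast)
  moreover have "set xs \<subseteq> V" using assms(1) by (simp add: is_path_def)
  ultimately have "packs E V ((map star_graph ds @ map path_graph ls1) @ path_graph ?l # map path_graph ls2)"
    using copy_on_path_if_is_path[OF assms(1)] by (intro packs_insert) auto
  then have "packs E V (forest ds (ls1 @ ?l # ls2))" by simp
  then show False using free unfolding ls12[symmetric] by blast
qed

lemma obtain_W_list:
  assumes "finite D" "card D \<le> 4" "n \<le> sum_list ls"
  obtains ws where "distinct ws" "length ws = n" "set ws \<subseteq> W - D"
proof (rule obtain_distinct_list)
  show "finite (W - D)" using finW by simp
  have "card W - card D \<le> card (W - D)" by (intro diff_card_le_card_Diff assms(1))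
  then show "n \<le> card (W - D)" using many' assms by linarith
qed

text \<open>The tail replaces one core vertex: followed by \<open>l div 2 - 1\<close> pairs of a
  core vertex and a common neighbour, the first core vertex being \<open>c\<close>, it has exactly
  \<open>l\<close> vertices. The parity of \<open>l\<close> decides whether the tail needs two or
  three vertices.\<close>

lemma no_tail_near_core:
  assumes "is_path E (V - K) zs" "c \<in> K" "{last zs, c} \<in> E"
    and "l \<in> set ls" "length zs = 2 \<and> even l \<or> length zs = 3 \<and> odd l"
  shows False
proof -
  obtain e where e: "l div 2 = Suc e" using ls(2) assms(4) by (cases "l div 2") fastforce+
  have zs: "zs \<noteq> []" using assms(5) by auto
  have "e - 1 \<le> card (K - {c})" using path_cover_lt[OF assms(4)] e assms(2) finK by simp
  then obtain cs' where cs': "distinct cs'" "length cs' = e - 1" "set cs' \<subseteq> K - {c}"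
    using obtain_distinct_list[of "K - {c}" "e - 1"] finK by auto
  \<comment> \<open>For \<open>l\<close> equal to 2 or 3 the tail is already the whole path, and the
    list of core vertices is empty.\<close>
  define cs where "cs = (if e = 0 then [] else c # cs')"
  have cs: "distinct cs" "length cs = e" "set cs \<subseteq> K" "cs \<noteq> [] \<Longrightarrow> hd cs = c"
    using cs' assms(2) by (auto simp: cs_def)
  have "e \<le> sum_list ls" using path_order_le[OF assms(4)] e by linarith
  moreover have "card (set zs) \<le> 4" using card_length[of zs] assms(5) by auto
  ultimately obtain ws where ws: "distinct ws" "length ws = e" "set ws \<subseteq> W - set zs"
    using obtain_W_list[of "set zs" e] by auto
  let ?xs = "zs @ splice cs ws"
  have mid: "is_path E V (splice cs ws)"
    using cs ws K W_sub W_adj by (intro is_path_splice) (auto, blast+)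
  have "set zs \<subseteq> V - K" using assms(1) by (simp add: is_path_def)
  then have "set zs \<inter> set (splice cs ws) = {}" using cs(3) ws(3) by (auto simp: set_splice)
  moreover have "hd (splice cs ws) = c" if "splice cs ws \<noteq> []"
  proof -
    have "cs \<noteq> []" using that cs(2) ws(2) by auto
    then show ?thesis using hd_splice cs(4) by metis
  qed
  ultimately have path: "is_path E V ?xs"
    using mid is_path_mono[OF assms(1), of V] assms(3) by (auto simp: is_path_append)
  have len: "length ?xs = l" using assms(5) cs(2) ws(2) e by (auto elim!: evenE oddE)
  have "set ?xs \<inter> K \<subseteq> set cs"
    using \<open>set zs \<subseteq> V - K\<close> ws(3) W_sub by (auto simp: set_splice)
  then have "card (set ?xs \<inter> K) \<le> card (set cs)" by (intro card_mono) auto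
  also have "\<dots> < length ?xs div 2" using card_length[of cs] cs(2) len e by simp
  finally show False using no_cheap_path[OF path] len assms(4) by simp
qed

text \<open>Outer edges at both ends replace one core vertex of an odd path: four end vertices,
  \<open>l div 2 - 1\<close> core vertices and \<open>l div 2 - 2\<close> common neighbours make
  exactly \<open>l\<close>. For \<open>l = 5\<close> there is a single core vertex, to which both
  tails attach; for longer paths the first and the last core vertex differ.\<close>

lemma no_two_tails_near_core:
  assumes "is_path E (V - K) [u, v]" "is_path E (V - K) [v', u']" "{u, v} \<inter> {v', u'} = {}"
    and "c \<in> K" "c' \<in> K" "{v, c} \<in> E" "{c', v'} \<in> E"
    and "l \<in> set ls" "odd l" "l div 2 = 2 \<and> c = c' \<or> 3 \<le> l div 2 \<and> c \<noteq> c'"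
  shows False
proof -
  obtain e where e: "l div 2 = Suc (Suc e)"
    using assms(10) by (cases "l div 2"; cases "l div 2 - 1") auto
  have "\<exists>cs. distinct cs \<and> length cs = Suc e \<and> set cs \<subseteq> K \<and> hd cs = c \<and> last cs = c'"
  proof (cases "c = c'")
    case True
    then show ?thesis using assms(4,10) e by (intro exI[of _ "[c]"]) auto
  next
    case False
    then obtain j where j: "e = Suc j" using assms(10) e by (cases e) auto
    have "card (K - {c, c'}) = card K - 2" using False assms(4,5) finK by (simp add: card_Diff_subset)
    then have "j \<le> card (K - {c, c'})" using path_cover_lt[OF assms(8)] e j by simp
    then obtain cs where "distinct cs" "length cs = j" "set cs \<subseteq> K - {c, c'}"
      using obtain_distinct_list[of "K - {c, c'}" j] finK by auto
    then show ?thesis using False assms(4,5) j by (intro exI[of _ "c # cs @ [c']"]) auto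
  qed
  then obtain cs where cs: "distinct cs" "length cs = Suc e" "set cs \<subseteq> K" "hd cs = c" "last cs = c'" by blast
  have cs_ne: "cs \<noteq> []" using cs(2) by auto
  let ?D = "{u, v, v', u'}"
  have "e \<le> sum_list ls" using path_order_le[OF assms(8)] e by linarith
  moreover have "card ?D \<le> 4" by (simp add: card_insert_if)
  ultimately obtain ws where ws: "distinct ws" "length ws = e" "set ws \<subseteq> W - ?D"
    using obtain_W_list[of ?D e] by auto
  let ?m = "splice cs ws"
  have mid: "is_path E V ?m"
    using cs ws K W_sub W_adj by (intro is_path_splice) (auto, blast+)
  have D: "?D \<subseteq> V - K" using assms(1,2) by (auto simp: is_path_def)
  have sm: "set ?m \<subseteq> K \<union> (W - ?D)" using cs(3) ws(3) by (auto simp: set_splice)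
  have m: "hd ?m = c" "last ?m = c'" "?m \<noteq> []"
    using hd_splice[OF cs_ne] last_splice[of cs ws] cs ws by auto
  let ?xs = "[u, v] @ ?m @ [v', u']"
  have "is_path E V [u, v]" "is_path E V [v', u']" using is_path_mono assms(1,2) by blast+
  moreover have "set [u, v] \<inter> set (?m @ [v', u']) = {}" "set ?m \<inter> set [v', u'] = {}"
    using assms(3) sm D by auto
  ultimately have path: "is_path E V ?xs"
    using mid m assms(6,7) unfolding is_path_append by simp
  have len: "length ?xs = l" using cs(2) ws(2) e assms(9) by (auto elim!: oddE)
  have "set ?xs \<inter> K \<subseteq> set cs" using D ws(3) W_sub by (auto simp: set_splice)
  then have "card (set ?xs \<inter> K) \<le> card (set cs)" by (intro card_mono) auto
  also have "\<dots> < length ?xs div 2" using card_length[of cs] cs(2) len e by simp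
  finally show False using no_cheap_path[OF path] len assms(8) by simp
qed

section \<open>Consequences of extremality\<close>

lemma touching_edges_ge:
  assumes Y: "Y \<subseteq> V - K" and large: "sum_list ds + length ds + sum_list ls \<le> card (W - Y)"
  shows "card K * card Y + esize E (V - Y) \<le> esize E V"
proof -
  let ?E0 = "{e \<in> E. e \<inter> Y = {}}" and ?E1 = "{{y, c} | y c. y \<in> Y \<and> c \<in> K}"
  let ?As = "forest ds ls"
  have finY: "finite Y" using Y finV by (meson finite_Diff finite_subset)
  have E1: "?E1 = (\<lambda>(y, c). {y, c}) ` (Y \<times> K)" by auto
  have "inj_on (\<lambda>(y, c). {y, c}) (Y \<times> K)"
    using Y by (auto simp: inj_on_def doubleton_eq_iff)
  then have c1: "card ?E1 = card Y * card K"
    unfolding E1 by (simp add: card_image card_cartesian_product)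
  have "?E0 = {e \<in> E. e \<subseteq> V - Y}" using edges_in by blast
  then have c0: "card ?E0 = esize E (V - Y)" by (simp add: esize_def)
  have fin1: "finite ?E1" unfolding E1 using finY finK by simp
  have "?E0 \<inter> ?E1 = {}" by auto
  then have "card (?E0 \<union> ?E1) = esize E (V - Y) + card Y * card K"
    using finE fin1 c0 c1 by (simp add: card_Un_disjoint)
  moreover have "card (?E0 \<union> ?E1) \<le> card E"
  proof (rule extremal)
    have "y \<noteq> c" if "y \<in> Y" "c \<in> K" for y c using that Y by blast
    then show "simple_edges (?E0 \<union> ?E1)"
      using simple by (auto simp: simple_edges_def)
    show "\<forall>e\<in>?E0 \<union> ?E1. e \<subseteq> V" using edges_in Y K by auto
    show "\<not> packs (?E0 \<union> ?E1) V ?As"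
    proof
      assume "packs (?E0 \<union> ?E1) V ?As"
      moreover have "\<forall>A\<in>set ?As. simple_graph A"
        by (auto simp: simple_graph_star_graph simple_graph_path_graph)
      moreover have "(\<Sum>A\<leftarrow>?As. card (verts A)) \<le> card (W - Y)"
        using large by (simp add: star_graph_def path_graph_def comp_def sum_list_Suc)
      ultimately have "packs E V ?As"
        using packs_untwin[OF _ _ finV K Y refl] by blast
      then show False using free by blast
    qed
  qed
  ultimately show ?thesis by (simp add: card_E mult.commute)
qed

lemma min_degree:
  assumes "v \<in> V - K"
  shows "card K \<le> degree E V v"
proof -
  have "card W - 1 \<le> card (W - {v})" using finW by (simp add: card_Diff_singleton_if)
  then have "card K * card {v} + esize E (V - {v}) \<le> esize E V"
    using assms many' by (intro touching_edges_ge) auto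
  then show ?thesis using esize_remove[OF simple finV, of v] assms by simp
qed

text \<open>The outer vertices at which a tail cannot be attached to the core. Once this set is
  known to be empty, every outer edge is a tail.\<close>

definition far :: "'a set" where
  "far = {v \<in> V - K. \<forall>c\<in>K. {v, c} \<notin> E}"

text \<open>A nonempty set far that no edge leaves would be dense by the previous bound, and so contain
  a path on 2 * card K + 1 vertices disjoint from K.\<close>

lemma far_empty:
  assumes "\<And>v y. v \<in> far \<Longrightarrow> y \<in> V - far \<Longrightarrow> {v, y} \<notin> E"
  shows "far = {}"
proof (rule ccontr)
  assume ne: "far \<noteq> {}"
  have far: "far \<subseteq> V - K" by (auto simp: far_def)
  have finF: "finite far" using far finV by (meson finite_Diff finite_subset)
  have "K \<noteq> {}" using K_ge_2 by auto
  \<comment> \<open>Vertices of \<open>W\<close> see all of the nonempty set \<open>K\<close>, so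
    none of them is far and all are available as replacements.\<close>
  then have "W - far = W" by (auto simp: far_def common_nbrs_def)
  then have "card K * card far + esize E (V - far) \<le> esize E V"
    using many' far by (intro touching_edges_ge) auto
  moreover have "esize E V = esize E (V - far) + esize E far"
    using far assms by (intro esize_separated[OF simple finV]) auto
  ultimately have dense: "card K * card far \<le> esize E far" by simp
  obtain xs where xs: "is_path E far xs" "length xs = 2 * card K + 1"
  proof (rule ccontr)
    assume "\<not> thesis"
    then have "2 * esize E far \<le> (2 * card K + 1 - 2) * card far"
      using that K_ge_2 by (intro erdos_gallai_path[OF simple finF]) auto
    also have "\<dots> < 2 * card K * card far"
      using ne finF K_ge_2 by (simp add: card_gt_0_iff)
    finally show False using dense by simp
  qed
  obtain l where l: "l \<in> set ls" using ls(1) by (cases ls) auto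
  let ?xs = "take l xs"
  have len: "length ?xs = l" using path_cover_lt[OF l] xs(2) by simp
  have path: "is_path E far ?xs" using xs(1) by (rule is_path_take)
  then have "set ?xs \<inter> K = {}" using far by (auto simp: is_path_def)
  then have "card (set ?xs \<inter> K) < length ?xs div 2" using len ls(2) l by fastforce
  moreover have "is_path E V ?xs" using is_path_mono[OF path] far by blast
  ultimately show False using no_cheap_path len l by metis
qed

lemma edge_path: "{u, v} \<in> E \<Longrightarrow> u \<in> X \<Longrightarrow> v \<in> X \<Longrightarrow> is_path E X [u, v]"
  using simple_edges_no_loop'[OF simple] by (auto simp: is_path_def)

lemma not_far: "v \<in> V - K \<Longrightarrow> v \<notin> far \<Longrightarrow> \<exists>c\<in>K. {v, c} \<in> E"
  by (auto simp: far_def)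

section \<open>Edges outside the core\<close>

abbreviation "M0 \<equiv> {e \<in> E. e \<subseteq> V - K}"

text \<open>An outer edge with an end adjacent to \<open>K\<close> is a tail of two vertices. Hence
  no edge leaves \<open>far\<close>, so \<open>far\<close> is empty, and then every outer edge would
  be such a tail.\<close>

lemma no_outer_edge:
  assumes "l \<in> set ls" "even l"
  shows "M0 = {}"
proof -
  have near: False if "{u, v} \<in> E" "u \<in> V - K" "v \<in> V - K" "c \<in> K" "{v, c} \<in> E" for u v c
    using no_tail_near_core[OF edge_path[OF that(1-3)] that(4) _ assms(1)] that(5) assms(2) by simp
  have "far = {}"
  proof (rule far_empty)
    fix v y assume v: "v \<in> far" and y: "y \<in> V - far"
    show "{v, y} \<notin> E"
    proof
      assume e: "{v, y} \<in> E"
      have "y \<in> V - K" "v \<in> V - K" using v y e by (auto simp: far_def)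
      then show False using not_far[of y] y near[OF e] by blast
    qed
  qed
  show ?thesis
  proof (rule ccontr)
    assume "M0 \<noteq> {}"
    then obtain e where e: "e \<in> E" "e \<subseteq> V - K" by blast
    then obtain u v where uv: "e = {u, v}" using simple by (auto simp: simple_edges_def card_2_iff)
    then show False using e not_far[of v] \<open>far = {}\<close> near[of u v] by blast
  qed
qed

text \<open>An edge leaving \<open>far\<close> extends to a tail of three vertices: a far vertex has
  degree at least \<open>card K\<close>, hence a second neighbour, which also lies outside
  \<open>K\<close>.\<close>

lemma far_empty_if_odd:
  assumes "l \<in> set ls" "odd l"
  shows "far = {}"
proof (rule far_empty)
  fix v y assume v: "v \<in> far" and y: "y \<in> V - far"
  show "{v, y} \<notin> E"
  proof
    assume e: "{v, y} \<in> E"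
    have yv: "y \<in> V - K" "v \<in> V - K" using v y e by (auto simp: far_def)
    obtain c where c: "c \<in> K" "{y, c} \<in> E" using not_far[of y] y yv(1) by blast
    have "2 \<le> degree E V v" using min_degree[OF yv(2)] K_ge_2 by linarith
    then have "\<not> nbrs E V v \<subseteq> {y}" using card_mono[of "{y}" "nbrs E V v"] by auto
    then obtain y' where y': "y' \<in> V" "{y', v} \<in> E" "y' \<noteq> y" by (auto simp: nbrs_def)
    have "y' \<notin> K" using v y'(2) by (auto simp: far_def insert_commute)
    moreover have "v \<noteq> y" using e simple_edges_no_loop[OF simple] by blast
    moreover have "v \<noteq> y'" using y'(2) simple_edges_no_loop[OF simple] by blast
    ultimately have "is_path E (V - K) [y', v, y]"
      using yv y' e by (auto simp: is_path_def)
    then show False using no_tail_near_core[OF _ c(1) _ assms(1), of "[y', v, y]"] c(2) assms(2) by simp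
  qed
qed

text \<open>Two outer edges with a common vertex form a tail of three vertices, whose end has a
  neighbour in \<open>K\<close> because \<open>far\<close> is empty.\<close>

lemma outer_matching:
  assumes "l \<in> set ls" "odd l"
  shows "matching_on (V - K) M0"
  unfolding matching_on_def
proof (intro conjI ballI)
  show "card e = 2" "e \<subseteq> V - K" if "e \<in> M0" for e using that simple by (auto simp: simple_edges_def)
  show "disjoint M0"
  proof (rule disjointI, rule ccontr)
    fix e f assume e: "e \<in> M0" and f: "f \<in> M0" and ne: "e \<noteq> f" and "e \<inter> f \<noteq> {}"
    then obtain u where u: "u \<in> e" "u \<in> f" by blast
    have "card e = 2" "card f = 2" using e f simple by (auto simp: simple_edges_def)
    then obtain y z where yz: "e = {u, y}" "f = {u, z}" "u \<noteq> y" "u \<noteq> z"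
      using u by (auto simp: card_2_iff)
    have "y \<noteq> z" using ne yz by blast
    then have "is_path E (V - K) [y, u, z]" using e f yz by (auto simp: is_path_def insert_commute)
    moreover obtain c where "c \<in> K" "{z, c} \<in> E"
      using not_far[of z] far_empty_if_odd[OF assms] f yz(2) by blast
    ultimately show False
      using no_tail_near_core[OF _ _ _ assms(1), of "[y, u, z]" c] assms(2) by simp
  qed
qed

text \<open>As the outer edges form a matching, each of their ends misses at most one vertex of
  \<open>K\<close>. Two outer edges can therefore be attached as two tails: at a common core vertex
  if \<open>l = 5\<close>, where \<open>card K\<close> is at least 3, and at distinct ones if
  \<open>l\<close> is larger.\<close>

lemma outer_edges_le_1:
  assumes "\<forall>l\<in>set ls. odd l" "l \<in> set ls" "l \<noteq> 3"
  shows "card M0 \<le> 1"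
proof (rule ccontr)
  assume "\<not> card M0 \<le> 1"
  moreover have "finite M0" using finE by simp
  ultimately have "\<exists>e\<in>M0. \<exists>f\<in>M0. e \<noteq> f" using card_le_Suc0_iff_eq[of M0] unfolding One_nat_def by blast
  then obtain e f where ef: "e \<in> M0" "f \<in> M0" "e \<noteq> f" by blast
  have odd: "odd l" using assms(1,2) by blast
  have disj: "e \<inter> f = {}"
    using outer_matching[OF assms(2) odd] ef by (auto simp: matching_on_def disjoint_def)
  have card2: "card e = 2" "card f = 2" using ef simple by (auto simp: simple_edges_def)
  obtain u v where "e = {u, v}" "u \<noteq> v" using card2(1) unfolding card_2_iff by blast
  moreover obtain v' u' where "f = {v', u'}" "u' \<noteq> v'" using card2(2) unfolding card_2_iff by blast
  ultimately have uv: "e = {u, v}" "f = {v', u'}" "u \<noteq> v" "u' \<noteq> v'" by blast+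
  have deg: "card K - 1 \<le> degree E K x" if x: "x \<in> g" and g: "g \<in> M0" for x g
  proof -
    have gE: "g \<in> E" "g \<subseteq> V - K" using g by auto
    have "nbrs E V x \<subseteq> nbrs E K x \<union> (g - {x})"
    proof
      fix y assume y: "y \<in> nbrs E V x"
      show "y \<in> nbrs E K x \<union> (g - {x})"
      proof (cases "y \<in> K")
        case False
        have "{y, x} \<in> M0" using y x gE False by (auto simp: nbrs_def)
        moreover have "{y, x} \<inter> g \<noteq> {}" using x by blast
        ultimately have "{y, x} = g"
          using outer_matching[OF assms(2) odd] g disjointD[of M0 "{y, x}" g]
          by (auto simp: matching_on_def)
        moreover have "y \<noteq> x" using y not_in_nbrs[OF simple] by metis
        ultimately show ?thesis by blast
      qed (use y in \<open>auto simp: nbrs_def\<close>)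
    qed
    moreover have "finite g" "card g = 2" using gE simple by (auto simp: simple_edges_def card_ge_0_finite)
    ultimately have "degree E V x \<le> card (nbrs E K x \<union> (g - {x}))"
      using finite_nbrs[OF finK] by (intro card_mono) auto
    also have "\<dots> \<le> degree E K x + card (g - {x})" by (rule card_Un_le)
    also have "card (g - {x}) = 1" using x \<open>card g = 2\<close> by simp
    finally show ?thesis using min_degree[of x] x gE(2) by fastforce
  qed
  have paths: "is_path E (V - K) [u, v]" "is_path E (V - K) [v', u']"
    using ef uv by (auto intro!: edge_path)
  have dv: "card K - 1 \<le> degree E K v" "card K - 1 \<le> degree E K v'"
    using deg[of v e] deg[of v' f] ef uv by auto
  have adj: "{x, c} \<in> E" "{c, x} \<in> E" if "c \<in> nbrs E K x" for c x
    using that by (auto simp: nbrs_def insert_commute)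
  have inK: "c \<in> K" if "c \<in> nbrs E K x" for c x using that by (simp add: nbrs_def)
  have "l \<noteq> 2" "2 \<le> l" using odd ls(2) assms(2) by auto
  then have l4: "2 \<le> l div 2" using assms(3) by auto
  show False
  proof (cases "l div 2 = 2")
    case True
    have "nbrs E K v \<inter> nbrs E K v' \<noteq> {}"
    proof
      assume "nbrs E K v \<inter> nbrs E K v' = {}"
      then have "degree E K v + degree E K v' = card (nbrs E K v \<union> nbrs E K v')"
        using finite_nbrs[OF finK] by (simp add: card_Un_disjoint)
      also have "\<dots> \<le> card K" by (rule card_mono[OF finK]) (use inK in blast)
      finally show False using dv path_cover_lt[OF assms(2)] True by linarith
    qed
    then obtain c where "c \<in> nbrs E K v" "c \<in> nbrs E K v'" by blast
    then show False
      using no_two_tails_near_core[OF paths _ inK inK adj(1) adj(2) assms(2) odd] disj uv True by blast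
  next
    case False
    obtain c where c: "c \<in> nbrs E K v"
      using dv(1) K_ge_2 by (cases "nbrs E K v = {}") auto
    have "2 \<le> degree E K v'" using dv(2) path_cover_lt[OF assms(2)] False l4 by linarith
    then have "\<not> nbrs E K v' \<subseteq> {c}" using card_mono[of "{c}" "nbrs E K v'"] by auto
    then obtain c' where "c' \<in> nbrs E K v'" "c' \<noteq> c" by blast
    then show False
      using no_two_tails_near_core[OF paths _ inK inK adj(1) adj(2) assms(2) odd] disj uv c False l4 by force
  qed
qed

text \<open>\<open>M\<close> is the outer part of a graph that contains no copy of the forest. By
  extremality \<open>E\<close> has at least as many edges as that graph, while its own outer part
  has at most \<open>card M\<close>; so no core edge is missing and the outer parts have equal
  size.\<close>

lemma core_structure:
  assumes "matching_on (V - K) M" "card M0 \<le> card M"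
    and "M = {} \<or> (card M \<le> 1 \<and> (\<forall>l\<in>set ls. odd l)) \<or> (\<forall>l\<in>set ls. l = 3)"
  shows "E = core_edges V K \<union> M0" "card M0 = card M"
proof -
  let ?C = "core_edges V K"
  have M: "\<forall>e\<in>M. e \<subseteq> V - K \<and> card e = 2" using assms(1) by (auto simp: matching_on_def)
  have "E \<subseteq> ?C \<union> M0"
  proof
    fix e assume e: "e \<in> E"
    then have "card e = 2" using simple by (auto simp: simple_edges_def)
    then obtain u v where uv: "e = {u, v}" "u \<noteq> v" by (auto simp: card_2_iff)
    have "e \<subseteq> V" using edges_in e by blast
    then show "e \<in> ?C \<union> M0" using e uv core_edges_iff[OF K, of u v] by auto
  qed
  have finC: "finite ?C"
    using core_edges_subset[OF K] finV by (intro finite_subset[of ?C "Pow V"]) auto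
  have finM: "finite M" using M finV by (intro finite_subset[of M "Pow V"]) auto
  have "?C \<inter> M = {}" using M core_edges_meet[of _ V K] by blast
  then have "card (?C \<union> M) = card ?C + card M" using finC finM by (simp add: card_Un_disjoint)
  moreover have "card (?C \<union> M) \<le> card E"
  proof (rule extremal)
    show "simple_edges (?C \<union> M)" using simple_core_edges[of V K] M by (auto simp: simple_edges_def)
    show "\<forall>e\<in>?C \<union> M. e \<subseteq> V" using M core_edges_subset[OF K] by blast
    show "\<not> packs (?C \<union> M) V (forest ds ls)"
      using card_K by (intro core_matching_free[OF finV K _ ds(2) assms(1,3)]) simp
  qed
  moreover have "card E \<le> card (E \<inter> ?C) + card M0"
  proof -
    have "E = (E \<inter> ?C) \<union> M0" using \<open>E \<subseteq> ?C \<union> M0\<close> by blast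
    then show ?thesis using card_Un_le[of "E \<inter> ?C" M0] by simp
  qed
  moreover have "card (E \<inter> ?C) \<le> card ?C" using finC by (intro card_mono) auto
  ultimately have "card (E \<inter> ?C) = card ?C" "card M0 = card M" using assms(2) by linarith+
  then have "E \<inter> ?C = ?C" using finC by (intro card_subset_eq) auto
  then show "E = ?C \<union> M0" using \<open>E \<subseteq> ?C \<union> M0\<close> by blast
  show "card M0 = card M" by fact
qed

lemma outer_ge_2: "2 \<le> card (V - K)"
proof -
  have "card W \<le> card (V - K)" using W_sub finV by (intro card_mono) auto
  then show ?thesis using many' by linarith
qed

lemma structure_even:
  assumes "\<exists>l\<in>set ls. even l"
  shows "E = core_edges V K"
proof -
  have "M0 = {}" using assms no_outer_edge by blast
  then have "card M0 \<le> card {}" by (simp only: card.empty)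
  then have "E = core_edges V K \<union> M0"
    by (intro core_structure(1)[of "{}"]) (simp_all add: matching_on_def disjoint_def)
  then show ?thesis using \<open>M0 = {}\<close> by blast
qed

lemma structure_odd:
  assumes "\<forall>l\<in>set ls. odd l" "\<exists>l\<in>set ls. l \<noteq> 3"
  obtains x y where "x \<in> V - K" "y \<in> V - K" "x \<noteq> y" "E = core_edges V K \<union> {{x, y}}"
proof -
  \<comment> \<open>One outer edge at an arbitrary pair gives a valid competitor, so exactly one
    outer edge must be present.\<close>
  obtain A where "A \<subseteq> V - K" "card A = 2" by (rule obtain_subset_with_card_n[OF outer_ge_2])
  then have A: "matching_on (V - K) {A}" by (simp add: matching_on_def disjoint_def)
  have le: "card M0 \<le> 1" using assms outer_edges_le_1 by blast
  have "card M0 \<le> card {A}" using le by simp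
  from core_structure[OF A this] assms(1) have M0: "E = core_edges V K \<union> M0" "card M0 = 1" by auto
  then obtain e where e: "M0 = {e}" by (auto simp: card_1_singleton_iff)
  then have "e \<in> E" "e \<subseteq> V - K" by auto
  moreover from this have "card e = 2" using simple by (auto simp: simple_edges_def)
  ultimately show ?thesis using that M0(1) e unfolding card_2_iff by auto
qed

lemma structure_3:
  assumes "\<forall>l\<in>set ls. l = 3"
  obtains M where "maximum_matching_on (V - K) M" "E = core_edges V K \<union> M"
proof -
  have fin: "finite (V - K)" using finV by simp
  obtain M where M: "matching_on (V - K) M" "card M = card (V - K) div 2"
    using ex_matching_on[OF fin] by blast
  obtain l where "l \<in> set ls" using ls(1) by (cases ls) auto
  then have l: "l \<in> set ls" "odd l" using assms by auto
  have M0: "matching_on (V - K) M0" by (rule outer_matching[OF l])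
  have "card M0 \<le> card M" using matching_on_card[OF fin M0] M(2) by simp
  then have "E = core_edges V K \<union> M0" "card M0 = card M"
    using core_structure[OF M(1)] assms by auto
  then show ?thesis using that M0 M(2) maximum_matching_on_iff[OF fin] by metis
qed

end

section \<open>Translation to the graphs and the forest of the theorem\<close>

lemma graph_iso_refl: "G \<simeq>\<^sub>g G"
  unfolding graph_iso_def by (intro exI[of _ id]) auto

lemma matching_on_image:
  assumes "matching_on A M" "inj_on g A"
  shows "matching_on (g ` A) ((\<lambda>e. g ` e) ` M)" "card ((\<lambda>e. g ` e) ` M) = card M"
proof -
  have M: "e \<subseteq> A" "card e = 2" if "e \<in> M" for e using assms(1) that by (auto simp: matching_on_def)
  have "disjoint ((\<lambda>e. g ` e) ` M)"
  proof (rule disjointI)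
    fix e' f' assume "e' \<in> (\<lambda>e. g ` e) ` M" "f' \<in> (\<lambda>e. g ` e) ` M" and ne: "e' \<noteq> f'"
    then obtain e f where ef: "e \<in> M" "f \<in> M" "e' = g ` e" "f' = g ` f" by blast
    moreover have "disjoint M" using assms(1) by (simp add: matching_on_def)
    ultimately have "e \<inter> f = {}" using ne disjointD[of M e f] by blast
    with ef show "e' \<inter> f' = {}" using inj_on_image_Int[OF assms(2) M(1)[OF ef(1)] M(1)[OF ef(2)]] ef by simp
  qed
  moreover have "card (g ` e) = 2" if "e \<in> M" for e
    using M[OF that] card_image[OF inj_on_subset[OF assms(2) M(1)[OF that]]] by simp
  ultimately show "matching_on (g ` A) ((\<lambda>e. g ` e) ` M)"
    unfolding matching_on_def using M by auto
  have "inj_on (\<lambda>e. g ` e) M"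
  proof (rule inj_onI)
    fix e f assume "e \<in> M" "f \<in> M" "g ` e = g ` f"
    then show "e = f" using inj_on_image_eq_iff[OF assms(2) M(1) M(1)] by simp
  qed
  then show "card ((\<lambda>e. g ` e) ` M) = card M" by (rule card_image)
qed

lemma iso_join_empty:
  assumes "finite (verts G)" "K \<subseteq> verts G" "card K = k" "card (verts G - K) = m"
    and "edges G = core_edges (verts G) K"
  shows "G \<simeq>\<^sub>g graph_join (complete_graph k) (graph_complement (complete_graph m))"
proof -
  obtain g where g: "bij_betw g (verts G - K) {..<m}"
    using ex_bij_betw_finite_nat[of "verts G - K"] assms(1,4) by (auto simp: atLeast0LessThan)
  show ?thesis
    by (rule graph_iso_core[OF assms(1-3) _ _ g, of "{}"])
      (use assms(5) in \<open>simp_all add: edges_join_complete verts_join_complete complement_complete_graph\<close>)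
qed

lemma iso_join_matching:
  assumes "finite (verts G)" "K \<subseteq> verts G" "card K = k" "card (verts G - K) = m"
    and "edges G = core_edges (verts G) K \<union> M" "maximum_matching_on (verts G - K) M"
  shows "\<exists>M'. maximum_matching_on (Inr ` verts (graph_complement (complete_graph m))) M' \<and>
    G \<simeq>\<^sub>g add_edges (graph_join (complete_graph k) (graph_complement (complete_graph m))) M'"
proof -
  have fin: "finite (verts G - K)" using assms(1) by simp
  obtain g where g: "bij_betw g (verts G - K) {..<m}"
    using ex_bij_betw_finite_nat[of "verts G - K"] assms(1,4) by (auto simp: atLeast0LessThan)
  let ?h = "Inr \<circ> g :: 'a \<Rightarrow> nat + nat"
  let ?M = "(\<lambda>e. ?h ` e) ` M"
  have M: "matching_on (verts G - K) M" "card M = m div 2"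
    using assms(4,6) maximum_matching_on_iff[OF fin] by auto
  have inj: "inj_on ?h (verts G - K)" and img: "?h ` (verts G - K) = Inr ` {..<m}"
    using g by (auto simp: bij_betw_def inj_on_def image_comp[symmetric])
  have "maximum_matching_on (Inr ` {..<m}) ?M"
    using matching_on_image[OF M(1) inj] M(2) maximum_matching_on_iff[of "Inr ` {..<m}" ?M]
    unfolding img by (simp add: card_image)
  moreover have "G \<simeq>\<^sub>g add_edges (graph_join (complete_graph k) (graph_complement (complete_graph m))) ?M"
    by (rule graph_iso_core[OF assms(1-3,5) _ g])
      (use M(1) in \<open>auto simp: matching_on_def add_edges_def edges_join_complete verts_join_complete complement_complete_graph\<close>)
  ultimately show ?thesis by (auto simp: complement_complete_graph)
qed

lemma iso_join_edge:
  assumes "finite (verts G)" "K \<subseteq> verts G" "card K = k" "card (verts G - K) = m + 2"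
    and "x \<in> verts G - K" "y \<in> verts G - K" "x \<noteq> y"
    and "edges G = core_edges (verts G) K \<union> {{x, y}}"
  shows "G \<simeq>\<^sub>g graph_join (complete_graph k)
    (graph_union (complete_graph 2) (graph_complement (complete_graph m)))"
proof -
  let ?D = "verts G - K - {x, y}"
  let ?B = "graph_union (complete_graph 2) (graph_complement (complete_graph m))"
  have "card ?D = m" using assms(1,4-7) by (simp add: card_Diff_subset)
  then obtain h where h: "bij_betw h ?D {..<m}"
    using ex_bij_betw_finite_nat[of ?D] assms(1) by (auto simp: atLeast0LessThan)
  define g :: "'a \<Rightarrow> nat + nat"
    where "g v = (if v = x then Inl 0 else if v = y then Inl 1 else Inr (h v))" for v
  have "bij_betw g {x, y} (Inl ` {..<2})"
    using assms(7) by (auto simp: bij_betw_def g_def numeral_2_eq_2 lessThan_Suc)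
  moreover have "bij_betw (Inr \<circ> h) ?D (Inr ` {..<m})"
    by (rule bij_betw_trans[OF h]) (simp add: bij_betw_def)
  then have "bij_betw g ?D (Inr ` {..<m})"
    by (subst bij_betw_cong[of _ _ "Inr \<circ> h"]) (auto simp: g_def)
  moreover have "Inl ` {..<2} \<inter> (Inr ` {..<m} :: (nat + nat) set) = {}" by auto
  ultimately have "bij_betw g ({x, y} \<union> ?D) (Inl ` {..<2} \<union> Inr ` {..<m})"
    by (rule bij_betw_combine)
  moreover have "{x, y} \<union> ?D = verts G - K" using assms(5,6) by auto
  moreover have "verts ?B = Inl ` {..<2} \<union> Inr ` {..<m}"
  proof -
    have "verts (complete_graph 2) = {..<2}" by (simp add: complete_graph_def)
    then show ?thesis by (simp add: graph_union_def complement_complete_graph Plus_def)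
  qed
  ultimately have g: "bij_betw g (verts G - K) (verts ?B)" by simp
  have eB: "edges ?B = {{Inl 0, Inl 1}}"
    by (simp add: graph_union_def complement_complete_graph edges_complete_2)
  show ?thesis
  proof (rule graph_iso_core[OF assms(1-3,8) _ g])
    show "edges (graph_join (complete_graph k) ?B) =
      core_edges (verts (graph_join (complete_graph k) ?B)) (Inl ` {..<k}) \<union> (\<lambda>e. (Inr \<circ> g) ` e) ` {{x, y}}"
      unfolding edges_join_complete eB using assms(7) by (simp add: g_def)
  qed (use assms(5,6) in \<open>simp_all add: verts_join_complete\<close>)
qed

lemma copy_of_star_forest_iff:
  "(\<exists>X\<subseteq>V. copy_on E (graph_Union {1..t} (\<lambda>i. star_graph (a i))) X) \<longleftrightarrow>
    packs E V (map star_graph (map a [1..<Suc t]))"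
proof -
  have "set [1..<Suc t] = {1..t}" by auto
  then show ?thesis
    using packs_graph_Union[of "[1..<Suc t]" E V "\<lambda>i. star_graph (a i)" "[]"] by (simp add: comp_def del: upt_Suc)
qed

lemma copy_of_forest_iff:
  "(\<exists>X\<subseteq>V. copy_on E (graph_union (graph_Union {1..t} (\<lambda>i. star_graph (a i)))
      (graph_Union {1..r} (\<lambda>j. path_graph (l j)))) X) \<longleftrightarrow>
    packs E V (map star_graph (map a [1..<Suc t]) @ map path_graph (map l [1..<Suc r]))"
  (is "?L \<longleftrightarrow> ?R")
proof -
  let ?S = "graph_Union {1..t} (\<lambda>i. star_graph (a i))" and ?P = "graph_Union {1..r} (\<lambda>j. path_graph (l j))"
  have sets: "set [1..<Suc t] = {1..t}" "set [1..<Suc r] = {1..r}" by auto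
  have "?R \<longleftrightarrow> (\<exists>X\<subseteq>V. copy_on E ?S X \<and> (\<exists>Y\<subseteq>V - X. copy_on E ?P Y))"
    using packs_graph_Union[of "[1..<Suc t]" E V "\<lambda>i. star_graph (a i)" "map path_graph (map l [1..<Suc r])"]
      packs_graph_Union[of "[1..<Suc r]" E _ "\<lambda>j. path_graph (l j)" "[]"] sets
    by (simp add: comp_def del: upt_Suc)
  also have "\<dots> \<longleftrightarrow> ?L"
  proof
    assume "\<exists>X\<subseteq>V. copy_on E ?S X \<and> (\<exists>Y\<subseteq>V - X. copy_on E ?P Y)"
    then obtain X Y where XY: "X \<subseteq> V" "copy_on E ?S X" "Y \<subseteq> V - X" "copy_on E ?P Y" by blast
    then have "X \<inter> Y = {}" "X \<union> Y \<subseteq> V" by blast+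
    then show ?L using XY unfolding copy_on_graph_union by blast
  next
    assume ?L
    then obtain X Y where XY: "X \<inter> Y = {}" "X \<union> Y \<subseteq> V" "copy_on E ?S X" "copy_on E ?P Y"
      unfolding copy_on_graph_union by blast
    then have "X \<subseteq> V" "Y \<subseteq> V - X" by blast+
    then show "\<exists>X\<subseteq>V. copy_on E ?S X \<and> (\<exists>Y\<subseteq>V - X. copy_on E ?P Y)" using XY by blast
  qed
  finally show ?thesis by blast
qed

theorem theorem1p7:
  fixes t r b :: nat and a l :: "nat \<Rightarrow> nat"
  assumes "t \<ge> 1" and "r \<ge> 2"
    and "antimono_on {1..t} a" and "\<forall>i\<in>{1..t}. a i \<ge> 3"
    and "antimono_on {1..r} l" and "\<forall>j\<in>{1..r}. l j \<ge> 2"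
    and "S = graph_Union {1..t} (\<lambda>i. star_graph (a i))"
    and "F = graph_union S (graph_Union {1..r} (\<lambda>j. path_graph (l j)))"
    and "b = (\<Sum>j=1..r. l j div 2)"
  shows "\<exists>n0. \<forall>n\<ge>n0. \<forall>G\<in>extremal_graphs n F.
      (\<exists>H\<in>extremal_graphs n S. G \<simeq>\<^sub>g H)
    \<or> ((\<forall>j\<in>{1..r}. l j = 3) \<and>
        (\<exists>M. maximum_matching_on
               (Inr ` verts (graph_complement (complete_graph (n - t - b + 1)))) M \<and>
             G \<simeq>\<^sub>g add_edges
               (graph_join (complete_graph (t + b - 1))
                  (graph_complement (complete_graph (n - t - b + 1)))) M))
    \<or> ((\<forall>j\<in>{1..r}. odd (l j)) \<and> (\<exists>j\<in>{1..r}. l j \<noteq> 3) \<and>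
        G \<simeq>\<^sub>g graph_join (complete_graph (t + b - 1))
               (graph_union (complete_graph 2)
                  (graph_complement (complete_graph (n - t - b - 1)))))
    \<or> ((\<exists>j\<in>{1..r}. even (l j)) \<and>
        G \<simeq>\<^sub>g graph_join (complete_graph (t + b - 1))
               (graph_complement (complete_graph (n - t - b + 1))))"
proof -
  define ds ls where "ds = map a [1..<Suc t]" and "ls = map l [1..<Suc r]"
  \<comment> \<open>The two shortest paths come last by monotonicity and are split off:
    \<open>m\<close> is what the completion of the core has to deal with, and it does so with the
    help of \<open>l'\<close>, where \<open>m \<le> l'\<close>.\<close>
  define ls0 l' m where "ls0 = map l [1..<r - 1]" and "l' = l (r - 1)" and "m = l r"
  define k where "k = t + b - 1"
  let ?As = "forest ds ls"
  have set_ds: "set ds = a ` {1..t}" and set_ls: "set ls = l ` {1..r}"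
    by (auto simp: ds_def ls_def)
  have ls_split: "ls = ls0 @ [l', m]"
  proof -
    obtain s where "r = Suc (Suc s)" using assms(2) by (metis add_2_eq_Suc le_Suc_ex)
    then show ?thesis by (simp add: ls_def ls0_def l'_def m_def)
  qed
  have len: "length ds = t" "length ls = r" by (simp_all add: ds_def ls_def)
  have ds: "ds \<noteq> []" "\<forall>d\<in>set ds. 3 \<le> d" using assms(1,4) len set_ds by auto
  have ls2: "\<forall>l\<in>set ls. 2 \<le> l" using assms(6) set_ls by auto
  have "m \<le> l'"
    using assms(5,2) unfolding monotone_on_def m_def l'_def by auto
  have b: "cover_sum ls = b"
    unfolding assms(9) ls_def by (simp add: comp_def sum_list_distinct_conv_sum_set atLeastLessThanSuc_atLeastAtMost del: upt_Suc)
  have "1 \<le> b" using cover_sum_pos[of ls] ls2 len assms(2) b by fastforce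
  then have k: "Suc k = t + b" using assms(1) by (simp add: k_def)
  have S_iff: "(\<exists>X\<subseteq>V. copy_on E S X) \<longleftrightarrow> packs E V (map star_graph ds)" for E :: "nat set set" and V
    unfolding assms(7) ds_def by (rule copy_of_star_forest_iff)
  have F_iff: "(\<exists>X\<subseteq>V. copy_on E F X) \<longleftrightarrow> packs E V ?As" for E :: "nat set set" and V
    unfolding assms(7,8) ds_def ls_def by (rule copy_of_forest_iff)
  have simple_S: "simple_graph S" unfolding assms(7) by (intro simple_graph_Union) (auto simp: simple_graph_star_graph)
  have simple_F: "simple_graph F"
    unfolding assms(8) by (intro simple_graph_union simple_S simple_graph_Union) (auto simp: simple_graph_path_graph)
  have free_S: "graph_free S G \<longleftrightarrow> \<not> packs (edges G) (verts G) (map star_graph ds)"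
    if "simple_graph G" for G :: "nat graph"
    using graph_free_iff_no_copy[OF that simple_S] S_iff by blast
  have free_F: "graph_free F G \<longleftrightarrow> \<not> packs (edges G) (verts G) ?As"
    if "simple_graph G" for G :: "nat graph"
    using graph_free_iff_no_copy[OF that simple_F] F_iff by blast
  have free_mono: "graph_free F G" if G: "simple_graph G" "graph_free S G" for G :: "nat graph"
  proof -
    have "packs (edges G) (verts G) (map star_graph ds)" if forest: "packs (edges G) (verts G) ?As"
    proof -
      obtain X where "X \<subseteq> verts G" "copy_on (edges G) F X" using F_iff forest by blast
      then obtain Y where "Y \<subseteq> verts G" "copy_on (edges G) S Y"
        unfolding assms(8) copy_on_graph_union by blast
      then show ?thesis using S_iff by blast
    qed
    then show ?thesis using free_S[OF G(1)] free_F[OF G(1)] G(2) by blast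
  qed
  \<comment> \<open>A competitor with \<open>k\<close> dominating vertices has at least
    \<open>k * (n - k)\<close> edges, which doubled is \<open>2 * k * n\<close> less this
    constant.\<close>
  define C where "C = 2 * k * k"
  define big where "big = 2 * (sum_list ds + length ds + sum_list ls) + 4"
  obtain n1 where n1: "\<And>(E :: nat set set) V. simple_edges E \<Longrightarrow> finite V \<Longrightarrow> n1 \<le> card V \<Longrightarrow>
    packs E V (map star_graph ds) \<Longrightarrow> \<not> packs E V ?As \<Longrightarrow>
    2 * (length ds + cover_sum ls - 1) * card V \<le> 2 * esize E V + C \<Longrightarrow>
    \<exists>T\<subseteq>V. card T = length ds \<and> \<not> packs E (V - T) (map path_graph ls)"
    by (rule star_centres_extract[of ls ds C]) (use ls2 ds len assms(2) in auto)
  have ls_split': "ls = (ls0 @ [l']) @ [m]" using ls_split by simp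
  obtain n2 where n2: "\<And>(E :: nat set set) X. simple_edges E \<Longrightarrow> finite X \<Longrightarrow> n2 \<le> card X \<Longrightarrow>
    \<not> packs E X (map path_graph ls) \<Longrightarrow>
    2 * (cover_sum ls - 1) * card X \<le> 2 * esize E X + C \<Longrightarrow>
    \<exists>A\<subseteq>X. card A = cover_sum (ls0 @ [l']) \<and> (\<forall>xs. is_path E (X - A) xs \<longrightarrow> length xs \<noteq> m)"
    using linear_forest_extract[of "ls0 @ [l']" m C] ls2 unfolding ls_split' by blast
  obtain n3 where n3: "\<And>(E :: nat set set) V K. simple_edges E \<Longrightarrow> finite V \<Longrightarrow> n3 \<le> card V \<Longrightarrow>
    \<not> packs E V ?As \<Longrightarrow>
    2 * (length ds + cover_sum ls - 1) * card V \<le> 2 * esize E V + C \<Longrightarrow>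
    K \<subseteq> V \<Longrightarrow> card K = length ds + cover_sum (ls0 @ [l']) \<Longrightarrow>
    \<forall>xs. is_path E (V - K) xs \<longrightarrow> length xs \<noteq> m \<Longrightarrow>
    \<exists>K'\<subseteq>V. card K' = length ds + cover_sum ls - 1 \<and> big \<le> card (common_nbrs E (V - K') K')"
    unfolding ls_split by (rule extend_to_full_core[of m l' ds ls0 C big]) (use ls2 ls_split \<open>m \<le> l'\<close> ds in auto)
  show ?thesis
  \<comment> \<open>The summand \<open>t\<close> keeps \<open>n2\<close> vertices after the centres
    are deleted, and \<open>k + 2\<close> makes the subtractions from \<open>n\<close>
    exact.\<close>
  proof (intro exI[of _ "n1 + n2 + n3 + t + k + 2"] allI impI ballI)
    fix n G assume n: "n1 + n2 + n3 + t + k + 2 \<le> n" and "G \<in> extremal_graphs n F"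
    define V E where "V = verts G" and "E = edges G"
    from \<open>G \<in> extremal_graphs n F\<close> have G: "simple_graph G" "card V = n" "graph_free F G"
      and max: "\<And>H :: nat graph. simple_graph H \<Longrightarrow> graph_order H = n \<Longrightarrow> graph_free F H \<Longrightarrow>
        card (edges H) \<le> card E"
      by (auto simp: extremal_graphs_def graph_order_def V_def E_def)
    have finV: "finite V" and E: "simple_edges E"
      using G(1) by (auto simp: simple_graph_def simple_edges_def V_def E_def)
    have free: "\<not> packs E V ?As" using free_F[OF G(1)] G(3) by (simp add: V_def E_def)
    have extremal: "card E' \<le> card E"
      if "simple_edges E'" "\<forall>e\<in>E'. e \<subseteq> V" "\<not> packs E' V ?As" for E'
    proof -
      let ?H = "\<lparr>verts = V, edges = E'\<rparr>"
      have "simple_graph ?H" using that finV by (auto simp: simple_graph_def simple_edges_def)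
      moreover from this have "graph_free F ?H" using free_F[of ?H] that(3) by simp
      ultimately show ?thesis using max[of ?H] G(2) by (simp add: graph_order_def)
    qed
    show "(\<exists>H\<in>extremal_graphs n S. G \<simeq>\<^sub>g H)
    \<or> ((\<forall>j\<in>{1..r}. l j = 3) \<and>
        (\<exists>M. maximum_matching_on
               (Inr ` verts (graph_complement (complete_graph (n - t - b + 1)))) M \<and>
             G \<simeq>\<^sub>g add_edges
               (graph_join (complete_graph (t + b - 1))
                  (graph_complement (complete_graph (n - t - b + 1)))) M))
    \<or> ((\<forall>j\<in>{1..r}. odd (l j)) \<and> (\<exists>j\<in>{1..r}. l j \<noteq> 3) \<and>
        G \<simeq>\<^sub>g graph_join (complete_graph (t + b - 1))
               (graph_union (complete_graph 2)
                  (graph_complement (complete_graph (n - t - b - 1)))))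
    \<or> ((\<exists>j\<in>{1..r}. even (l j)) \<and>
        G \<simeq>\<^sub>g graph_join (complete_graph (t + b - 1))
               (graph_complement (complete_graph (n - t - b + 1))))"
    proof (cases "graph_free S G")
      case True
      \<comment> \<open>Every graph free of \<open>S\<close> is free of \<open>F\<close>, so
        \<open>G\<close> is also maximal among the competitors for \<open>S\<close>.\<close>
      then have "G \<in> extremal_graphs n S"
        using G(1,2) max free_mono by (auto simp: extremal_graphs_def graph_order_def V_def E_def)
      then show ?thesis using graph_iso_refl by blast
    next
      case False
      then have stars: "packs E V (map star_graph ds)" using free_S[OF G(1)] by (simp add: V_def E_def)
      have card_E: "card E = esize E V"
        using G(1) unfolding esize_def by (intro arg_cong[of _ _ card]) (auto simp: simple_graph_def V_def E_def)
      have k': "length ds + cover_sum ls - 1 = k" using k len b by simp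
      have "k \<le> card V" using n G(2) by simp
      \<comment> \<open>Any \<open>k\<close> vertices serve as the core of the competitor that
        bounds \<open>card E\<close> from below.\<close>
      then obtain K0 where K0: "K0 \<subseteq> V" "card K0 = k" by (rule obtain_subset_with_card_n)
      have "\<not> packs (core_edges V K0 \<union> {}) V ?As"
        by (rule core_matching_free[OF finV K0(1) _ ds(2)])
          (use K0(2) k len b in \<open>simp_all add: matching_on_def disjoint_def\<close>)
      then have "card (core_edges V K0) \<le> card E"
        using core_edges_subset[OF K0(1)] by (intro extremal simple_core_edges) auto
      then have "k * (n - k) \<le> esize E V"
        using core_edges_card_ge[OF finV K0(1)] K0(2) G(2) card_E by simp
      moreover have "k * n = k * (n - k) + k * k"
        using n by (metis add_mult_distrib2 le_add_diff_inverse2 \<open>k \<le> card V\<close> G(2))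
      ultimately have dense: "2 * k * card V \<le> 2 * esize E V + C" by (simp add: C_def G(2))
      obtain T where T: "T \<subseteq> V" "card T = t" "\<not> packs E (V - T) (map path_graph ls)"
        using n1[OF E finV _ stars free] dense n G(2) len k' by auto
      have finT: "finite T" using T(1) finV finite_subset by blast
      have cVT: "card (V - T) = n - t" using T G(2) finT by (simp add: card_Diff_subset)
      have "esize E V \<le> esize E (V - T) + t * card V"
        using esize_remove_le[OF E finV T(1)] T(2) by simp
      \<comment> \<open>Since \<open>k = t + (b - 1)\<close>, deleting the \<open>t\<close> centres
        removes at most their share of the count, and the hypothesis for the paths holds with the
        same \<open>C\<close>.\<close>
      moreover have "2 * k * card V = 2 * (b - 1) * card V + 2 * (t * card V)"
        using \<open>1 \<le> b\<close> by (cases b) (simp_all add: k_def algebra_simps)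
      moreover have "2 * (b - 1) * card (V - T) \<le> 2 * (b - 1) * card V"
        using finV by (intro mult_le_mono card_mono) auto
      ultimately have "2 * (b - 1) * card (V - T) \<le> 2 * esize E (V - T) + C" using dense by linarith
      moreover have "n2 \<le> card (V - T)" using n unfolding cVT by linarith
      ultimately obtain A where A: "A \<subseteq> V - T" "card A = cover_sum (ls0 @ [l'])"
        "\<forall>xs. is_path E (V - T - A) xs \<longrightarrow> length xs \<noteq> m"
        using n2[OF E, of "V - T"] finV T(3) b by auto
      have "card (T \<union> A) = length ds + cover_sum (ls0 @ [l'])"
        using A(1,2) T(2) finT finV len finite_subset[of A "V - T"] by (subst card_Un_disjoint) auto
      moreover have "V - (T \<union> A) = V - T - A" "T \<union> A \<subseteq> V" using A(1) T(1) by auto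
      ultimately obtain K where core: "K \<subseteq> V" "card K = k" "big \<le> card (common_nbrs E (V - K) K)"
        using n3[OF E finV _ free, of "T \<union> A"] dense n G(2) A(3) k' by auto
      interpret extremal_forest_core E V K ds ls
      proof
        show "Suc (card K) = length ds + cover_sum ls" using core(2) k len b by simp
        show "2 * (sum_list ds + length ds + sum_list ls) + 4 \<le> card (common_nbrs E (V - K) K)"
          using core(3) by (simp add: big_def)
        show "e \<subseteq> V" if "e \<in> E" for e using that G(1) by (auto simp: simple_graph_def V_def E_def)
        show "2 \<le> length ls" using len assms(2) by simp
      qed (use E finV free extremal core ds ls2 in auto)
      have "card (V - K) = n - k" using card_Diff_subset[OF finK core(1)] core(2) G(2) by simp
      then have outer: "card (verts G - K) = n - t - b + 1"
        using n k unfolding V_def[symmetric] by linarith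
      have finG: "finite (verts G)" and KG: "K \<subseteq> verts G" using finV core(1) by (simp_all add: V_def)
      consider (even) "\<exists>l\<in>set ls. even l" | (three) "\<forall>l\<in>set ls. l = 3"
        | (odd) "\<forall>l\<in>set ls. odd l" "\<exists>l\<in>set ls. l \<noteq> 3" by blast
      then show ?thesis
      proof cases
        case even
        have "G \<simeq>\<^sub>g graph_join (complete_graph k) (graph_complement (complete_graph (n - t - b + 1)))"
          using structure_even[OF even] unfolding E_def V_def by (rule iso_join_empty[OF finG KG core(2) outer])
        moreover have "\<exists>j\<in>{1..r}. even (l j)" using even set_ls by auto
        ultimately show ?thesis unfolding k_def by blast
      next
        case three
        obtain M where "maximum_matching_on (V - K) M" "E = core_edges V K \<union> M"
          by (rule structure_3[OF three])
        then have "\<exists>M. maximum_matching_on (Inr ` verts (graph_complement (complete_graph (n - t - b + 1)))) M \<and>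
          G \<simeq>\<^sub>g add_edges (graph_join (complete_graph k) (graph_complement (complete_graph (n - t - b + 1)))) M"
          unfolding E_def V_def by (intro iso_join_matching[OF finG KG core(2) outer])
        moreover have "\<forall>j\<in>{1..r}. l j = 3" using three set_ls by auto
        ultimately show ?thesis unfolding k_def by blast
      next
        case odd
        obtain x y where xy: "x \<in> V - K" "y \<in> V - K" "x \<noteq> y" "E = core_edges V K \<union> {{x, y}}"
          by (rule structure_odd[OF odd])
        have "card (verts G - K) = (n - t - b - 1) + 2"
          using outer outer_ge_2 unfolding V_def[symmetric] by linarith
        then have "G \<simeq>\<^sub>g graph_join (complete_graph k)
            (graph_union (complete_graph 2) (graph_complement (complete_graph (n - t - b - 1))))"
          using xy unfolding E_def V_def by (intro iso_join_edge[OF finG KG core(2)])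
        moreover have "\<forall>j\<in>{1..r}. odd (l j)" "\<exists>j\<in>{1..r}. l j \<noteq> 3" using odd set_ls by auto
        ultimately show ?thesis unfolding k_def by blast
      qed
    qed
  qed
qed

end
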